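(* Let $J\subset S$ be a bigraded ideal. If $\mathrm{char}(K)=0$, then $$\mathrm{reg}_x^S(S/J)=\mathrm{reg}_x^S(S/\mathrm{bigin}(J)).$$
   Context: $K$ is an infinite field and $S=K[x_1,\dots,x_n,y_1,\dots,y_m]$ is the standard bigraded polynomial ring with $\deg x_i=(1,0)$, $\deg y_j=(0,1)$. For a finitely generated bigraded $S$-module $M$, $\mathrm{reg}_x^S(M)=\sup\{a\in\mathbb Z:\mathrm{Tor}^S_i(M,K)_{(a+i,b)}\ne0\text{ for some }i,b\in\mathbb Z\}$. Term order: for $u,u'\in\mathbb N^n$, $v,v'\in\mathbb N^m$ (with $\mathbb N=\{0,1,2,\dots\}$ and $|u|=\sum u_i$), $x^uy^v>x^{u'}y^{v'}$ if either $(|u|+|v|,|v|,|u|)>(|u'|+|v'|,|v'|,|u'|)$ lexicographically, or these triples are equal and $x^uy^v>x^{u'}y^{v'}$ in the reverse lexicographic order induced by $y_1>\dots>y_m>x_1>\dots>x_n$. For an ideal $I$, $\mathrm{in}(I)$ is the monomial ideal generated by the leading monomials $\mathrm{in}(f)$, $0\ne f\in I$. Bigeneric initial ideal: let $G=\mathrm{GL}(n,K)\times\mathrm{GL}(m,K)$. An element $g=(d_{ij},e_{kl})\in G$ acts on $S$ as the $K$-algebra automorphism with $g(x_j)=\sum_id_{ij}x_i$ and $g(y_l)=\sum_ke_{kl}y_k$. For every bigraded ideal $J$ there is a nonempty Zariski open set $U\subset G$ such that $\mathrm{in}(gJ)$ is the same ideal for all $g\in U$; this ideal is denoted $\mathrm{bigin}(J)$.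 *)

theory Defs
  imports
    "HOL-Algebra.QuotRing"
    "HOL-Algebra.Module"
    "HOL-Library.Poly_Mapping"
    "HOL-Library.Product_Plus"
    "HOL-Library.Extended_Real"
    "Jordan_Normal_Form.Matrix"
begin

section \<open>The bigraded polynomial ring\<close>

text \<open>The pair \<open>(u, v)\<close> stands for the monomial \<open>x\<^sup>u y\<^sup>v\<close>. All indices start at 0, so
  the variables are \<open>x 0, \<dots>, x (n - 1), y 0, \<dots>, y (m - 1)\<close>.\<close>

type_synonym bimon = "(nat \<Rightarrow>\<^sub>0 nat) \<times> (nat \<Rightarrow>\<^sub>0 nat)"
type_synonym 'k bipoly = "bimon \<Rightarrow>\<^sub>0 'k"

abbreviation lookup :: "('a \<Rightarrow>\<^sub>0 'b::zero) \<Rightarrow> 'a \<Rightarrow> 'b" where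
  "lookup \<equiv> Poly_Mapping.lookup"

abbreviation keys :: "('a \<Rightarrow>\<^sub>0 'b::zero) \<Rightarrow> 'a set" where
  "keys \<equiv> Poly_Mapping.keys"

definition mdeg :: "(nat \<Rightarrow>\<^sub>0 nat) \<Rightarrow> nat" where
  "mdeg u = (\<Sum>i\<in>keys u. lookup u i)"

definition bideg :: "bimon \<Rightarrow> int \<times> int" where
  "bideg w = (int (mdeg (fst w)), int (mdeg (snd w)))"

definition bimonom :: "bimon \<Rightarrow> 'k::field bipoly" where
  "bimonom w = Poly_Mapping.single w 1"

definition bconst :: "'k::field \<Rightarrow> 'k bipoly" where
  "bconst c = Poly_Mapping.single 0 c"

definition x_var :: "nat \<Rightarrow> 'k::field bipoly" where
  "x_var i = bimonom (Poly_Mapping.single i 1, 0)"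

definition y_var :: "nat \<Rightarrow> 'k::field bipoly" where
  "y_var i = bimonom (0, Poly_Mapping.single i 1)"

definition bipoly_ring :: "nat \<Rightarrow> nat \<Rightarrow> 'k::field bipoly ring" where
  "bipoly_ring n m =
    \<lparr>carrier = {f. \<forall>(u, v)\<in>keys f. keys u \<subseteq> {..<n} \<and> keys v \<subseteq> {..<m}},
     monoid.mult = (*), one = 1, zero = 0, add = (+)\<rparr>"

definition bihom :: "nat \<Rightarrow> nat \<Rightarrow> int \<times> int \<Rightarrow> 'k::field bipoly set" where
  "bihom n m c = {f \<in> carrier (bipoly_ring n m). \<forall>w\<in>keys f. bideg w = c}"

definition bigraded_ideal :: "nat \<Rightarrow> nat \<Rightarrow> 'k::field bipoly set \<Rightarrow> bool" where
  "bigraded_ideal n m J \<longleftrightarrow>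
    ideal J (bipoly_ring n m) \<and>
    J = Idl\<^bsub>bipoly_ring n m\<^esub> {f \<in> J. \<exists>c. f \<in> bihom n m c}"


section \<open>The term order and initial ideals\<close>

text \<open>The reverse lexicographic order induced by
  \<open>y 0 > \<dots> > y (m - 1) > x 0 > \<dots> > x (n - 1)\<close>, for monomials of the same total degree:
  the larger monomial has the smaller exponent at the last variable where they differ.\<close>

definition revlex_greater :: "bimon \<Rightarrow> bimon \<Rightarrow> bool" where
  "revlex_greater w w' \<longleftrightarrow>
    (\<exists>k. lookup (fst w) k < lookup (fst w') k \<and>
         (\<forall>i>k. lookup (fst w) i = lookup (fst w') i)) \<or>
    (fst w = fst w' \<and>
     (\<exists>k. lookup (snd w) k < lookup (snd w') k \<and>
          (\<forall>i>k. lookup (snd w) i = lookup (snd w') i)))"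

definition degree_triple :: "bimon \<Rightarrow> nat \<times> nat \<times> nat" where
  "degree_triple w = (mdeg (fst w) + mdeg (snd w), mdeg (snd w), mdeg (fst w))"

definition mon_greater :: "bimon \<Rightarrow> bimon \<Rightarrow> bool" where
  "mon_greater w w' \<longleftrightarrow>
    (degree_triple w', degree_triple w) \<in> less_than <*lex*> less_than <*lex*> less_than \<or>
    (degree_triple w = degree_triple w' \<and> revlex_greater w w')"

definition lead_mon :: "'k::field bipoly \<Rightarrow> bimon" where
  "lead_mon f = (THE w. w \<in> keys f \<and> (\<forall>w'\<in>keys f. w' \<noteq> w \<longrightarrow> mon_greater w w'))"

definition initial_ideal :: "nat \<Rightarrow> nat \<Rightarrow> 'k::field bipoly set \<Rightarrow> 'k bipoly set" where
  "initial_ideal n m I = Idl\<^bsub>bipoly_ring n m\<^esub> {bimonom (lead_mon f) | f. f \<in> I \<and> f \<noteq> 0}"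


section \<open>The group action and the bigeneric initial ideal\<close>

definition GL :: "nat \<Rightarrow> 'k::field mat set" where
  "GL n = {A \<in> carrier_mat n n. invertible_mat A}"

definition act :: "nat \<Rightarrow> nat \<Rightarrow> 'k::field mat \<times> 'k mat \<Rightarrow> 'k bipoly \<Rightarrow> 'k bipoly" where
  "act n m g f =
    (\<Sum>(u, v)\<in>keys f. bconst (lookup f (u, v))
       * (\<Prod>j\<in>keys u. (\<Sum>i<n. bconst (fst g $$ (i, j)) * x_var i) ^ lookup u j)
       * (\<Prod>l\<in>keys v. (\<Sum>k<m. bconst (snd g $$ (k, l)) * y_var k) ^ lookup v l))"

text \<open>Polynomial functions on pairs of matrices \<open>(d, e)\<close>: the variable \<open>Inl (i, j)\<close>
  stands for \<open>d\<^bsub>ij\<^esub>\<close>, and \<open>Inr (k, l)\<close> for \<open>e\<^bsub>kl\<^esub>\<close>.\<close>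

type_synonym entry_var = "nat \<times> nat + nat \<times> nat"
type_synonym 'k entry_poly = "(entry_var \<Rightarrow>\<^sub>0 nat) \<Rightarrow>\<^sub>0 'k"

definition entry :: "'k mat \<times> 'k mat \<Rightarrow> entry_var \<Rightarrow> 'k" where
  "entry g z = (case z of Inl ij \<Rightarrow> fst g $$ ij | Inr kl \<Rightarrow> snd g $$ kl)"

definition entry_polys :: "nat \<Rightarrow> nat \<Rightarrow> 'k::field entry_poly set" where
  "entry_polys n m =
    {p. \<forall>w\<in>keys p. keys w \<subseteq> ({..<n} \<times> {..<n}) <+> ({..<m} \<times> {..<m})}"

definition entry_eval :: "'k::field entry_poly \<Rightarrow> 'k mat \<times> 'k mat \<Rightarrow> 'k" where
  "entry_eval p g = (\<Sum>w\<in>keys p. lookup p w * (\<Prod>z\<in>keys w. entry g z ^ lookup w z))"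

text \<open>Closed subsets of the principal open set \<open>GL n \<times> GL m\<close> of affine space are cut out by
  polynomials in the entries, since the inverse determinants are units.\<close>

definition zariski_open :: "nat \<Rightarrow> nat \<Rightarrow> ('k::field mat \<times> 'k mat) set \<Rightarrow> bool" where
  "zariski_open n m U \<longleftrightarrow>
    (\<exists>P \<subseteq> entry_polys n m. U = (GL n \<times> GL m) - {g. \<forall>p\<in>P. entry_eval p g = 0})"

definition bigin :: "nat \<Rightarrow> nat \<Rightarrow> 'k::field bipoly set \<Rightarrow> 'k bipoly set" where
  "bigin n m J =
    (THE I. \<exists>U. zariski_open n m U \<and> U \<noteq> {} \<and>
       (\<forall>g\<in>U. initial_ideal n m (act n m g ` J) = I))"


section \<open>Bigraded free resolutions, Tor and the x-regularity\<close>

text \<open>\<open>F\<^sub>i\<close> is the direct sum of the \<open>S(- shift i j)\<close> with \<open>j < rank i\<close>, that is, a free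
  module with basis elements of bidegree \<open>shift i j\<close>, and its elements are
  vectors of length \<open>rank i\<close>. The matrix \<open>diff i\<close> represents the differential from
  \<open>F\<^bsub>i+1\<^esub>\<close> to \<open>F\<^sub>i\<close>, and \<open>aug j\<close> is the image in \<open>M\<close> of the \<open>j\<close>-th basis element of
  \<open>F\<^sub>0\<close>.\<close>

record (overloaded) ('k::zero, 'b) free_complex =
  rank :: "nat \<Rightarrow> nat"
  shift :: "nat \<Rightarrow> nat \<Rightarrow> int \<times> int"
  diff :: "nat \<Rightarrow> 'k bipoly mat"
  aug :: "nat \<Rightarrow> 'b"

definition free_vecs ::
  "nat \<Rightarrow> nat \<Rightarrow> ('k::field, 'b) free_complex \<Rightarrow> nat \<Rightarrow> 'k bipoly vec set" where
  "free_vecs n m F i =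
    {v \<in> carrier_vec (rank F i). \<forall>j<rank F i. v $ j \<in> carrier (bipoly_ring n m)}"

definition aug_map ::
  "('k::field bipoly, 'b) module \<Rightarrow> ('k, 'b) free_complex \<Rightarrow> 'k bipoly vec \<Rightarrow> 'b" where
  "aug_map M F v = (\<Oplus>\<^bsub>M\<^esub>j\<in>{..<rank F 0}. (v $ j) \<odot>\<^bsub>M\<^esub> aug F j)"

text \<open>A bigraded module is given by a module \<open>M\<close> together with its family \<open>D\<close> of
  homogeneous components.\<close>

definition bigraded_free_resolution ::
  "nat \<Rightarrow> nat \<Rightarrow> ('k::field bipoly, 'b) module \<Rightarrow> (int \<times> int \<Rightarrow> 'b set) \<Rightarrow>
   ('k, 'b) free_complex \<Rightarrow> bool" where
  "bigraded_free_resolution n m M D F \<longleftrightarrow>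
    (\<forall>j<rank F 0. aug F j \<in> D (shift F 0 j)) \<and>
    (\<forall>i. diff F i \<in> carrier_mat (rank F i) (rank F (Suc i))) \<and>
    (\<forall>i. \<forall>k<rank F i. \<forall>j<rank F (Suc i).
       diff F i $$ (k, j) \<in> bihom n m (shift F (Suc i) j - shift F i k)) \<and>
    aug_map M F ` free_vecs n m F 0 = carrier M \<and>
    {v \<in> free_vecs n m F 0. aug_map M F v = \<zero>\<^bsub>M\<^esub>} =
      (\<lambda>v. diff F 0 *\<^sub>v v) ` free_vecs n m F 1 \<and>
    (\<forall>i. {v \<in> free_vecs n m F (Suc i). diff F i *\<^sub>v v = 0\<^sub>v (rank F i)} =
      (\<lambda>v. diff F (Suc i) *\<^sub>v v) ` free_vecs n m F (Suc (Suc i)))"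

text \<open>As \<open>K = S / (x, y)\<close>, tensoring with \<open>K\<close> turns \<open>F\<^sub>i\<close> into \<open>K\<close>-vectors of length
  \<open>rank i\<close>, and each matrix is reduced to the constant coefficients of its entries.\<close>

definition diff_K :: "('k::field, 'b) free_complex \<Rightarrow> nat \<Rightarrow> 'k mat" where
  "diff_K F i = map_mat (\<lambda>f. lookup f 0) (diff F i)"

definition vecs_K :: "('k::field, 'b) free_complex \<Rightarrow> nat \<Rightarrow> int \<times> int \<Rightarrow> 'k vec set" where
  "vecs_K F i c =
    {z \<in> carrier_vec (rank F i). \<forall>j<rank F i. z $ j \<noteq> 0 \<longrightarrow> shift F i j = c}"

fun cycles_K :: "('k::field, 'b) free_complex \<Rightarrow> nat \<Rightarrow> int \<times> int \<Rightarrow> 'k vec set" where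
  "cycles_K F 0 c = vecs_K F 0 c"
| "cycles_K F (Suc i) c = {z \<in> vecs_K F (Suc i) c. diff_K F i *\<^sub>v z = 0\<^sub>v (rank F i)}"

definition boundaries_K ::
  "('k::field, 'b) free_complex \<Rightarrow> nat \<Rightarrow> int \<times> int \<Rightarrow> 'k vec set" where
  "boundaries_K F i c = (\<lambda>z. diff_K F i *\<^sub>v z) ` vecs_K F (Suc i) c"

definition homology_K ::
  "('k::field, 'b) free_complex \<Rightarrow> nat \<Rightarrow> int \<times> int \<Rightarrow> 'k vec set monoid" where
  "homology_K F i c =
    (module_vec TYPE('k) (rank F i))\<lparr>carrier := cycles_K F i c\<rparr> A_Mod boundaries_K F i c"

text \<open>The component of bidegree \<open>c\<close> of \<open>Tor\<^sub>i\<^sup>S(M, K)\<close>, computed from a chosen bigraded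
  free resolution of \<open>M\<close> (up to isomorphism, it does not depend on the choice). Finitely
  generated bigraded modules over the noetherian ring \<open>S\<close> have resolutions with all
  \<open>F\<^sub>i\<close> of finite rank.\<close>

definition Tor_K ::
  "nat \<Rightarrow> nat \<Rightarrow> ('k::field bipoly, 'b) module \<Rightarrow> (int \<times> int \<Rightarrow> 'b set) \<Rightarrow>
   nat \<Rightarrow> int \<times> int \<Rightarrow> 'k vec set monoid" where
  "Tor_K n m M D i c = homology_K (SOME F. bigraded_free_resolution n m M D F) i c"

text \<open>For the zero module this is \<open>-\<infinity>\<close>.\<close>

definition reg_x ::
  "nat \<Rightarrow> nat \<Rightarrow> ('k::field bipoly, 'b) module \<Rightarrow> (int \<times> int \<Rightarrow> 'b set) \<Rightarrow> ereal" where
  "reg_x n m M D =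
    Sup {ereal (real_of_int a) | a i b.
      carrier (Tor_K n m M D i (a + int i, b)) \<noteq> {\<one>\<^bsub>Tor_K n m M D i (a + int i, b)\<^esub>}}"


section \<open>The bigraded module S/J\<close>

definition quot_module ::
  "nat \<Rightarrow> nat \<Rightarrow> 'k::field bipoly set \<Rightarrow> ('k bipoly, 'k bipoly set) module" where
  "quot_module n m J =
    (let S = bipoly_ring n m; Q = S Quot J in
     \<lparr>carrier = carrier Q, monoid.mult = monoid.mult Q, one = one Q, zero = zero Q, add = add Q,
      smult = (\<lambda>f X. (J +>\<^bsub>S\<^esub> f) \<otimes>\<^bsub>Q\<^esub> X)\<rparr>)"

definition quot_bihom ::
  "nat \<Rightarrow> nat \<Rightarrow> 'k::field bipoly set \<Rightarrow> int \<times> int \<Rightarrow> 'k bipoly set set" where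
  "quot_bihom n m J c = (\<lambda>f. J +>\<^bsub>bipoly_ring n m\<^esub> f) ` bihom n m c"

abbreviation reg_x_quot :: "nat \<Rightarrow> nat \<Rightarrow> 'k::field bipoly set \<Rightarrow> ereal" where
  "reg_x_quot n m J \<equiv> reg_x n m (quot_module n m J) (quot_bihom n m J)"

end

theory Submission
  imports Defs "HOL-Library.Function_Algebras" "Jordan_Normal_Form.Determinant"
    "HOL-Computational_Algebra.Polynomial"
begin

text \<open>Let \<open>F\<close> be a bigraded free resolution of \<open>S/J\<close>, so that Tor is the homology of \<open>F\<close> with all
  variables set to zero. Restoring the variables one at a time, first \<open>y\<^sub>0, \<dots>, y\<^bsub>m-1\<^esub>\<close> and then
  \<open>x\<^sub>0, \<dots>, x\<^bsub>n-1\<^esub>\<close>, gives a chain of complexes from \<open>F \<otimes> K\<close> to \<open>F\<close>, whose neighbours are linked by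
  the long exact sequence of the multiplication by a variable (\<open>mult_sequence\<close>). Passing over a
  variable \<open>y\<close> does not change the bounds on \<open>x\<close>-degrees, by Nakayama's lemma. Suppose that
  each \<open>x\<^sub>a\<close> is injective on \<open>S/(J + (x\<^bsub>a+1\<^esub>, \<dots>, x\<^bsub>n-1\<^esub>))\<close> in large \<open>x\<close>-degrees. Then the \<open>x\<close>-regularity
  is at most \<open>r\<close> if and only if these maps are injective in all \<open>x\<close>-degrees above \<open>r\<close> and
  \<open>S/(J + (x\<^sub>0, \<dots>, x\<^bsub>n-1\<^esub>))\<close> is zero there (\<open>regularity_criterion\<close>).

  The order is reverse lexicographic with the variables \<open>x\<^bsub>n-1\<^esub>, x\<^bsub>n-2\<^esub>, \<dots>\<close> last, and for such an order
  both conditions depend on the leading monomials of \<open>J\<close> only (\<open>agrees_x_iff_leads\<close>). So two bigraded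
  ideals with the same leading monomials have the same \<open>x\<close>-regularity, provided that the leading
  monomials satisfy the injectivity in large degrees (\<open>tor_bound_by_leads\<close>). This applies to the ideals
  \<open>gJ\<close>, for generic \<open>g\<close>, and \<open>bigin(J)\<close>, while \<open>J\<close> and \<open>gJ\<close> have the same Tor, as \<open>g\<close> carries a
  resolution of \<open>S/J\<close> to one of \<open>S/gJ\<close> (\<open>is_res_act\<close>).

  Generic leading monomials exist by elimination with polynomial functions of the matrix entries
  in each bidegree, and finitely many bidegrees suffice by Dickson's lemma (\<open>generic_leads_exist\<close>). In
  characteristic \<open>0\<close> they are strongly stable: the substitution \<open>x\<^sub>a \<mapsto> x\<^sub>a + t x\<^sub>i\<close> preserves genericity
  for almost all \<open>t\<close>, and the coefficient of \<open>t\<close> in the result is the derivative by \<open>x\<^sub>a\<close>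
  multiplied by \<open>x\<^sub>i\<close> (\<open>lead_set_shear_stable\<close>). Strong stability implies the injectivity in large
  degrees (\<open>strongly_stable_x_filter_regular\<close>).\<close>

section \<open>Polynomials as linear combinations of monomials\<close>

lemma single_eq_bconst_bimonom: "Poly_Mapping.single w c = bconst c * bimonom w"
  by (simp add: bconst_def bimonom_def mult_single)

lemma lookup_sum_single:
  "finite A \<Longrightarrow> lookup (\<Sum>w\<in>A. Poly_Mapping.single w (g w)) v = (if v \<in> A then g v else 0)"
  by (simp add: lookup_sum lookup_single when_def)

lemma poly_mapping_expand:
  assumes "finite A" "keys f \<subseteq> A"
  shows "f = (\<Sum>w\<in>A. Poly_Mapping.single w (lookup f w))"
  using assms by (intro poly_mapping_eqI) (auto simp: lookup_sum_single in_keys_iff)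

lemma single_mult_expand:
  fixes g :: "'a::cancel_comm_monoid_add \<Rightarrow>\<^sub>0 'b::comm_semiring_1"
  shows "Poly_Mapping.single u a * g = (\<Sum>w\<in>keys g. Poly_Mapping.single (u + w) (a * lookup g w))"
proof -
  have "Poly_Mapping.single u a * g
      = Poly_Mapping.single u a * (\<Sum>w\<in>keys g. Poly_Mapping.single w (lookup g w))"
    by (rule arg_cong[OF poly_mapping_expand]) simp_all
  then show ?thesis by (simp add: sum_distrib_left mult_single)
qed

lemma lookup_single_mult:
  fixes g :: "'a::cancel_comm_monoid_add \<Rightarrow>\<^sub>0 'b::comm_semiring_1"
  shows "lookup (Poly_Mapping.single u a * g) (u + w) = a * lookup g w"
proof -
  have "lookup (Poly_Mapping.single u a * g) (u + w)
      = (\<Sum>w'\<in>keys g. if w' = w then a * lookup g w' else 0)"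
    unfolding single_mult_expand lookup_sum
    by (rule sum.cong) (auto simp: lookup_single when_def)
  also have "\<dots> = a * lookup g w" by (simp add: in_keys_iff)
  finally show ?thesis .
qed

lemma lookup_bconst_mult: "lookup (bconst a * f) w = a * lookup f w"
  using lookup_single_mult[of 0 a f w] by (simp add: bconst_def)

lemma lookup_single_mult_eq_0:
  fixes g :: "'a::cancel_comm_monoid_add \<Rightarrow>\<^sub>0 'b::comm_semiring_1"
  assumes "\<And>w. v \<noteq> u + w"
  shows "lookup (Poly_Mapping.single u a * g) v = 0"
  unfolding single_mult_expand lookup_sum
  using assms by (intro sum.neutral) (auto simp: lookup_single when_def)

lemma keys_single_mult:
  fixes g :: "'a::cancel_comm_monoid_add \<Rightarrow>\<^sub>0 'b::{comm_semiring_1, semiring_no_zero_divisors}"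
  assumes "a \<noteq> 0"
  shows "keys (Poly_Mapping.single u a * g) = (+) u ` keys g"
proof (rule Set.set_eqI)
  fix v
  show "v \<in> keys (Poly_Mapping.single u a * g) \<longleftrightarrow> v \<in> (+) u ` keys g"
  proof (cases "\<exists>w. v = u + w")
    case True
    then obtain w where "v = u + w" by blast
    then show ?thesis using assms by (auto simp: in_keys_iff lookup_single_mult)
  next
    case False
    then show ?thesis by (auto simp: in_keys_iff lookup_single_mult_eq_0)
  qed
qed

lemma mult_expand:
  fixes f g :: "'a::cancel_comm_monoid_add \<Rightarrow>\<^sub>0 'b::comm_semiring_1"
  shows "f * g = (\<Sum>u\<in>keys f. Poly_Mapping.single u (lookup f u) * g)"
proof -
  have "f * g = (\<Sum>u\<in>keys f. Poly_Mapping.single u (lookup f u)) * g"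
    by (rule arg_cong[OF poly_mapping_expand]) simp_all
  then show ?thesis by (simp add: sum_distrib_right)
qed

text \<open>Linear changes of coordinates and the evaluation of polynomials in matrix entries are both of
  this form: monomials are mapped multiplicatively, coefficients through a ring homomorphism.\<close>

definition lin_ext ::
  "('k::comm_ring_1 \<Rightarrow> 'r::comm_ring_1) \<Rightarrow> ('a \<Rightarrow> 'r) \<Rightarrow> ('a \<Rightarrow>\<^sub>0 'k) \<Rightarrow> 'r" where
  "lin_ext \<kappa> \<mu> f = (\<Sum>w\<in>keys f. \<kappa> (lookup f w) * \<mu> w)"

locale coeff_hom =
  fixes \<kappa> :: "'k::comm_ring_1 \<Rightarrow> 'r::comm_ring_1"
  assumes hom_add: "\<kappa> (a + b) = \<kappa> a + \<kappa> b"
    and hom_mult: "\<kappa> (a * b) = \<kappa> a * \<kappa> b"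
    and hom_one: "\<kappa> 1 = 1"
begin

lemma hom_zero: "\<kappa> 0 = 0"
  using hom_add[of 0 0] by simp

lemma lin_ext_superset:
  assumes "finite A" "keys f \<subseteq> A"
  shows "lin_ext \<kappa> \<mu> f = (\<Sum>w\<in>A. \<kappa> (lookup f w) * \<mu> w)"
  unfolding lin_ext_def using assms
  by (intro sum.mono_neutral_left) (auto simp: in_keys_iff hom_zero)

lemma lin_ext_zero [simp]: "lin_ext \<kappa> \<mu> 0 = 0"
  by (simp add: lin_ext_def)

lemma lin_ext_add: "lin_ext \<kappa> \<mu> (f + g) = lin_ext \<kappa> \<mu> f + lin_ext \<kappa> \<mu> g"
proof -
  let ?A = "keys f \<union> keys g"
  have "keys (f + g) \<subseteq> ?A" by (rule Poly_Mapping.keys_add)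
  then show ?thesis
    by (simp add: lin_ext_superset[of ?A] lookup_add hom_add distrib_right sum.distrib)
qed

lemma lin_ext_sum: "lin_ext \<kappa> \<mu> (\<Sum>i\<in>I. f i) = (\<Sum>i\<in>I. lin_ext \<kappa> \<mu> (f i))"
  by (induction I rule: infinite_finite_induct) (simp_all add: lin_ext_add)

lemma lin_ext_diff: "lin_ext \<kappa> \<mu> (f - g) = lin_ext \<kappa> \<mu> f - lin_ext \<kappa> \<mu> g"
  using lin_ext_add[of \<mu> "f - g" g] by simp

lemma lin_ext_single: "lin_ext \<kappa> \<mu> (Poly_Mapping.single w a) = \<kappa> a * \<mu> w"
  by (cases "a = 0") (simp_all add: lin_ext_def hom_zero)

lemma lin_ext_mult:
  fixes f g :: "'a::cancel_comm_monoid_add \<Rightarrow>\<^sub>0 'k"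
  assumes "\<And>u v. \<mu> (u + v) = \<mu> u * \<mu> v"
  shows "lin_ext \<kappa> \<mu> (f * g) = lin_ext \<kappa> \<mu> f * lin_ext \<kappa> \<mu> g"
proof -
  have "lin_ext \<kappa> \<mu> (f * g) = (\<Sum>u\<in>keys f. \<Sum>v\<in>keys g.
      \<kappa> (lookup f u) * \<mu> u * (\<kappa> (lookup g v) * \<mu> v))"
    unfolding mult_expand[of f g] lin_ext_sum single_mult_expand lin_ext_single hom_mult assms
    by (simp add: mult_ac)
  also have "\<dots> = lin_ext \<kappa> \<mu> f * lin_ext \<kappa> \<mu> g"
    by (simp add: lin_ext_def sum_product)
  finally show ?thesis .
qed

end

definition mon_prod :: "('a \<Rightarrow> 'r::comm_monoid_mult) \<Rightarrow> ('a \<Rightarrow>\<^sub>0 nat) \<Rightarrow> 'r" where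
  "mon_prod a u = (\<Prod>j\<in>keys u. a j ^ lookup u j)"

lemma mon_prod_superset:
  assumes "finite A" "keys u \<subseteq> A"
  shows "mon_prod a u = (\<Prod>j\<in>A. a j ^ lookup u j)"
  unfolding mon_prod_def using assms
  by (intro prod.mono_neutral_left) (auto simp: in_keys_iff)

lemma mon_prod_zero [simp]: "mon_prod a 0 = 1"
  by (simp add: mon_prod_def)

lemma mon_prod_add: "mon_prod a (u + v) = mon_prod a u * mon_prod a v"
proof -
  let ?A = "keys u \<union> keys v"
  have "keys (u + v) \<subseteq> ?A" by (rule Poly_Mapping.keys_add)
  then show ?thesis
    by (simp add: mon_prod_superset[of ?A] lookup_add power_add prod.distrib)
qed

lemma mon_prod_single: "mon_prod a (Poly_Mapping.single i k) = a i ^ k"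
  by (cases "k = 0") (simp_all add: mon_prod_def)


subsection \<open>Restricting the support\<close>

definition restr :: "'a set \<Rightarrow> ('a \<Rightarrow>\<^sub>0 'b::zero) \<Rightarrow> ('a \<Rightarrow>\<^sub>0 'b)" where
  "restr A f = Poly_Mapping.mapp (\<lambda>w c. c when w \<in> A) f"

lemma lookup_restr: "lookup (restr A f) w = (if w \<in> A then lookup f w else 0)"
  by (auto simp: restr_def lookup_mapp when_def in_keys_iff)

lemma keys_restr: "keys (restr A f) = keys f \<inter> A"
  by (auto simp: in_keys_iff lookup_restr split: if_splits)

lemma restr_zero [simp]: "restr A 0 = 0"
  by (rule poly_mapping_eqI) (simp add: lookup_restr)

lemma restr_add: "restr A (f + g) = restr A f + restr A g"
  by (rule poly_mapping_eqI) (simp add: lookup_restr lookup_add)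

lemma restr_diff: "restr A (f - g :: _ \<Rightarrow>\<^sub>0 _ :: ab_group_add) = restr A f - restr A g"
  by (rule poly_mapping_eqI) (simp add: lookup_restr lookup_minus)

lemma restr_sum: "restr A (\<Sum>i\<in>I. f i) = (\<Sum>i\<in>I. restr A (f i))"
  by (induction I rule: infinite_finite_induct) (simp_all add: restr_add)

lemma restr_restr: "restr A (restr B f) = restr (A \<inter> B) f"
  by (rule poly_mapping_eqI) (simp add: lookup_restr)

lemma restr_id: "keys f \<subseteq> A \<Longrightarrow> restr A f = f"
  by (rule poly_mapping_eqI) (auto simp: lookup_restr in_keys_iff)

lemma restr_eq_0: "keys f \<inter> A = {} \<Longrightarrow> restr A f = 0"
  by (rule poly_mapping_eqI) (auto simp: lookup_restr in_keys_iff)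

lemma restr_empty [simp]: "restr {} f = 0"
  by (rule restr_eq_0) simp

lemma restr_single_mult:
  fixes g :: "'a::cancel_comm_monoid_add \<Rightarrow>\<^sub>0 'b::comm_semiring_1"
  shows "restr A (Poly_Mapping.single u a * g) = Poly_Mapping.single u a * restr {w. u + w \<in> A} g"
proof (rule poly_mapping_eqI)
  fix v
  show "lookup (restr A (Poly_Mapping.single u a * g)) v
      = lookup (Poly_Mapping.single u a * restr {w. u + w \<in> A} g) v"
  proof (cases "\<exists>w. v = u + w")
    case True
    then obtain w where "v = u + w" by blast
    then show ?thesis by (simp add: lookup_restr lookup_single_mult)
  next
    case False
    then show ?thesis by (simp add: lookup_restr lookup_single_mult_eq_0)
  qed
qed

text \<open>Keeping only the monomials outside a prime monomial ideal is the substitution of \<open>0\<close> for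
  the variables in that ideal.\<close>

lemma restr_mult:
  fixes f g :: "'a::cancel_comm_monoid_add \<Rightarrow>\<^sub>0 'b::comm_semiring_1"
  assumes "\<And>u w. u + w \<in> A \<longleftrightarrow> u \<in> A \<and> w \<in> A"
  shows "restr A (f * g) = restr A f * restr A g"
proof -
  have "restr A (f * g)
      = (\<Sum>u\<in>keys f. Poly_Mapping.single u (lookup f u) * restr {w. u + w \<in> A} g)"
    by (subst mult_expand) (simp add: restr_sum restr_single_mult)
  also have "\<dots> = (\<Sum>u\<in>keys f \<inter> A. Poly_Mapping.single u (lookup f u) * restr A g)"
    by (rule sum.mono_neutral_cong_right) (auto simp: assms)
  also have "\<dots> = restr A f * restr A g"
    by (subst mult_expand[of "restr A f"]) (simp add: keys_restr lookup_restr)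
  finally show ?thesis .
qed

lemma restr_graded_mult:
  fixes f g :: "'a::cancel_comm_monoid_add \<Rightarrow>\<^sub>0 'b::comm_semiring_1"
  assumes "\<And>u w. u \<in> keys f \<Longrightarrow> u + w \<in> A \<longleftrightarrow> w \<in> B"
  shows "restr A (f * g) = f * restr B g"
proof -
  have "restr A (f * g)
      = (\<Sum>u\<in>keys f. Poly_Mapping.single u (lookup f u) * restr {w. u + w \<in> A} g)"
    by (subst mult_expand) (simp add: restr_sum restr_single_mult)
  also have "\<dots> = (\<Sum>u\<in>keys f. Poly_Mapping.single u (lookup f u) * restr B g)"
    using assms by (intro sum.cong refl arg_cong2[of _ _ _ _ "(*)"] arg_cong2[of _ _ _ _ restr]) auto
  also have "\<dots> = f * restr B g"
    by (rule mult_expand[symmetric])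
  finally show ?thesis .
qed


section \<open>Bidegrees and the term order\<close>

definition mons :: "nat \<Rightarrow> nat \<Rightarrow> bimon set" where
  "mons n m = {w. keys (fst w) \<subseteq> {..<n} \<and> keys (snd w) \<subseteq> {..<m}}"

abbreviation poly_carrier :: "nat \<Rightarrow> nat \<Rightarrow> 'k::field bipoly set" where
  "poly_carrier n m \<equiv> carrier (bipoly_ring n m)"

lemma poly_carrier_iff: "f \<in> poly_carrier n m \<longleftrightarrow> keys f \<subseteq> mons n m"
  by (fastforce simp: bipoly_ring_def mons_def)

lemma keys_add_nat: "keys (u + v :: _ \<Rightarrow>\<^sub>0 nat) = keys u \<union> keys v"
  by (auto simp: in_keys_iff lookup_add)

lemma mons_add: "u + w \<in> mons n m \<longleftrightarrow> u \<in> mons n m \<and> w \<in> mons n m"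
  by (auto simp: mons_def keys_add_nat)

lemma zero_in_mons [simp]: "0 \<in> mons n m"
  by (simp add: mons_def)

lemma mons_mono: "a \<le> n \<Longrightarrow> b \<le> m \<Longrightarrow> mons a b \<subseteq> mons n m"
  by (fastforce simp: mons_def)

lemma mons_0_0: "mons 0 0 = {0}"
  by (auto simp: mons_def prod_eq_iff keys_eq_empty)

lemma mdeg_superset: "finite A \<Longrightarrow> keys u \<subseteq> A \<Longrightarrow> mdeg u = (\<Sum>i\<in>A. lookup u i)"
  unfolding mdeg_def by (rule sum.mono_neutral_left) (auto simp: in_keys_iff)

lemma mdeg_add: "mdeg (u + v) = mdeg u + mdeg v"
proof -
  let ?A = "keys u \<union> keys v"
  show ?thesis by (simp add: mdeg_superset[of ?A] keys_add_nat lookup_add sum.distrib)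
qed

lemma mdeg_zero [simp]: "mdeg 0 = 0"
  by (simp add: mdeg_def)

lemma mdeg_single [simp]: "mdeg (Poly_Mapping.single i k) = k"
  by (cases "k = 0") (simp_all add: mdeg_def)

lemma bideg_add: "bideg (u + w) = bideg u + bideg w"
  by (simp add: bideg_def mdeg_add)

lemma bideg_zero [simp]: "bideg 0 = 0"
  by (simp add: bideg_def zero_prod_def)

lemma bideg_nonneg: "0 \<le> fst (bideg w)" "0 \<le> snd (bideg w)"
  by (simp_all add: bideg_def)

definition hmons :: "nat \<Rightarrow> nat \<Rightarrow> int \<times> int \<Rightarrow> bimon set" where
  "hmons n m c = {w \<in> mons n m. bideg w = c}"

lemma bihom_iff: "f \<in> bihom n m c \<longleftrightarrow> keys f \<subseteq> hmons n m c"
  by (auto simp: bihom_def hmons_def poly_carrier_iff)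

lemma finite_mdeg_eq: "finite {u. keys u \<subseteq> {..<n} \<and> mdeg u = d}"
proof -
  let ?F = "\<lambda>u. restrict (lookup u) {..<n}"
  let ?U = "{u. keys u \<subseteq> {..<n} \<and> mdeg u = d}"
  have le: "lookup u i \<le> d" if "keys u \<subseteq> {..<n}" "mdeg u = d" "i < n" for u i
  proof -
    have "mdeg u = (\<Sum>i<n. lookup u i)" using that by (intro mdeg_superset) auto
    moreover have "lookup u i \<le> (\<Sum>i<n. lookup u i)" using that by (intro member_le_sum) auto
    ultimately show ?thesis using that by simp
  qed
  have "?F ` ?U \<subseteq> {..<n} \<rightarrow>\<^sub>E {..d}"
    by (intro image_subsetI restrict_PiE_iff[THEN iffD2]) (simp add: le)
  moreover have "finite ({..<n} \<rightarrow>\<^sub>E {..d})" by (simp add: finite_PiE)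
  moreover have "inj_on ?F ?U"
  proof (rule inj_onI, rule poly_mapping_eqI)
    fix u v i assume u: "u \<in> ?U" and v: "v \<in> ?U" and eq: "?F u = ?F v"
    show "lookup u i = lookup v i"
    proof (cases "i < n")
      case True
      then show ?thesis using fun_cong[OF eq, of i] by simp
    next
      case False
      then have "i \<notin> keys u" "i \<notin> keys v" using u v by auto
      then show ?thesis by (simp add: in_keys_iff)
    qed
  qed
  ultimately show ?thesis using inj_on_finite[of ?F ?U] by simp
qed

lemma finite_hmons: "finite (hmons n m c)"
proof -
  have "hmons n m c \<subseteq> {u. keys u \<subseteq> {..<n} \<and> mdeg u = nat (fst c)}
      \<times> {u. keys u \<subseteq> {..<m} \<and> mdeg u = nat (snd c)}"
    by (auto simp: hmons_def mons_def bideg_def)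
  moreover have "finite ({u. keys u \<subseteq> {..<n} \<and> mdeg u = nat (fst c)}
      \<times> {u. keys u \<subseteq> {..<m} \<and> mdeg u = nat (snd c)})"
    by (intro finite_cartesian_product finite_mdeg_eq)
  ultimately show ?thesis by (rule finite_subset)
qed

text \<open>The exponents of one block of variables: the vector that is smaller here belongs to the larger
  monomial.\<close>

definition rev_less :: "(nat \<Rightarrow>\<^sub>0 nat) \<Rightarrow> (nat \<Rightarrow>\<^sub>0 nat) \<Rightarrow> bool" where
  "rev_less u v \<longleftrightarrow> (\<exists>k. lookup u k < lookup v k \<and> (\<forall>i>k. lookup u i = lookup v i))"

lemma rev_less_trans: "rev_less u v \<Longrightarrow> rev_less v w \<Longrightarrow> rev_less u w"
proof -
  assume "rev_less u v" "rev_less v w"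
  then obtain k l where k: "lookup u k < lookup v k" "\<forall>i>k. lookup u i = lookup v i"
    and l: "lookup v l < lookup w l" "\<forall>i>l. lookup v i = lookup w i"
    unfolding rev_less_def by blast
  show ?thesis
    unfolding rev_less_def
  proof (rule exI[of _ "max k l"], intro conjI allI impI)
    show "lookup u (max k l) < lookup w (max k l)"
      using k(1) k(2)[rule_format, of l] l(1) l(2)[rule_format, of k]
      by (cases k l rule: linorder_cases) (simp_all add: max_def)
    show "lookup u i = lookup w i" if "max k l < i" for i
      using k(2)[rule_format, of i] l(2)[rule_format, of i] that by simp
  qed
qed

lemma rev_less_irrefl: "\<not> rev_less u u"
  by (simp add: rev_less_def)

lemma rev_less_total: "u \<noteq> v \<Longrightarrow> rev_less u v \<or> rev_less v u"
proof -
  assume "u \<noteq> v"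
  let ?D = "{i. lookup u i \<noteq> lookup v i}"
  have "?D \<subseteq> keys u \<union> keys v" by (auto simp: in_keys_iff)
  then have fin: "finite ?D" by (rule finite_subset) simp
  have "?D \<noteq> {}" using \<open>u \<noteq> v\<close> by (auto intro: poly_mapping_eqI)
  then have "Max ?D \<in> ?D" using fin Max_in by blast
  then have ne: "lookup u (Max ?D) \<noteq> lookup v (Max ?D)" by (rule CollectD)
  have eq: "lookup u i = lookup v i" if "i > Max ?D" for i
  proof (rule ccontr)
    assume "lookup u i \<noteq> lookup v i"
    then have "i \<le> Max ?D" by (intro Max_ge fin CollectI)
    then show False using that by simp
  qed
  show ?thesis
  proof (cases "lookup u (Max ?D) < lookup v (Max ?D)")
    case True
    then show ?thesis unfolding rev_less_def using eq by blast
  next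
    case False
    then have "lookup v (Max ?D) < lookup u (Max ?D)" using ne by linarith
    then show ?thesis unfolding rev_less_def using eq by metis
  qed
qed

lemma rev_less_add: "rev_less (w + u) (w + v) \<longleftrightarrow> rev_less u v"
  by (simp add: rev_less_def lookup_add)

lemma mon_greater_iff: "mon_greater w w' \<longleftrightarrow>
  (degree_triple w', degree_triple w) \<in> less_than <*lex*> less_than <*lex*> less_than \<or>
  degree_triple w = degree_triple w' \<and>
    (rev_less (fst w) (fst w') \<or> fst w = fst w' \<and> rev_less (snd w) (snd w'))"
  by (simp add: mon_greater_def revlex_greater_def rev_less_def)

lemma mon_greater_irrefl: "\<not> mon_greater w w"
  by (simp add: mon_greater_iff rev_less_irrefl degree_triple_def)

lemma mon_greater_trans:
  assumes "mon_greater u v" "mon_greater v w"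
  shows "mon_greater u w"
proof -
  define R where "R = less_than <*lex*> less_than <*lex*> less_than"
  have "trans R" unfolding R_def by (intro trans_lex_prod trans_less_than)
  then have R: "(c, a) \<in> R" if "(b, a) \<in> R" "(c, b) \<in> R" for a b c
    using that by (meson transD)
  show ?thesis
    using assms unfolding mon_greater_iff R_def[symmetric]
    by (elim disjE conjE) (auto intro: R rev_less_trans)
qed

lemma mon_greater_total:
  assumes "u \<noteq> v"
  shows "mon_greater u v \<or> mon_greater v u"
proof -
  define R where "R = less_than <*lex*> less_than <*lex*> less_than"
  have "total R" unfolding R_def by (intro total_lex_prod total_less_than)
  then have R: "degree_triple u = degree_triple v \<or> (degree_triple v, degree_triple u) \<in> R \<or>
      (degree_triple u, degree_triple v) \<in> R"
    unfolding total_on_def by blast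
  have "fst u \<noteq> fst v \<or> snd u \<noteq> snd v" using assms by (auto simp: prod_eq_iff)
  then have "rev_less (fst u) (fst v) \<or> rev_less (fst v) (fst u) \<or>
      fst u = fst v \<and> (rev_less (snd u) (snd v) \<or> rev_less (snd v) (snd u))"
    using rev_less_total by blast
  then show ?thesis
    using R unfolding mon_greater_iff R_def[symmetric] by fastforce
qed

lemma mon_greater_asym: "mon_greater u v \<Longrightarrow> \<not> mon_greater v u"
  using mon_greater_trans mon_greater_irrefl by blast

lemma mon_greater_add: "mon_greater (w + u) (w + v) \<longleftrightarrow> mon_greater u v"
  by (simp add: mon_greater_iff degree_triple_def mdeg_add rev_less_add)

text \<open>This is the property that singles out the reverse lexicographic order: within a bidegree,
  setting the last variables to zero removes the smallest monomials.\<close>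

lemma mon_greater_mons:
  assumes "w \<in> mons a m" "w' \<in> mons n m" "w' \<notin> mons a m" "bideg w = bideg w'"
  shows "mon_greater w w'"
proof -
  have w: "keys (fst w) \<subseteq> {..<a}" using assms(1) by (simp add: mons_def)
  have "\<not> keys (fst w') \<subseteq> {..<a}" using assms(2,3) by (simp add: mons_def)
  then obtain i where i: "i \<in> keys (fst w')" "a \<le> i" by (metis lessThan_iff not_le subsetI)
  have "i \<notin> keys (fst w)" using w i(2) by fastforce
  then have ne: "lookup (fst w) i \<noteq> lookup (fst w') i" using i(1) by (simp add: in_keys_iff)
  then have "fst w \<noteq> fst w'" by fastforce
  moreover have "\<not> rev_less (fst w') (fst w)"
  proof
    assume "rev_less (fst w') (fst w)"
    then obtain k where k: "lookup (fst w') k < lookup (fst w) k"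
      "\<forall>i>k. lookup (fst w') i = lookup (fst w) i"
      unfolding rev_less_def by blast
    then have "k \<in> keys (fst w)" by (simp add: in_keys_iff)
    then have "k < a" using w by blast
    then show False using k(2)[rule_format, of i] i(2) ne by simp
  qed
  ultimately have "rev_less (fst w) (fst w')" using rev_less_total by blast
  moreover have "degree_triple w = degree_triple w'"
    using assms(4) by (simp add: bideg_def degree_triple_def)
  ultimately show ?thesis by (simp add: mon_greater_iff)
qed

lemma finite_has_greatest_mon:
  assumes "finite A" "A \<noteq> {}"
  shows "\<exists>w\<in>A. \<forall>w'\<in>A. w' \<noteq> w \<longrightarrow> mon_greater w w'"
  using assms
proof (induction A rule: finite_ne_induct)
  case (singleton x)
  then show ?case by simp
next
  case (insert x A)
  then obtain w where w: "w \<in> A" "\<forall>w'\<in>A. w' \<noteq> w \<longrightarrow> mon_greater w w'" by blast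
  have "x \<noteq> w" using insert w by auto
  then consider "mon_greater x w" | "mon_greater w x" using mon_greater_total by blast
  then show ?case
  proof cases
    case 1
    then have "\<forall>w'\<in>insert x A. w' \<noteq> x \<longrightarrow> mon_greater x w'"
      using w mon_greater_trans[OF 1] 1 by auto
    then show ?thesis by blast
  next
    case 2
    then show ?thesis using w by blast
  qed
qed

lemma lead_mon_props:
  assumes "f \<noteq> 0"
  shows lead_mon_in_keys: "lead_mon f \<in> keys f"
    and lead_mon_greater: "\<And>w. w \<in> keys f \<Longrightarrow> w \<noteq> lead_mon f \<Longrightarrow> mon_greater (lead_mon f) w"
proof -
  have "keys f \<noteq> {}" using assms by simp
  then obtain w where w: "w \<in> keys f" "\<forall>w'\<in>keys f. w' \<noteq> w \<longrightarrow> mon_greater w w'"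
    using finite_has_greatest_mon[OF finite_keys] by blast
  define P where "P = (\<lambda>w. w \<in> keys f \<and> (\<forall>w'\<in>keys f. w' \<noteq> w \<longrightarrow> mon_greater w w'))"
  have "P w" using w by (simp add: P_def)
  moreover have "v = w" if "P v" for v
    using that w mon_greater_asym[of v w] mon_greater_asym[of w v] unfolding P_def by metis
  ultimately have "P (THE w. P w)" by (rule theI)
  then have *: "P (lead_mon f)" by (simp add: lead_mon_def P_def)
  then show "lead_mon f \<in> keys f" by (simp add: P_def)
  show "mon_greater (lead_mon f) w" if "w \<in> keys f" "w \<noteq> lead_mon f" for w
    using * that by (simp add: P_def)
qed

lemma lead_mon_eqI:
  assumes "lookup f w \<noteq> 0" "\<And>w'. mon_greater w' w \<Longrightarrow> lookup f w' = 0"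
  shows "lead_mon f = w"
proof (rule ccontr)
  assume ne: "lead_mon f \<noteq> w"
  have "f \<noteq> 0" using assms by auto
  then have "lead_mon f \<in> keys f" by (rule lead_mon_in_keys)
  moreover have "mon_greater (lead_mon f) w"
    by (rule lead_mon_greater[OF \<open>f \<noteq> 0\<close>]) (use assms(1) ne in \<open>simp_all add: in_keys_iff\<close>)
  ultimately show False using assms(2)[of "lead_mon f"] by (simp add: in_keys_iff)
qed

lemma lookup_lead_mon: "f \<noteq> 0 \<Longrightarrow> lookup f (lead_mon f) \<noteq> 0"
  using lead_mon_in_keys by (simp add: in_keys_iff)

lemma lookup_above_lead_mon: "mon_greater w (lead_mon f) \<Longrightarrow> lookup f w = 0"
proof (rule ccontr)
  assume *: "mon_greater w (lead_mon f)" "lookup f w \<noteq> 0"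
  then have f: "f \<noteq> 0" "w \<in> keys f" by (auto simp: in_keys_iff)
  have "w \<noteq> lead_mon f" using *(1) mon_greater_irrefl[of "lead_mon f"] by auto
  then have "mon_greater (lead_mon f) w" by (rule lead_mon_greater[OF f])
  then show False using *(1) mon_greater_asym by blast
qed

lemma lead_mon_single_mult:
  fixes f :: "'k::field bipoly"
  assumes "a \<noteq> 0" "f \<noteq> 0"
  shows "lead_mon (Poly_Mapping.single u a * f) = u + lead_mon f"
proof (rule lead_mon_eqI)
  show "lookup (Poly_Mapping.single u a * f) (u + lead_mon f) \<noteq> 0"
    using assms lookup_lead_mon by (simp add: lookup_single_mult)
  fix w' assume *: "mon_greater w' (u + lead_mon f)"
  show "lookup (Poly_Mapping.single u a * f) w' = 0"
  proof (cases "\<exists>w. w' = u + w")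
    case True
    then obtain w where "w' = u + w" by blast
    then show ?thesis using * by (simp add: mon_greater_add lookup_single_mult lookup_above_lead_mon)
  next
    case False
    then show ?thesis by (intro lookup_single_mult_eq_0) blast
  qed
qed

lemma single_mult_eq_0_iff:
  fixes f :: "'k::field bipoly"
  assumes "a \<noteq> 0"
  shows "Poly_Mapping.single u a * f = 0 \<longleftrightarrow> f = 0"
  using keys_single_mult[OF assms, of u f] keys_eq_empty[of f]
    keys_eq_empty[of "Poly_Mapping.single u a * f"] by simp

definition lead_set :: "'k::field bipoly set \<Rightarrow> bimon set" where
  "lead_set V = {lead_mon f | f. f \<in> V \<and> f \<noteq> 0}"

lemma lead_setI: "f \<in> V \<Longrightarrow> f \<noteq> 0 \<Longrightarrow> lead_mon f \<in> lead_set V"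
  by (auto simp: lead_set_def)

lemma lead_setE:
  assumes "w \<in> lead_set V"
  obtains f where "f \<in> V" "f \<noteq> 0" "lead_mon f = w"
  using assms by (auto simp: lead_set_def)

lemma lead_set_mono: "V \<subseteq> V' \<Longrightarrow> lead_set V \<subseteq> lead_set V'"
  by (auto simp: lead_set_def)

text \<open>Subtracting a multiple of an element of the smaller space with the same leading monomial
  lowers the leading monomial, and in a finite set of monomials this stops.\<close>

lemma subspace_eq_if_same_leads:
  fixes V V' :: "'k::field bipoly set"
  assumes fin: "finite W" and W: "\<And>f. f \<in> V' \<Longrightarrow> keys f \<subseteq> W"
    and V0: "0 \<in> V" and Vadd: "\<And>f g c. f \<in> V \<Longrightarrow> g \<in> V \<Longrightarrow> f + bconst c * g \<in> V"
    and V'sub: "\<And>f g c. f \<in> V' \<Longrightarrow> g \<in> V \<Longrightarrow> f - bconst c * g \<in> V'"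
    and lead: "lead_set V' \<subseteq> lead_set V"
  shows "V' \<subseteq> V"
proof
  fix f assume "f \<in> V'"
  then show "f \<in> V"
  proof (induction "card {w \<in> W. w = lead_mon f \<or> mon_greater (lead_mon f) w}" arbitrary: f
      rule: less_induct)
    case less
    show ?case
    proof (cases "f = 0")
      case True
      then show ?thesis using V0 by simp
    next
      case False
      then have "lead_mon f \<in> lead_set V" using lead less.prems lead_setI by blast
      then obtain g where g: "g \<in> V" "g \<noteq> 0" "lead_mon g = lead_mon f" by (rule lead_setE)
      define c where "c = lookup f (lead_mon f) / lookup g (lead_mon g)"
      define h where "h = f - bconst c * g"
      have h: "h \<in> V'" unfolding h_def using V'sub less.prems g by blast
      have f_eq: "f = h + bconst c * g" by (simp add: h_def)
      have "h \<in> V"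
      proof (cases "h = 0")
        case True
        then show ?thesis using V0 by simp
      next
        case False
        have "c * lookup g (lead_mon f) = lookup f (lead_mon f)"
          using lookup_lead_mon[OF g(2)] g(3) by (simp add: c_def)
        then have "lookup h (lead_mon f) = 0" by (simp add: h_def lookup_minus lookup_bconst_mult)
        moreover have "lookup h w = 0" if "mon_greater w (lead_mon f)" for w
          using that g(3) by (simp add: h_def lookup_minus lookup_bconst_mult lookup_above_lead_mon)
        ultimately have lt: "mon_greater (lead_mon f) (lead_mon h)"
          using lookup_lead_mon[OF False] mon_greater_total[of "lead_mon h" "lead_mon f"] by metis
        let ?L = "\<lambda>f. {w \<in> W. w = lead_mon f \<or> mon_greater (lead_mon f) w}"
        have "?L h \<subseteq> ?L f" using mon_greater_trans[OF lt] lt by blast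
        moreover have "lead_mon f \<in> ?L f" using lead_mon_in_keys[OF \<open>f \<noteq> 0\<close>] W less.prems by blast
        moreover have "lead_mon f \<notin> ?L h" using mon_greater_asym[OF lt] lt mon_greater_irrefl[of "lead_mon f"] by auto
        ultimately have "?L h \<subset> ?L f" by blast
        then have "card (?L h) < card (?L f)" by (rule psubset_card_mono[rotated]) (use fin in simp)
        then show ?thesis using less.hyps h by blast
      qed
      then show ?thesis using Vadd g f_eq by metis
    qed
  qed
qed

section \<open>Bigraded ideals\<close>

lemma poly_carrier_add: "f \<in> poly_carrier n m \<Longrightarrow> g \<in> poly_carrier n m \<Longrightarrow> f + g \<in> poly_carrier n m"
  unfolding poly_carrier_iff using Poly_Mapping.keys_add[of f g] by blast

lemma poly_carrier_zero [simp]: "0 \<in> poly_carrier n m"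
  by (simp add: poly_carrier_iff)

lemma poly_carrier_uminus: "f \<in> poly_carrier n m \<Longrightarrow> - f \<in> poly_carrier n m"
  by (simp add: poly_carrier_iff keys_def)

lemma poly_carrier_diff: "f \<in> poly_carrier n m \<Longrightarrow> g \<in> poly_carrier n m \<Longrightarrow> f - g \<in> poly_carrier n m"
  using poly_carrier_add[OF _ poly_carrier_uminus, of f n m g] by simp

lemma poly_carrier_mult: "f \<in> poly_carrier n m \<Longrightarrow> g \<in> poly_carrier n m \<Longrightarrow> f * g \<in> poly_carrier n m"
  unfolding poly_carrier_iff using keys_mult[of f g] mons_add by blast

lemma poly_carrier_single: "w \<in> mons n m \<Longrightarrow> Poly_Mapping.single w c \<in> poly_carrier n m"
  by (simp add: poly_carrier_iff)

lemma poly_carrier_one [simp]: "1 \<in> poly_carrier n m"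
  by (simp add: poly_carrier_iff)

lemma poly_carrier_bconst [simp]: "bconst c \<in> poly_carrier n m"
  unfolding bconst_def by (rule poly_carrier_single) simp

lemma poly_carrier_sum: "(\<And>i. i \<in> I \<Longrightarrow> f i \<in> poly_carrier n m) \<Longrightarrow> (\<Sum>i\<in>I. f i) \<in> poly_carrier n m"
  by (induction I rule: infinite_finite_induct) (simp_all add: poly_carrier_add)

lemma bipoly_ring_simps [simp]:
  "monoid.mult (bipoly_ring n m) = (*)" "one (bipoly_ring n m) = 1"
  "zero (bipoly_ring n m) = 0" "add (bipoly_ring n m) = (+)"
  by (simp_all add: bipoly_ring_def)

lemma cring_bipoly_ring: "cring (bipoly_ring n m :: 'k::field bipoly ring)"
proof (rule cringI)
  show "abelian_group (bipoly_ring n m :: 'k bipoly ring)"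
  proof (rule abelian_groupI)
    fix f :: "'k bipoly" assume "f \<in> poly_carrier n m"
    then have "- f \<in> poly_carrier n m" "- f \<oplus>\<^bsub>bipoly_ring n m\<^esub> f = \<zero>\<^bsub>bipoly_ring n m\<^esub>"
      by (simp_all add: poly_carrier_uminus)
    then show "\<exists>g\<in>poly_carrier n m. g \<oplus>\<^bsub>bipoly_ring n m\<^esub> f = \<zero>\<^bsub>bipoly_ring n m\<^esub>" by blast
  qed (simp_all add: poly_carrier_add add_ac)
  show "Group.comm_monoid (bipoly_ring n m :: 'k bipoly ring)"
    by (rule comm_monoidI) (simp_all add: poly_carrier_mult mult_ac)
qed (simp add: distrib_right)

lemma ring_bipoly_ring: "ring (bipoly_ring n m :: 'k::field bipoly ring)"
  using cring_bipoly_ring cring.axioms(1) by blast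

text \<open>Ideals in terms of the arithmetic of the type of polynomials instead of the ring record, so
  that simplification applies.\<close>

definition poly_ideal :: "nat \<Rightarrow> nat \<Rightarrow> 'k::field bipoly set \<Rightarrow> bool" where
  "poly_ideal n m J \<longleftrightarrow> J \<subseteq> poly_carrier n m \<and> 0 \<in> J \<and> (\<forall>f\<in>J. \<forall>g\<in>J. f + g \<in> J) \<and>
     (\<forall>f\<in>J. \<forall>g\<in>poly_carrier n m. g * f \<in> J)"

lemma poly_idealD:
  assumes "poly_ideal n m J"
  shows "f \<in> J \<Longrightarrow> f \<in> poly_carrier n m" "0 \<in> J" "f \<in> J \<Longrightarrow> g \<in> J \<Longrightarrow> f + g \<in> J"
    "f \<in> J \<Longrightarrow> g \<in> poly_carrier n m \<Longrightarrow> g * f \<in> J"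
  using assms by (auto simp: poly_ideal_def)

lemma poly_ideal_uminus: "poly_ideal n m J \<Longrightarrow> f \<in> J \<Longrightarrow> - f \<in> J"
  using poly_idealD(4)[of n m J f "- 1"] by (simp add: poly_carrier_uminus)

lemma poly_ideal_diff: "poly_ideal n m J \<Longrightarrow> f \<in> J \<Longrightarrow> g \<in> J \<Longrightarrow> f - g \<in> J"
  using poly_idealD(3)[of n m J f "- g"] poly_ideal_uminus[of n m J g] by simp

lemma poly_ideal_sum: "poly_ideal n m J \<Longrightarrow> (\<And>i. i \<in> I \<Longrightarrow> f i \<in> J) \<Longrightarrow> (\<Sum>i\<in>I. f i) \<in> J"
  by (induction I rule: infinite_finite_induct) (simp_all add: poly_idealD)

lemma ideal_iff_poly_ideal: "ideal J (bipoly_ring n m) \<longleftrightarrow> poly_ideal n m J"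
proof
  assume J: "ideal J (bipoly_ring n m)"
  interpret ideal J "bipoly_ring n m" by (rule J)
  show "poly_ideal n m J"
    using a_subset additive_subgroup.zero_closed[OF is_additive_subgroup]
      additive_subgroup.a_closed[OF is_additive_subgroup] I_l_closed
    unfolding poly_ideal_def bipoly_ring_simps
    by (intro conjI ballI)
next
  assume J: "poly_ideal n m J"
  interpret R: cring "bipoly_ring n m :: 'a bipoly ring" by (rule cring_bipoly_ring)
  have neg: "\<ominus>\<^bsub>bipoly_ring n m\<^esub> f = - f" if "f \<in> poly_carrier n m" for f :: "'a bipoly"
    by (rule R.minus_equality) (use that in \<open>simp_all add: poly_carrier_uminus\<close>)
  show "ideal J (bipoly_ring n m)"
  proof (rule idealI)
    show "subgroup J (add_monoid (bipoly_ring n m))"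
    proof (rule R.add.subgroupI)
      show "J \<noteq> {}" using poly_idealD(2)[OF J] by blast
      fix f assume "f \<in> J"
      then show "\<ominus>\<^bsub>bipoly_ring n m\<^esub> f \<in> J"
        using neg poly_idealD(1)[OF J] poly_ideal_uminus[OF J] by simp
    qed (use poly_idealD[OF J] in auto)
  qed (use poly_idealD[OF J] in \<open>auto simp: R.ring_axioms mult.commute\<close>)
qed

lemma Idl_poly_ideal: "S \<subseteq> poly_carrier n m \<Longrightarrow> poly_ideal n m (Idl\<^bsub>bipoly_ring n m\<^esub> S)"
  using ring.genideal_ideal[OF ring_bipoly_ring] ideal_iff_poly_ideal by blast

lemma Idl_superset: "S \<subseteq> poly_carrier n m \<Longrightarrow> S \<subseteq> Idl\<^bsub>bipoly_ring n m\<^esub> S"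
  using ring.genideal_self[OF ring_bipoly_ring] by blast

lemma Idl_least: "poly_ideal n m J \<Longrightarrow> S \<subseteq> J \<Longrightarrow> Idl\<^bsub>bipoly_ring n m\<^esub> S \<subseteq> J"
  using ring.genideal_minimal[OF ring_bipoly_ring] ideal_iff_poly_ideal by blast

abbreviation hcomp :: "int \<times> int \<Rightarrow> 'k::field bipoly \<Rightarrow> 'k bipoly" where
  "hcomp c \<equiv> restr {w. bideg w = c}"

lemma sum_hcomp:
  assumes "finite C" "bideg ` keys f \<subseteq> C"
  shows "(\<Sum>c\<in>C. hcomp c f) = f"
proof (rule poly_mapping_eqI)
  fix w
  have "lookup (\<Sum>c\<in>C. hcomp c f) w = (\<Sum>c\<in>C. if c = bideg w then lookup f w else 0)"
    unfolding lookup_sum by (intro sum.cong) (auto simp: lookup_restr)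
  also have "\<dots> = lookup f w"
    using assms by (cases "w \<in> keys f") (auto simp: in_keys_iff)
  finally show "lookup (\<Sum>c\<in>C. hcomp c f) w = lookup f w" .
qed

lemma hcomp_bihom: "f \<in> poly_carrier n m \<Longrightarrow> hcomp c f \<in> bihom n m c"
  by (auto simp: bihom_iff poly_carrier_iff keys_restr hmons_def)

lemma hcomp_id: "f \<in> bihom n m c \<Longrightarrow> hcomp c f = f"
  by (rule restr_id) (auto simp: bihom_iff hmons_def)

lemma bihom_carrier: "f \<in> bihom n m c \<Longrightarrow> f \<in> poly_carrier n m"
  by (simp add: bihom_def)

lemma bihom_mult:
  assumes "f \<in> bihom n m c" "g \<in> bihom n m d"
  shows "f * g \<in> bihom n m (c + d)"
proof -
  have "keys (f * g) \<subseteq> {a + b | a b. a \<in> keys f \<and> b \<in> keys g}" by (rule keys_mult)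
  also have "\<dots> \<subseteq> hmons n m (c + d)"
  proof (rule subsetI, elim CollectE exE conjE)
    fix w a b assume "w = a + b" "a \<in> keys f" "b \<in> keys g"
    moreover from this have "a \<in> hmons n m c" "b \<in> hmons n m d" using assms by (auto simp: bihom_iff)
    ultimately show "w \<in> hmons n m (c + d)" by (simp add: hmons_def mons_add bideg_add)
  qed
  finally show ?thesis by (simp add: bihom_iff)
qed

lemma bihom_add: "f \<in> bihom n m c \<Longrightarrow> g \<in> bihom n m c \<Longrightarrow> f + g \<in> bihom n m c"
  unfolding bihom_iff using Poly_Mapping.keys_add[of f g] by blast

lemma bihom_uminus: "f \<in> bihom n m c \<Longrightarrow> - f \<in> bihom n m c"
  by (simp add: bihom_iff keys_def)

lemma bihom_diff: "f \<in> bihom n m c \<Longrightarrow> g \<in> bihom n m c \<Longrightarrow> f - g \<in> bihom n m c"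
  using bihom_add[OF _ bihom_uminus, of f n m c g] by simp

lemma bihom_zero [simp]: "0 \<in> bihom n m c"
  by (simp add: bihom_iff)

lemma bihom_sum: "(\<And>i. i \<in> I \<Longrightarrow> f i \<in> bihom n m c) \<Longrightarrow> (\<Sum>i\<in>I. f i) \<in> bihom n m c"
  by (induction I rule: infinite_finite_induct) (simp_all add: bihom_add)

lemma bihom_single: "w \<in> mons n m \<Longrightarrow> bideg w = c \<Longrightarrow> Poly_Mapping.single w a \<in> bihom n m c"
  by (simp add: bihom_iff hmons_def)

lemma bihom_bconst [simp]: "bconst a \<in> bihom n m 0"
  unfolding bconst_def by (rule bihom_single) simp_all

lemma bihom_scale: "f \<in> bihom n m c \<Longrightarrow> bconst a * f \<in> bihom n m c"
  using bihom_mult[OF bihom_bconst, of f n m c a] by simp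

lemma hcomp_mult:
  assumes "f \<in> bihom n m d"
  shows "hcomp c (f * g) = f * hcomp (c - d) g"
proof (rule restr_graded_mult)
  fix u w assume "u \<in> keys f"
  then have "bideg u = d" using assms by (auto simp: bihom_iff hmons_def)
  then show "u + w \<in> {w. bideg w = c} \<longleftrightarrow> w \<in> {w. bideg w = c - d}"
    by (auto simp: bideg_add)
qed

definition bigraded :: "nat \<Rightarrow> nat \<Rightarrow> 'k::field bipoly set \<Rightarrow> bool" where
  "bigraded n m J \<longleftrightarrow> poly_ideal n m J \<and> (\<forall>f\<in>J. \<forall>c. hcomp c f \<in> J)"

lemma bigradedD:
  assumes "bigraded n m J"
  shows "poly_ideal n m J" "f \<in> J \<Longrightarrow> hcomp c f \<in> J"
  using assms unfolding bigraded_def by blast+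

text \<open>The elements of \<open>J\<close> with all homogeneous components in \<open>J\<close> form an ideal, and this ideal
  contains the homogeneous elements of \<open>J\<close>.\<close>

lemma bigraded_ideal_iff: "bigraded_ideal n m J \<longleftrightarrow> bigraded n m J"
proof
  let ?H = "{f \<in> J. \<exists>c. f \<in> bihom n m c}"
  assume *: "bigraded_ideal n m J"
  then have J: "poly_ideal n m J" and eq: "J = Idl\<^bsub>bipoly_ring n m\<^esub> ?H"
    by (auto simp: bigraded_ideal_def ideal_iff_poly_ideal)
  let ?J = "{f \<in> J. \<forall>c. hcomp c f \<in> J}"
  have "poly_ideal n m ?J"
    unfolding poly_ideal_def
  proof (intro conjI ballI)
    show "?J \<subseteq> poly_carrier n m" using poly_idealD(1)[OF J] by blast
    show "0 \<in> ?J" using poly_idealD(2)[OF J] by simp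
    show "f + g \<in> ?J" if "f \<in> ?J" "g \<in> ?J" for f g
      using that poly_idealD(3)[OF J] by (simp add: restr_add)
    show "g * f \<in> ?J" if f: "f \<in> ?J" and g: "g \<in> poly_carrier n m" for f g
    proof -
      have "hcomp c (g * f) \<in> J" for c
      proof -
        have "hcomp c (g * f)
            = (\<Sum>u\<in>keys g. Poly_Mapping.single u (lookup g u) * restr {w. u + w \<in> {w. bideg w = c}} f)"
          by (subst mult_expand) (simp only: restr_sum restr_single_mult)
        moreover have "Poly_Mapping.single u (lookup g u) * restr {w. u + w \<in> {w. bideg w = c}} f \<in> J"
          if "u \<in> keys g" for u
        proof -
          have "{w. u + w \<in> {w. bideg w = c}} = {w. bideg w = c - bideg u}"
            by (auto simp: bideg_add)
          moreover have "hcomp (c - bideg u) f \<in> J" using f by blast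
          moreover have "u \<in> mons n m" using that g by (auto simp: poly_carrier_iff)
          ultimately show ?thesis by (simp only:) (intro poly_idealD(4)[OF J] poly_carrier_single)
        qed
        ultimately show ?thesis by (simp only:) (rule poly_ideal_sum[OF J])
      qed
      then show ?thesis using f g poly_idealD(4)[OF J] by simp
    qed
  qed
  moreover have "?H \<subseteq> ?J"
  proof
    fix f assume "f \<in> ?H"
    then obtain d where f: "f \<in> J" "f \<in> bihom n m d" by blast
    have "hcomp c f \<in> J" for c
    proof (cases "c = d")
      case True
      then show ?thesis using f by (simp add: hcomp_id)
    next
      case False
      then have "hcomp c f = 0" using f(2) by (intro restr_eq_0) (auto simp: bihom_iff hmons_def)
      then show ?thesis using poly_idealD(2)[OF J] by simp
    qed
    then show "f \<in> ?J" using f by simp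
  qed
  ultimately have "J \<subseteq> ?J" using Idl_least eq by blast
  then show "bigraded n m J" using J by (auto simp: bigraded_def)
next
  let ?H = "{f \<in> J. \<exists>c. f \<in> bihom n m c}"
  assume *: "bigraded n m J"
  note J = bigradedD(1)[OF *]
  have H: "?H \<subseteq> poly_carrier n m" using poly_idealD(1)[OF J] by blast
  have "Idl\<^bsub>bipoly_ring n m\<^esub> ?H \<subseteq> J" by (rule Idl_least[OF J]) blast
  moreover have "f \<in> Idl\<^bsub>bipoly_ring n m\<^esub> ?H" if f: "f \<in> J" for f
  proof -
    have "hcomp c f \<in> Idl\<^bsub>bipoly_ring n m\<^esub> ?H" for c
      using Idl_superset[OF H] bigradedD(2)[OF * f] hcomp_bihom[OF poly_idealD(1)[OF J f]] by blast
    then have "(\<Sum>c\<in>bideg ` keys f. hcomp c f) \<in> Idl\<^bsub>bipoly_ring n m\<^esub> ?H"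
      by (intro poly_ideal_sum[OF Idl_poly_ideal[OF H]])
    then show ?thesis by (subst (asm) sum_hcomp) simp_all
  qed
  ultimately show "bigraded_ideal n m J"
    using J by (auto simp: bigraded_ideal_def ideal_iff_poly_ideal)
qed


section \<open>Monomial ideals\<close>

definition mon_upset :: "nat \<Rightarrow> nat \<Rightarrow> bimon set \<Rightarrow> bool" where
  "mon_upset n m L \<longleftrightarrow> L \<subseteq> mons n m \<and> (\<forall>w\<in>L. \<forall>u\<in>mons n m. u + w \<in> L)"

definition mon_ideal :: "bimon set \<Rightarrow> 'k::field bipoly set" where
  "mon_ideal L = {f. keys f \<subseteq> L}"

lemma bigraded_mon_ideal:
  assumes "mon_upset n m L"
  shows "bigraded n m (mon_ideal L)"
  unfolding bigraded_def poly_ideal_def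
proof (intro conjI ballI allI)
  show "mon_ideal L \<subseteq> poly_carrier n m" "0 \<in> mon_ideal L"
    using assms by (auto simp: mon_ideal_def poly_carrier_iff mon_upset_def)
  fix f assume f: "f \<in> mon_ideal L"
  show "f + g \<in> mon_ideal L" if "g \<in> mon_ideal L" for g
    using f that Poly_Mapping.keys_add[of f g] by (auto simp: mon_ideal_def)
  show "hcomp c f \<in> mon_ideal L" for c
    using f by (auto simp: mon_ideal_def keys_restr)
  show "g * f \<in> mon_ideal L" if g: "g \<in> poly_carrier n m" for g
  proof -
    have "keys (g * f) \<subseteq> {a + b | a b. a \<in> keys g \<and> b \<in> keys f}" by (rule keys_mult)
    also have "\<dots> \<subseteq> L"
    proof (rule subsetI, elim CollectE exE conjE)
      fix w a b assume w: "w = a + b" "a \<in> keys g" "b \<in> keys f"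
      have "a \<in> mons n m" using w(2) g by (auto simp: poly_carrier_iff)
      moreover have "b \<in> L" using w(3) f by (auto simp: mon_ideal_def)
      ultimately show "w \<in> L" using assms w(1) by (simp add: mon_upset_def)
    qed
    finally show ?thesis by (simp add: mon_ideal_def)
  qed
qed

lemma lead_set_mon_ideal: "lead_set (mon_ideal L :: 'k::field bipoly set) = L"
proof
  show "lead_set (mon_ideal L :: 'k bipoly set) \<subseteq> L"
  proof
    fix w assume "w \<in> lead_set (mon_ideal L :: 'k bipoly set)"
    then obtain f :: "'k bipoly" where "f \<in> mon_ideal L" "f \<noteq> 0" "lead_mon f = w" by (rule lead_setE)
    then show "w \<in> L" using lead_mon_in_keys[of f] by (auto simp: mon_ideal_def)
  qed
  show "L \<subseteq> lead_set (mon_ideal L :: 'k bipoly set)"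
  proof
    fix w assume "w \<in> L"
    let ?f = "Poly_Mapping.single w (1::'k)"
    have "?f \<noteq> 0" by (metis lookup_single_eq lookup_zero one_neq_zero)
    moreover have "?f \<in> mon_ideal L" using \<open>w \<in> L\<close> by (simp add: mon_ideal_def)
    moreover have "lead_mon ?f = w" using lead_mon_in_keys[OF \<open>?f \<noteq> 0\<close>] by simp
    ultimately show "w \<in> lead_set (mon_ideal L :: 'k bipoly set)" using lead_setI by metis
  qed
qed

lemma mon_upset_lead_set:
  fixes J :: "'k::field bipoly set"
  assumes "poly_ideal n m J"
  shows "mon_upset n m (lead_set J)"
  unfolding mon_upset_def
proof (intro conjI ballI subsetI)
  fix w assume "w \<in> lead_set J"
  then obtain f where f: "f \<in> J" "f \<noteq> 0" "lead_mon f = w" by (rule lead_setE)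
  show "w \<in> mons n m"
    using lead_mon_in_keys[OF f(2)] f poly_idealD(1)[OF assms f(1)] by (auto simp: poly_carrier_iff)
  fix u assume u: "u \<in> mons n m"
  let ?g = "Poly_Mapping.single u (1::'k) * f"
  have "?g \<in> J" using f u by (intro poly_idealD(4)[OF assms] poly_carrier_single)
  moreover have "?g \<noteq> 0" using f by (simp add: single_mult_eq_0_iff)
  moreover have "lead_mon ?g = u + w" using f by (simp add: lead_mon_single_mult)
  ultimately show "u + w \<in> lead_set J" using lead_setI by metis
qed

text \<open>The leading monomials are closed under multiplication by monomials, so no further monomials
  appear in the ideal that they generate.\<close>

lemma initial_ideal_eq:
  assumes J: "poly_ideal n m J"
  shows "initial_ideal n m J = mon_ideal (lead_set J)"
proof
  let ?B = "{bimonom (lead_mon f) | f. f \<in> J \<and> f \<noteq> 0}"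
  note up = mon_upset_lead_set[OF J]
  have B: "?B \<subseteq> mon_ideal (lead_set J)"
    by (auto simp: mon_ideal_def bimonom_def intro: lead_setI)
  have Bc: "?B \<subseteq> poly_carrier n m"
    using up by (auto simp: bimonom_def poly_carrier_iff mon_upset_def intro: lead_setI)
  show "initial_ideal n m J \<subseteq> mon_ideal (lead_set J)"
    unfolding initial_ideal_def using bigradedD(1)[OF bigraded_mon_ideal[OF up]] B by (rule Idl_least)
  show "mon_ideal (lead_set J) \<subseteq> initial_ideal n m J"
  proof
    fix f :: "'a bipoly" assume f: "f \<in> mon_ideal (lead_set J)"
    have "(\<Sum>w\<in>keys f. bconst (lookup f w) * bimonom w) \<in> initial_ideal n m J"
      unfolding initial_ideal_def
    proof (intro poly_ideal_sum[OF Idl_poly_ideal[OF Bc]] poly_idealD(4)[OF Idl_poly_ideal[OF Bc]] poly_carrier_bconst)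
      fix w assume "w \<in> keys f"
      then have "w \<in> lead_set J" using f by (auto simp: mon_ideal_def)
      then have "bimonom w \<in> ?B" by (auto simp: lead_set_def)
      then show "bimonom w \<in> Idl\<^bsub>bipoly_ring n m\<^esub> ?B" using Idl_superset[OF Bc] by blast
    qed
    then show "f \<in> initial_ideal n m J"
      by (metis (no_types, lifting) finite_keys order_refl poly_mapping_expand
          single_eq_bconst_bimonom sum.cong)
  qed
qed

lemma lead_set_homogeneous:
  assumes J: "bigraded n m J" and w: "w \<in> lead_set J"
  obtains f where "f \<in> J" "f \<in> bihom n m (bideg w)" "f \<noteq> 0" "lead_mon f = w"
proof -
  obtain g where g: "g \<in> J" "g \<noteq> 0" "lead_mon g = w" using w by (rule lead_setE)
  let ?f = "hcomp (bideg w) g"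
  have l: "lookup ?f w \<noteq> 0" using lookup_lead_mon[OF g(2)] g(3) by (simp add: lookup_restr)
  have "lead_mon ?f = w"
    using l lookup_above_lead_mon[of _ g] g(3) by (intro lead_mon_eqI) (simp_all add: lookup_restr)
  moreover have "?f \<noteq> 0" using l by auto
  ultimately show thesis
    using that[of ?f] bigradedD[OF J] g(1) hcomp_bihom poly_idealD(1) by blast
qed


subsection \<open>Dickson's lemma\<close>

text \<open>Induction on the number of coordinates. Representatives for all but one coordinate suffice for
  the elements whose remaining coordinate is at least the bound \<open>B\<close>; each of the finitely many
  smaller values of that coordinate gets its own representatives.\<close>

lemma dickson_nat:
  fixes h :: "'b \<Rightarrow> 'a \<Rightarrow> nat"
  assumes "finite K"
  shows "\<exists>Q0\<subseteq>Q. finite Q0 \<and> (\<forall>f\<in>Q. \<exists>q\<in>Q0. \<forall>i\<in>K. h q i \<le> h f i)"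
  using assms
proof (induction K arbitrary: Q rule: finite_induct)
  case empty
  show ?case
  proof (cases "Q = {}")
    case False
    then obtain q where "q \<in> Q" by blast
    then show ?thesis by (intro exI[of _ "{q}"]) simp
  qed simp
next
  case (insert k K)
  obtain Q0 where Q0: "Q0 \<subseteq> Q" "finite Q0" "\<forall>f\<in>Q. \<exists>q\<in>Q0. \<forall>i\<in>K. h q i \<le> h f i"
    using insert.IH[of Q] by blast
  obtain B where B: "\<forall>q\<in>Q0. h q k \<le> B"
    using finite_nat_set_iff_bounded_le[of "(\<lambda>q. h q k) ` Q0"] Q0(2) by auto
  have "\<exists>R. \<forall>v. R v \<subseteq> {f \<in> Q. h f k = v} \<and> finite (R v) \<and>
      (\<forall>f\<in>{f \<in> Q. h f k = v}. \<exists>q\<in>R v. \<forall>i\<in>K. h q i \<le> h f i)"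
    by (intro choice allI) (rule insert.IH)
  then obtain R where R': "\<forall>v. R v \<subseteq> {f \<in> Q. h f k = v} \<and> finite (R v) \<and>
      (\<forall>f\<in>{f \<in> Q. h f k = v}. \<exists>q\<in>R v. \<forall>i\<in>K. h q i \<le> h f i)" by (rule exE)
  have R: "R v \<subseteq> {f \<in> Q. h f k = v}" "finite (R v)"
    "f \<in> Q \<Longrightarrow> h f k = v \<Longrightarrow> \<exists>q\<in>R v. \<forall>i\<in>K. h q i \<le> h f i" for v f
    using R'[rule_format, of v] by blast+
  let ?Q = "Q0 \<union> (\<Union>v\<in>{..<B}. R v)"
  have "\<exists>q\<in>?Q. \<forall>i\<in>insert k K. h q i \<le> h f i" if f: "f \<in> Q" for f
  proof (cases "h f k < B")
    case True
    obtain q where q: "q \<in> R (h f k)" "\<forall>i\<in>K. h q i \<le> h f i" using R(3)[OF f refl] by blast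
    then have "h q k = h f k" using R(1) by blast
    then show ?thesis using q True by (intro bexI[of _ q]) auto
  next
    case False
    obtain q where q: "q \<in> Q0" "\<forall>i\<in>K. h q i \<le> h f i" using Q0(3) f by blast
    then have "h q k \<le> h f k" using B False by fastforce
    then show ?thesis using q by (intro bexI[of _ q]) auto
  qed
  moreover have "?Q \<subseteq> Q" using Q0(1) R(1) by blast
  moreover have "finite ?Q" using Q0(2) R(2) by simp
  ultimately show ?case by (intro exI[of _ ?Q]) blast
qed

lemma dickson:
  assumes "Q \<subseteq> mons n m"
  obtains Q0 where "Q0 \<subseteq> Q" "finite Q0" "\<And>w. w \<in> Q \<Longrightarrow> \<exists>q\<in>Q0. \<exists>u\<in>mons n m. w = u + q"
proof -
  let ?h = "\<lambda>w. case_sum (lookup (fst w)) (lookup (snd w)) :: nat + nat \<Rightarrow> nat"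
  let ?K = "Inl ` {..<n} \<union> Inr ` {..<m} :: (nat + nat) set"
  have "finite ?K" by simp
  from dickson_nat[OF this, of Q ?h] obtain Q0 where Q0: "Q0 \<subseteq> Q" "finite Q0"
    "\<forall>w\<in>Q. \<exists>q\<in>Q0. \<forall>i\<in>?K. ?h q i \<le> ?h w i" by blast
  have "\<exists>q\<in>Q0. \<exists>u\<in>mons n m. w = u + q" if w: "w \<in> Q" for w
  proof -
    obtain q where q: "q \<in> Q0" "\<forall>i\<in>?K. ?h q i \<le> ?h w i" using Q0(3) w by blast
    have qm: "q \<in> mons n m" and wm: "w \<in> mons n m" using assms Q0(1) q(1) w by auto
    have le1: "lookup (fst q) i \<le> lookup (fst w) i" for i
    proof (cases "i < n")
      case True
      then have "Inl i \<in> ?K" by simp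
      from bspec[OF q(2) this] show ?thesis by simp
    next
      case False
      then have "i \<notin> keys (fst q)" using qm by (auto simp: mons_def)
      then show ?thesis by (simp add: in_keys_iff)
    qed
    have le2: "lookup (snd q) i \<le> lookup (snd w) i" for i
    proof (cases "i < m")
      case True
      then have "Inr i \<in> ?K" by simp
      from bspec[OF q(2) this] show ?thesis by simp
    next
      case False
      then have "i \<notin> keys (snd q)" using qm by (auto simp: mons_def)
      then show ?thesis by (simp add: in_keys_iff)
    qed
    let ?u = "(fst w - fst q, snd w - snd q)"
    have eq: "w = ?u + q"
      using le1 le2 by (intro prod_eqI poly_mapping_eqI) (simp_all add: lookup_add minus_poly_mapping.rep_eq)
    then have "?u \<in> mons n m" using wm mons_add by metis
    then show ?thesis using q(1) eq by blast
  qed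
  then show thesis using that Q0 by blast
qed

section \<open>Graded submodules of free modules are finitely generated\<close>

text \<open>A vector is a function that vanishes from its length on, so that equality of vectors is equality
  of functions and sums and differences are those of functions.\<close>

definition fvec :: "nat \<Rightarrow> nat \<Rightarrow> nat \<Rightarrow> (nat \<Rightarrow> 'k::field bipoly) set" where
  "fvec n m r = {v. (\<forall>j<r. v j \<in> poly_carrier n m) \<and> (\<forall>j\<ge>r. v j = 0)}"

definition hvec ::
  "nat \<Rightarrow> nat \<Rightarrow> nat \<Rightarrow> (nat \<Rightarrow> int \<times> int) \<Rightarrow> int \<times> int \<Rightarrow> (nat \<Rightarrow> 'k::field bipoly) set" where
  "hvec n m r s c = {v. (\<forall>j<r. v j \<in> bihom n m (c - s j)) \<and> (\<forall>j\<ge>r. v j = 0)}"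

definition mat_app ::
  "nat \<Rightarrow> nat \<Rightarrow> (nat \<Rightarrow> nat \<Rightarrow> 'k::field bipoly) \<Rightarrow> (nat \<Rightarrow> 'k bipoly) \<Rightarrow> nat \<Rightarrow> 'k bipoly" where
  "mat_app p q B v = (\<lambda>k. if k < p then \<Sum>j<q. B k j * v j else 0)"

definition vcomp ::
  "nat \<Rightarrow> (nat \<Rightarrow> int \<times> int) \<Rightarrow> int \<times> int \<Rightarrow> (nat \<Rightarrow> 'k::field bipoly) \<Rightarrow> nat \<Rightarrow> 'k bipoly" where
  "vcomp r s c v = (\<lambda>j. if j < r then hcomp (c - s j) (v j) else 0)"

definition vscale :: "'k::field bipoly \<Rightarrow> (nat \<Rightarrow> 'k bipoly) \<Rightarrow> nat \<Rightarrow> 'k bipoly" where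
  "vscale f v = (\<lambda>j. f * v j)"

lemma fvec_add: "v \<in> fvec n m r \<Longrightarrow> w \<in> fvec n m r \<Longrightarrow> v + w \<in> fvec n m r"
  by (simp add: fvec_def poly_carrier_add)

lemma fvec_diff: "v \<in> fvec n m r \<Longrightarrow> w \<in> fvec n m r \<Longrightarrow> v - w \<in> fvec n m r"
  by (simp add: fvec_def poly_carrier_diff)

lemma fvec_zero [simp]: "0 \<in> fvec n m r"
  by (simp add: fvec_def)

lemma fvec_scale: "f \<in> poly_carrier n m \<Longrightarrow> v \<in> fvec n m r \<Longrightarrow> vscale f v \<in> fvec n m r"
  by (simp add: fvec_def vscale_def poly_carrier_mult)

lemma hvec_fvec: "v \<in> hvec n m r s c \<Longrightarrow> v \<in> fvec n m r"
  unfolding fvec_def hvec_def using bihom_carrier by blast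

lemma hvec_add: "v \<in> hvec n m r s c \<Longrightarrow> w \<in> hvec n m r s c \<Longrightarrow> v + w \<in> hvec n m r s c"
  by (simp add: hvec_def bihom_add)

lemma hvec_diff: "v \<in> hvec n m r s c \<Longrightarrow> w \<in> hvec n m r s c \<Longrightarrow> v - w \<in> hvec n m r s c"
  by (simp add: hvec_def bihom_diff)

lemma hvec_zero [simp]: "0 \<in> hvec n m r s c"
  by (simp add: hvec_def)

lemma hvec_scale:
  assumes "f \<in> bihom n m d" "v \<in> hvec n m r s c"
  shows "vscale f v \<in> hvec n m r s (d + c)"
proof -
  have "f * v j \<in> bihom n m (d + c - s j)" if "j < r" for j
    using bihom_mult[OF assms(1), of "v j" "c - s j"] assms(2) that
    by (simp add: hvec_def add_diff_eq)
  then show ?thesis using assms(2) by (simp add: hvec_def vscale_def)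
qed

lemma vcomp_hvec: "v \<in> fvec n m r \<Longrightarrow> vcomp r s c v \<in> hvec n m r s c"
  by (simp add: fvec_def hvec_def vcomp_def hcomp_bihom)

lemma vcomp_id: "v \<in> hvec n m r s c \<Longrightarrow> vcomp r s c v = v"
  by (rule ext) (auto simp: hvec_def vcomp_def intro: hcomp_id)

lemma mat_app_add: "mat_app p q B (v + w) = mat_app p q B v + mat_app p q B w"
  by (rule ext) (simp add: mat_app_def distrib_left sum.distrib)

lemma mat_app_diff: "mat_app p q B (v - w) = mat_app p q B v - mat_app p q B w"
  by (rule ext) (simp add: mat_app_def right_diff_distrib sum_subtractf)

lemma mat_app_zero [simp]: "mat_app p q B 0 = 0"
  by (rule ext) (simp add: mat_app_def)

lemma mat_app_scale: "mat_app p q B (vscale f v) = vscale f (mat_app p q B v)"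
  by (rule ext) (simp add: mat_app_def vscale_def sum_distrib_left mult.left_commute)

definition hmat ::
  "nat \<Rightarrow> nat \<Rightarrow> nat \<Rightarrow> nat \<Rightarrow> (nat \<Rightarrow> int \<times> int) \<Rightarrow> (nat \<Rightarrow> int \<times> int) \<Rightarrow>
   (nat \<Rightarrow> nat \<Rightarrow> 'k::field bipoly) \<Rightarrow> bool" where
  "hmat n m p q s t B \<longleftrightarrow> (\<forall>k<p. \<forall>j<q. B k j \<in> bihom n m (t j - s k))"

lemma mat_app_fvec:
  assumes "hmat n m p q s t B" "v \<in> fvec n m q"
  shows "mat_app p q B v \<in> fvec n m p"
proof -
  have "B k j * v j \<in> poly_carrier n m" if "k < p" "j < q" for k j
  proof (rule poly_carrier_mult)
    show "B k j \<in> poly_carrier n m"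
      using assms(1) that bihom_carrier[of "B k j" n m "t j - s k"] by (simp add: hmat_def)
    show "v j \<in> poly_carrier n m" using assms(2) that by (simp add: fvec_def)
  qed
  then have "(\<Sum>j<q. B k j * v j) \<in> poly_carrier n m" if "k < p" for k
    using that by (intro poly_carrier_sum) simp
  then show ?thesis by (simp add: fvec_def mat_app_def)
qed

lemma mat_app_hvec:
  assumes "hmat n m p q s t B" "v \<in> hvec n m q t c"
  shows "mat_app p q B v \<in> hvec n m p s c"
proof -
  have "B k j * v j \<in> bihom n m (c - s k)" if "k < p" "j < q" for k j
  proof -
    have "B k j * v j \<in> bihom n m (t j - s k + (c - t j))"
      using assms that by (intro bihom_mult) (simp_all add: hmat_def hvec_def)
    then show ?thesis by (simp add: algebra_simps)
  qed
  then have "(\<Sum>j<q. B k j * v j) \<in> bihom n m (c - s k)" if "k < p" for k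
    using that by (intro bihom_sum) simp
  then show ?thesis by (simp add: hvec_def mat_app_def)
qed

lemma vcomp_mat_app:
  assumes "hmat n m p q s t B"
  shows "vcomp p s c (mat_app p q B v) = mat_app p q B (vcomp q t c v)"
proof (rule ext)
  fix k
  show "vcomp p s c (mat_app p q B v) k = mat_app p q B (vcomp q t c v) k"
  proof (cases "k < p")
    case True
    have "hcomp (c - s k) (\<Sum>j<q. B k j * v j) = (\<Sum>j<q. hcomp (c - s k) (B k j * v j))"
      by (rule restr_sum)
    also have "\<dots> = (\<Sum>j<q. B k j * hcomp (c - t j) (v j))"
    proof (rule sum.cong[OF refl])
      fix j assume "j \<in> {..<q}"
      then have "B k j \<in> bihom n m (t j - s k)" using assms True by (simp add: hmat_def)
      from hcomp_mult[OF this, of "c - s k" "v j"]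
      show "hcomp (c - s k) (B k j * v j) = B k j * hcomp (c - t j) (v j)" by simp
    qed
    finally show ?thesis using True by (simp add: vcomp_def mat_app_def)
  qed (simp add: vcomp_def mat_app_def)
qed

lemma fvec_in_if_components_in:
  assumes v: "v \<in> fvec n m r" and N0: "0 \<in> N" and Nadd: "\<And>u w. u \<in> N \<Longrightarrow> w \<in> N \<Longrightarrow> u + w \<in> N"
    and comp: "\<And>c. vcomp r s c v \<in> N"
  shows "v \<in> N"
proof -
  define C where "C = (\<Union>j<r. (\<lambda>w. bideg w + s j) ` keys (v j))"
  have fin: "finite C" by (simp add: C_def)
  have "v = (\<Sum>c\<in>C. vcomp r s c v)"
  proof (rule ext)
    fix j
    have sum_app: "(\<Sum>c\<in>C. vcomp r s c v) j = (\<Sum>c\<in>C. vcomp r s c v j)"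
      using fin by (induction C rule: finite_induct) simp_all
    show "v j = (\<Sum>c\<in>C. vcomp r s c v) j"
    proof (cases "j < r")
      case True
      have "(\<Sum>c\<in>C. vcomp r s c v j) = (\<Sum>c\<in>(\<lambda>c. c - s j) ` C. hcomp c (v j))"
        using True by (subst sum.reindex) (auto simp: vcomp_def inj_on_def)
      also have "\<dots> = v j"
      proof (rule sum_hcomp)
        show "bideg ` keys (v j) \<subseteq> (\<lambda>c. c - s j) ` C"
        proof
          fix c assume "c \<in> bideg ` keys (v j)"
          then have "c + s j \<in> C" using True by (auto simp: C_def)
          then show "c \<in> (\<lambda>c. c - s j) ` C" by (metis add_diff_cancel_right' image_eqI)
        qed
      qed (use fin in simp)
      finally show ?thesis using sum_app by simp
    next
      case False
      then show ?thesis using v sum_app by (simp add: fvec_def vcomp_def)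
    qed
  qed
  moreover have "(\<Sum>c\<in>C. vcomp r s c v) \<in> N"
    using fin by (induction C rule: finite_induct) (simp_all only: sum.empty sum.insert N0 Nadd comp not_False_eq_True)
  ultimately show ?thesis by simp
qed

definition graded_submodule ::
  "nat \<Rightarrow> nat \<Rightarrow> nat \<Rightarrow> (nat \<Rightarrow> int \<times> int) \<Rightarrow> (nat \<Rightarrow> 'k::field bipoly) set \<Rightarrow> bool" where
  "graded_submodule n m r s N \<longleftrightarrow> N \<subseteq> fvec n m r \<and> 0 \<in> N \<and> (\<forall>v\<in>N. \<forall>w\<in>N. v + w \<in> N) \<and>
     (\<forall>v\<in>N. \<forall>f\<in>poly_carrier n m. vscale f v \<in> N) \<and> (\<forall>v\<in>N. \<forall>c. vcomp r s c v \<in> N)"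

lemma graded_submoduleD:
  assumes "graded_submodule n m r s N"
  shows "v \<in> N \<Longrightarrow> v \<in> fvec n m r" "0 \<in> N" "v \<in> N \<Longrightarrow> w \<in> N \<Longrightarrow> v + w \<in> N"
    "v \<in> N \<Longrightarrow> f \<in> poly_carrier n m \<Longrightarrow> vscale f v \<in> N" "v \<in> N \<Longrightarrow> vcomp r s c v \<in> N"
  using assms unfolding graded_submodule_def by blast+

lemma graded_submodule_diff:
  assumes "graded_submodule n m r s N" "v \<in> N" "w \<in> N"
  shows "v - w \<in> N"
proof -
  have "vscale (- 1) w \<in> N" using graded_submoduleD(4)[OF assms(1,3)] by (simp add: poly_carrier_uminus)
  then have "v + vscale (- 1) w \<in> N" by (rule graded_submoduleD(3)[OF assms(1,2)])
  moreover have "v + vscale (- 1) w = v - w" by (rule ext) (simp add: vscale_def)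
  ultimately show ?thesis by simp
qed

lemma graded_submodule_image:
  assumes B: "hmat n m p q s t B"
  shows "graded_submodule n m p s (mat_app p q B ` fvec n m q)"
  unfolding graded_submodule_def
proof (intro conjI ballI allI)
  show "mat_app p q B ` fvec n m q \<subseteq> fvec n m p" using mat_app_fvec[OF B] by blast
  show "0 \<in> mat_app p q B ` fvec n m q" by (rule image_eqI[where x = 0]) simp_all
  fix v assume "v \<in> mat_app p q B ` fvec n m q"
  then obtain v' where v: "v = mat_app p q B v'" "v' \<in> fvec n m q" by blast
  show "v + w \<in> mat_app p q B ` fvec n m q" if w_in: "w \<in> mat_app p q B ` fvec n m q" for w
  proof -
    obtain w' where w: "w = mat_app p q B w'" "w' \<in> fvec n m q" using w_in by blast
    show ?thesis
      unfolding v(1) w(1) mat_app_add[symmetric] by (intro imageI fvec_add v(2) w(2))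
  qed
  show "vscale f v \<in> mat_app p q B ` fvec n m q" if "f \<in> poly_carrier n m" for f
    unfolding v(1) mat_app_scale[symmetric] by (intro imageI fvec_scale that v(2))
  show "vcomp p s c v \<in> mat_app p q B ` fvec n m q" for c
    unfolding v(1) vcomp_mat_app[OF B] by (intro imageI hvec_fvec[OF vcomp_hvec] v(2))
qed

lemma graded_submodule_kernel:
  assumes B: "hmat n m p q s t B"
  shows "graded_submodule n m q t {v \<in> fvec n m q. mat_app p q B v = 0}"
  unfolding graded_submodule_def
proof (intro conjI ballI allI)
  fix v :: "nat \<Rightarrow> 'a bipoly" assume "v \<in> {v \<in> fvec n m q. mat_app p q B v = 0}"
  then have v: "v \<in> fvec n m q" "mat_app p q B v = 0" by auto
  show "v + w \<in> {v \<in> fvec n m q. mat_app p q B v = 0}"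
    if "w \<in> {v \<in> fvec n m q. mat_app p q B v = 0}" for w
    using that v fvec_add[of v n m q w] by (simp add: mat_app_add)
  show "vscale f v \<in> {v \<in> fvec n m q. mat_app p q B v = 0}" if "f \<in> poly_carrier n m" for f
  proof -
    have "mat_app p q B (vscale f v) = 0"
      unfolding mat_app_scale v(2) by (rule ext) (simp add: vscale_def)
    then show ?thesis using fvec_scale[OF that v(1)] by simp
  qed
  show "vcomp q t c v \<in> {v \<in> fvec n m q. mat_app p q B v = 0}" for c
  proof -
    have "mat_app p q B (vcomp q t c v) = vcomp p s c (mat_app p q B v)"
      by (rule vcomp_mat_app[OF B, symmetric])
    also have "\<dots> = 0" unfolding v(2) by (rule ext) (simp add: vcomp_def)
    finally show ?thesis using hvec_fvec[OF vcomp_hvec[OF v(1)]] by simp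
  qed
qed auto

text \<open>A Groebner basis argument: for each position, finitely many elements of the submodule have
  first nonzero entries there whose leading monomials divide all others, by Dickson's lemma. They
  generate, since \<open>subspace_eq_if_same_leads\<close> applies to the entries at each position.\<close>

theorem graded_submodule_finitely_generated:
  fixes N :: "(nat \<Rightarrow> 'k::field bipoly) set"
  assumes N: "graded_submodule n m r s N"
  shows "\<exists>q t B. hmat n m r q s t B \<and> N = mat_app r q B ` fvec n m q"
proof -
  define Q where "Q = (\<lambda>j. {lead_mon (v j) | v c. v \<in> N \<and> v \<in> hvec n m r s c \<and> (\<forall>i<j. v i = 0) \<and> v j \<noteq> 0})"
  have Qm: "Q j \<subseteq> mons n m" if "j < r" for j
  proof
    fix w assume "w \<in> Q j"
    then obtain v where v: "v \<in> N" "v j \<noteq> 0" "w = lead_mon (v j)" unfolding Q_def by blast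
    then have "keys (v j) \<subseteq> mons n m"
      using graded_submoduleD(1)[OF N, of v] that by (simp add: fvec_def poly_carrier_iff)
    then show "w \<in> mons n m" using lead_mon_in_keys[OF v(2)] v(3) by blast
  qed
  have "\<exists>Q0\<subseteq>Q j. finite Q0 \<and> (\<forall>w\<in>Q j. \<exists>q\<in>Q0. \<exists>u\<in>mons n m. w = u + q)" if "j < r" for j
    by (rule dickson[OF Qm[OF that]]) blast
  then have "\<forall>j. \<exists>Q0. j < r \<longrightarrow> Q0 \<subseteq> Q j \<and> finite Q0 \<and>
      (\<forall>w\<in>Q j. \<exists>q\<in>Q0. \<exists>u\<in>mons n m. w = u + q)" by meson
  from choice[OF this] obtain Q0 where Q0': "\<forall>j. j < r \<longrightarrow> Q0 j \<subseteq> Q j \<and> finite (Q0 j) \<and>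
      (\<forall>w\<in>Q j. \<exists>q\<in>Q0 j. \<exists>u\<in>mons n m. w = u + q)" by (rule exE)
  have Q0: "Q0 j \<subseteq> Q j" "finite (Q0 j)" "\<And>w. w \<in> Q j \<Longrightarrow> \<exists>q\<in>Q0 j. \<exists>u\<in>mons n m. w = u + q"
    if "j < r" for j
    using Q0'[rule_format, OF that] by simp_all
  define good where "good = (\<lambda>j q g. fst g \<in> N \<and> fst g \<in> hvec n m r s (snd g) \<and>
      (\<forall>i<j. fst g i = 0) \<and> fst g j \<noteq> 0 \<and> lead_mon (fst g j) = q)"
  have ex_good: "\<exists>g. good j q g" if jq: "j < r" "q \<in> Q0 j" for j q
  proof -
    have "q \<in> Q j" using Q0(1)[OF jq(1)] jq(2) by (rule subsetD)
    then have "\<exists>v c. q = lead_mon (v j) \<and> v \<in> N \<and> v \<in> hvec n m r s c \<and> (\<forall>i<j. v i = 0) \<and> v j \<noteq> 0"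
      unfolding Q_def by (rule CollectD)
    then obtain v c where "q = lead_mon (v j) \<and> v \<in> N \<and> v \<in> hvec n m r s c \<and> (\<forall>i<j. v i = 0) \<and> v j \<noteq> 0"
      by (elim exE)
    then have "good j q (v, c)" unfolding good_def fst_conv snd_conv by (elim conjE) (intro conjI, simp_all)
    then show ?thesis by (rule exI)
  qed
  have G0: "good j q (SOME g. good j q g)" if "j < r" "q \<in> Q0 j" for j q
    by (rule someI_ex) (rule ex_good[OF that])
  define G where "G = (\<lambda>j q. SOME g. good j q g)"
  have G: "good j q (G j q)" if "j < r" "q \<in> Q0 j" for j q
    unfolding G_def by (rule G0[OF that])
  have "finite (\<Union>j<r. G j ` Q0 j)" 
    by (rule finite_UN_I) (simp, rule finite_imageI, rule Q0(2), simp)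
  from finite_list[OF this] obtain gs where gs: "set gs = (\<Union>j<r. G j ` Q0 j)" by (rule exE)
  define B where "B = (\<lambda>k l. fst (gs ! l) k)"
  define t where "t = (\<lambda>l. snd (gs ! l))"
  let ?q = "length gs"
  have gsN: "fst (gs ! l) \<in> N" "fst (gs ! l) \<in> hvec n m r s (t l)" if "l < ?q" for l
  proof -
    have "gs ! l \<in> (\<Union>j<r. G j ` Q0 j)" using nth_mem[OF that] unfolding gs .
    then obtain j q where jq: "j < r" "q \<in> Q0 j" "gs ! l = G j q" by blast
    have "good j q (gs ! l)" unfolding jq(3) by (rule G[OF jq(1,2)])
    then show "fst (gs ! l) \<in> N" "fst (gs ! l) \<in> hvec n m r s (t l)" by (simp_all add: good_def t_def)
  qed
  have B: "hmat n m r ?q s t B" using gsN(2) by (simp add: hmat_def B_def hvec_def)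
  let ?M = "mat_app r ?q B ` fvec n m ?q"
  note M = graded_submodule_image[OF B]
  have colM: "fst (gs ! l) \<in> ?M" if "l < ?q" for l
  proof -
    let ?e = "\<lambda>j. if j = l then 1 else 0 :: 'k bipoly"
    have "mat_app r ?q B ?e = fst (gs ! l)"
    proof (rule ext)
      fix k
      have "(\<Sum>j<?q. B k j * ?e j) = (\<Sum>j<?q. if j = l then B k j else 0)" by (intro sum.cong) auto
      also have "\<dots> = B k l" using that by simp
      finally show "mat_app r ?q B ?e k = fst (gs ! l) k"
        using graded_submoduleD(1)[OF N gsN(1)[OF that]] by (simp add: mat_app_def B_def fvec_def)
    qed
    moreover have "?e \<in> fvec n m ?q" using that by (simp add: fvec_def)
    ultimately show ?thesis by (intro image_eqI[of _ _ ?e]) simp_all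
  qed
  have MN: "?M \<subseteq> N"
  proof
    fix v assume "v \<in> ?M"
    then obtain u where u: "u \<in> fvec n m ?q" "v = mat_app r ?q B u" by blast
    have "(\<Sum>l<l0. vscale (u l) (fst (gs ! l))) \<in> N" if "l0 \<le> ?q" for l0
      using that
    proof (induction l0)
      case (Suc l0)
      have "vscale (u l0) (fst (gs ! l0)) \<in> N"
        using u(1) Suc.prems by (intro graded_submoduleD(4)[OF N] gsN) (simp_all add: fvec_def)
      moreover have "(\<Sum>l<l0. vscale (u l) (fst (gs ! l))) \<in> N" using Suc by simp
      ultimately show ?case unfolding sum.lessThan_Suc by (intro graded_submoduleD(3)[OF N])
    qed (simp add: graded_submoduleD(2)[OF N])
    moreover have "(\<Sum>l<?q. vscale (u l) (fst (gs ! l))) = v"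
    proof (rule ext)
      fix k
      have "(\<Sum>l<l0. vscale (u l) (fst (gs ! l))) k = (\<Sum>l<l0. u l * fst (gs ! l) k)" for l0
        by (induction l0) (simp_all add: vscale_def)
      moreover have "fst (gs ! l) k = 0" if "\<not> k < r" "l < ?q" for l
        using graded_submoduleD(1)[OF N gsN(1)[OF that(2)]] that(1) by (simp add: fvec_def)
      ultimately show "(\<Sum>l<?q. vscale (u l) (fst (gs ! l))) k = v k"
        using u(2) by (simp add: mat_app_def B_def mult.commute)
    qed
    ultimately show "v \<in> N" using order_refl by fastforce
  qed
  \<comment> \<open>Descending induction on the number of leading zero entries; at each position the leading
    monomials of the entries are reached by multiples of the chosen generators.\<close>
  have key: "\<forall>c. \<forall>v\<in>N \<inter> hvec n m r s c. (\<forall>i<j. v i = 0) \<longrightarrow> v \<in> ?M" if "j \<le> r" for j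
    using that
  proof (induction j rule: inc_induct)
    case base
    show ?case
    proof (intro allI ballI impI)
      fix c v assume "v \<in> N \<inter> hvec n m r s c" "\<forall>i<r. v i = 0"
      then have "v i = 0" for i by (cases "i < r") (simp_all add: hvec_def)
      then have "v = 0" by (intro ext) simp
      then show "v \<in> ?M" using graded_submoduleD(2)[OF M] by simp
    qed
  next
    case (step j)
    show ?case
    proof (intro allI ballI impI)
      fix c v assume v: "v \<in> N \<inter> hvec n m r s c" and v0: "\<forall>i<j. v i = 0"
      let ?V = "\<lambda>N. {v j | v. v \<in> N \<and> v \<in> hvec n m r s c \<and> (\<forall>i<j. v i = 0)}"
      have scal: "bconst a * v j = vscale (bconst a) v j" for a and v :: "nat \<Rightarrow> 'k bipoly"
        by (simp add: vscale_def)
      have hs: "vscale (bconst a) v \<in> hvec n m r s c" if "v \<in> hvec n m r s c" for a v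
        using hvec_scale[OF bihom_bconst that] by simp
      have "?V N \<subseteq> ?V ?M"
      proof (rule subspace_eq_if_same_leads[OF finite_hmons[of n m "c - s j"]])
        show "keys f \<subseteq> hmons n m (c - s j)" if "f \<in> ?V N" for f
          using that step.hyps by (auto simp: hvec_def bihom_iff)
        show "0 \<in> ?V ?M" using graded_submoduleD(2)[OF M] by (intro CollectI exI[of _ 0]) simp
        show "f + bconst a * g \<in> ?V ?M" if "f \<in> ?V ?M" "g \<in> ?V ?M" for f g a
        proof -
          obtain v w where vw: "f = v j" "v \<in> ?M" "v \<in> hvec n m r s c" "\<forall>i<j. v i = 0"
            "g = w j" "w \<in> ?M" "w \<in> hvec n m r s c" "\<forall>i<j. w i = 0" using \<open>f \<in> ?V ?M\<close> \<open>g \<in> ?V ?M\<close> by blast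
          have "v + vscale (bconst a) w \<in> ?M" by (intro graded_submoduleD(3)[OF M] graded_submoduleD(4)[OF M] vw) simp
          moreover have "v + vscale (bconst a) w \<in> hvec n m r s c" by (intro hvec_add hs vw)
          moreover have "\<forall>i<j. (v + vscale (bconst a) w) i = 0" using vw by (simp add: vscale_def)
          moreover have "f + bconst a * g = (v + vscale (bconst a) w) j" using vw by (simp add: vscale_def)
          ultimately show ?thesis by blast
        qed
        show "f - bconst a * g \<in> ?V N" if "f \<in> ?V N" "g \<in> ?V ?M" for f g a
        proof -
          obtain v w where vw: "f = v j" "v \<in> N" "v \<in> hvec n m r s c" "\<forall>i<j. v i = 0"
            "g = w j" "w \<in> ?M" "w \<in> hvec n m r s c" "\<forall>i<j. w i = 0" using \<open>f \<in> ?V N\<close> \<open>g \<in> ?V ?M\<close> by blast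
          have "w \<in> N" using MN vw(6) by blast
          then have "v - vscale (bconst a) w \<in> N" by (intro graded_submodule_diff[OF N] graded_submoduleD(4)[OF N] vw) simp_all
          moreover have "v - vscale (bconst a) w \<in> hvec n m r s c" by (intro hvec_diff hs vw)
          moreover have "\<forall>i<j. (v - vscale (bconst a) w) i = 0" using vw by (simp add: vscale_def)
          moreover have "f - bconst a * g = (v - vscale (bconst a) w) j" using vw by (simp add: vscale_def)
          ultimately show ?thesis by blast
        qed
        show "lead_set (?V N) \<subseteq> lead_set (?V ?M)"
        proof
          fix w assume "w \<in> lead_set (?V N)"
          then obtain f where f: "f \<in> ?V N" "f \<noteq> 0" "lead_mon f = w" by (rule lead_setE)
          then obtain v where v: "f = v j" "v \<in> N" "v \<in> hvec n m r s c" "\<forall>i<j. v i = 0" by blast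
          have "w \<in> Q j" unfolding Q_def using v f by blast
          then obtain q u where q: "q \<in> Q0 j" "u \<in> mons n m" "w = u + q" using Q0(3) step.hyps by blast
          obtain g d where gd: "G j q = (g, d)" by (cases "G j q")
          have good: "g \<in> N" "g \<in> hvec n m r s d" "\<forall>i<j. g i = 0" "g j \<noteq> 0" "lead_mon (g j) = q"
            using G[OF step.hyps(2) q(1)] unfolding gd good_def fst_conv snd_conv by blast+
          have "(g, d) \<in> set gs" unfolding gs 
            by (rule UN_I[of j], simp add: step.hyps(2), rule image_eqI[of _ _ q], rule gd[symmetric], rule q(1))
          then obtain l where "l < ?q" "gs ! l = (g, d)" by (metis in_set_conv_nth)
          then have gM: "g \<in> ?M" using colM[of l] by simp
          let ?x = "Poly_Mapping.single u (1::'k)"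
          have lead_bideg: "bideg (lead_mon (u j)) = e - s j" if "u \<in> hvec n m r s e" "u j \<noteq> 0" for u e
          proof -
            have "keys (u j) \<subseteq> hmons n m (e - s j)"
              using that(1) step.hyps(2) by (simp add: hvec_def bihom_iff)
            then have "lead_mon (u j) \<in> hmons n m (e - s j)" using lead_mon_in_keys[OF that(2)] by (rule subsetD)
            then show ?thesis by (simp add: hmons_def)
          qed
          have "bideg w = c - s j" using lead_bideg[OF v(3)] f(2,3) v(1) by simp
          moreover have "bideg q = d - s j" using lead_bideg[OF good(2,4)] good(5) by simp
          ultimately have bu: "bideg u + d = c" unfolding q(3) bideg_add by (simp add: algebra_simps)
          have xM: "vscale ?x g \<in> ?M" by (rule graded_submoduleD(4)[OF M gM poly_carrier_single[OF q(2)]])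
          have xh: "vscale ?x g \<in> hvec n m r s c"
            using hvec_scale[OF bihom_single[OF q(2) refl] good(2), of "1::'k"] unfolding bu .
          have x0: "\<forall>i<j. vscale ?x g i = 0" using good(3) unfolding vscale_def by simp
          have xV: "vscale ?x g j \<in> ?V ?M" 
            by (rule CollectI, rule exI[where x = "vscale ?x g"]) (intro conjI refl xM xh x0)
          have xj: "vscale ?x g j = ?x * g j" by (simp only: vscale_def)
          have "vscale ?x g j \<noteq> 0"
            unfolding xj using good(4) by (simp only: single_mult_eq_0_iff[OF one_neq_zero] not_False_eq_True)
          from lead_setI[OF xV this] show "w \<in> lead_set (?V ?M)"
            unfolding xj lead_mon_single_mult[OF one_neq_zero good(4)] good(5) q(3) .
        qed
      qed
      moreover have "v j \<in> ?V N" using v v0 by blast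
      ultimately obtain v' where v': "v j = v' j" "v' \<in> ?M" "v' \<in> hvec n m r s c" "\<forall>i<j. v' i = 0" by blast
      have "v' \<in> N" using MN v'(2) by (rule subsetD)
      then have "v - v' \<in> N" using v by (intro graded_submodule_diff[OF N]) simp
      moreover have "v - v' \<in> hvec n m r s c" using v v'(3) by (intro hvec_diff) simp
      moreover have "\<forall>i<Suc j. (v - v') i = 0" using v'(1,4) v0 by (simp add: less_Suc_eq)
      ultimately have "v - v' \<in> ?M" using step.IH by (meson IntI)
      then have "v - v' + v' \<in> ?M" using v'(2) by (rule graded_submoduleD(3)[OF M])
      then show "v \<in> ?M" by simp
    qed
  qed
  have "N \<subseteq> ?M"
  proof
    fix v assume v: "v \<in> N"
    show "v \<in> ?M"
    proof (rule fvec_in_if_components_in[OF graded_submoduleD(1)[OF N v] graded_submoduleD(2)[OF M] graded_submoduleD(3)[OF M]])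
      fix c show "vcomp r s c v \<in> ?M"
        using key[of 0, rule_format, of "vcomp r s c v" c] graded_submoduleD(5)[OF N v, of c]
          vcomp_hvec[OF graded_submoduleD(1)[OF N v], of s c] by simp
    qed
  qed
  then show ?thesis using MN B by blast
qed


section \<open>Free resolutions\<close>

definition lin_comb :: "nat \<Rightarrow> (nat \<Rightarrow> 'k::field bipoly) \<Rightarrow> (nat \<Rightarrow> 'k bipoly) \<Rightarrow> 'k bipoly" where
  "lin_comb r A v = (\<Sum>j<r. v j * A j)"

text \<open>A bigraded free resolution of \<open>S/J\<close>: the matrix \<open>D i\<close> represents the map from position \<open>i + 1\<close> to
  position \<open>i\<close>, and the \<open>j\<close>-th basis element in position \<open>0\<close> is mapped to the class of \<open>A j\<close>.\<close>

definition is_res ::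
  "nat \<Rightarrow> nat \<Rightarrow> 'k::field bipoly set \<Rightarrow> (nat \<Rightarrow> nat) \<Rightarrow> (nat \<Rightarrow> nat \<Rightarrow> int \<times> int) \<Rightarrow>
   (nat \<Rightarrow> nat \<Rightarrow> nat \<Rightarrow> 'k bipoly) \<Rightarrow> (nat \<Rightarrow> 'k bipoly) \<Rightarrow> bool" where
  "is_res n m J rk sh D A \<longleftrightarrow>
     (\<forall>j<rk 0. A j \<in> bihom n m (sh 0 j)) \<and>
     (\<forall>i. hmat n m (rk i) (rk (Suc i)) (sh i) (sh (Suc i)) (D i)) \<and>
     (\<forall>f\<in>poly_carrier n m. \<exists>v\<in>fvec n m (rk 0). f - lin_comb (rk 0) A v \<in> J) \<and>
     {v \<in> fvec n m (rk 0). lin_comb (rk 0) A v \<in> J}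
       = mat_app (rk 0) (rk 1) (D 0) ` fvec n m (rk 1) \<and>
     (\<forall>i. {v \<in> fvec n m (rk (Suc i)). mat_app (rk i) (rk (Suc i)) (D i) v = 0}
       = mat_app (rk (Suc i)) (rk (Suc (Suc i))) (D (Suc i)) ` fvec n m (rk (Suc (Suc i))))"

theorem resolution_exists:
  fixes J :: "'k::field bipoly set"
  assumes J: "bigraded n m J"
  shows "\<exists>rk sh D A. is_res n m J rk sh D A"
proof -
  note pJ = bigradedD(1)[OF J]
  define P where "P = (\<lambda>i (r, s, q, t, B :: nat \<Rightarrow> nat \<Rightarrow> 'k bipoly). hmat n m r q s t B \<and>
    (i = (0::nat) \<longrightarrow> r = 1 \<and> s = (\<lambda>_. 0) \<and> {v \<in> fvec n m 1. v 0 \<in> J} = mat_app 1 q B ` fvec n m q))"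
  define R where "R = (\<lambda>i::nat. \<lambda>(r :: nat, s :: nat \<Rightarrow> int \<times> int, q :: nat, t :: nat \<Rightarrow> int \<times> int,
    B :: nat \<Rightarrow> nat \<Rightarrow> 'k bipoly) (r' :: nat, s' :: nat \<Rightarrow> int \<times> int, q' :: nat,
    t' :: nat \<Rightarrow> int \<times> int, B' :: nat \<Rightarrow> nat \<Rightarrow> 'k bipoly). r' = q \<and> s' = t \<and>
      {v \<in> fvec n m q. mat_app r q B v = 0} = mat_app q q' B' ` fvec n m q')"
  have "\<exists>f. \<forall>i. P i (f i) \<and> R i (f i) (f (Suc i))"
  proof (rule dependent_nat_choice)
    let ?N = "{v \<in> fvec n m 1. v 0 \<in> J}"
    have "graded_submodule n m 1 (\<lambda>_. 0) ?N"
      unfolding graded_submodule_def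
    proof (intro conjI ballI allI)
      fix v assume v: "v \<in> ?N"
      then have vf: "v \<in> fvec n m 1" by blast
      show "v + w \<in> ?N" if "w \<in> ?N" for w 
        using v that fvec_add[of v n m 1 w] poly_idealD(3)[OF pJ] by simp
      show "vscale f v \<in> ?N" if "f \<in> poly_carrier n m" for f
        using fvec_scale[OF that vf] v that poly_idealD(4)[OF pJ] by (simp add: vscale_def)
      show "vcomp 1 (\<lambda>_. 0) c v \<in> ?N" for c
        using hvec_fvec[OF vcomp_hvec[OF vf]] v bigradedD(2)[OF J] by (simp add: vcomp_def)
    qed (use poly_idealD(2)[OF pJ] in auto)
    from graded_submodule_finitely_generated[OF this]
    obtain q t B where "hmat n m 1 q (\<lambda>_. 0) t B" "?N = mat_app 1 q B ` fvec n m q" by blast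
    then have "P 0 (1, \<lambda>_. 0, q, t, B)" by (simp add: P_def)
    then show "\<exists>x. P 0 x" by blast
  next
    fix x i assume Px: "P i x"
    obtain r s q t B where x: "x = (r, s, q, t, B)" by (cases x)
    have "hmat n m r q s t B" using Px unfolding x P_def by simp
    from graded_submodule_finitely_generated[OF graded_submodule_kernel[OF this]]
    obtain q' t' B' where "hmat n m q q' t t' B'"
      "{v \<in> fvec n m q. mat_app r q B v = 0} = mat_app q q' B' ` fvec n m q'" by blast
    then have "P (Suc i) (q, t, q', t', B') \<and> R i x (q, t, q', t', B')" by (simp add: P_def R_def x)
    then show "\<exists>y. P (Suc i) y \<and> R i x y" by blast
  qed
  then obtain f where f: "\<And>i. P i (f i)" "\<And>i. R i (f i) (f (Suc i))" by blast
  define rk where "rk = (\<lambda>i. fst (f i))"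
  define sh where "sh = (\<lambda>i. fst (snd (f i)))"
  define D where "D = (\<lambda>i. snd (snd (snd (snd (f i)))))"
  define q where "q = (\<lambda>i. fst (snd (snd (f i))))"
  define t where "t = (\<lambda>i. fst (snd (snd (snd (f i)))))"
  have f_eq: "f i = (rk i, sh i, q i, t i, D i)" for i
    by (simp add: rk_def sh_def D_def q_def t_def)
  have qt: "q i = rk (Suc i)" "t i = sh (Suc i)" for i
    using f(2)[of i] unfolding f_eq R_def by simp_all
  have hm: "hmat n m (rk i) (rk (Suc i)) (sh i) (sh (Suc i)) (D i)" for i
    using f(1)[of i] unfolding f_eq P_def qt by simp
  have ex: "{v \<in> fvec n m (rk (Suc i)). mat_app (rk i) (rk (Suc i)) (D i) v = 0}
       = mat_app (rk (Suc i)) (rk (Suc (Suc i))) (D (Suc i)) ` fvec n m (rk (Suc (Suc i)))" for i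
    using f(2)[of i] unfolding f_eq R_def qt by simp
  have r0: "rk 0 = 1" "sh 0 = (\<lambda>_. 0)"
    "{v \<in> fvec n m 1. v 0 \<in> J} = mat_app 1 (rk 1) (D 0) ` fvec n m (rk 1)"
    using f(1)[of 0] unfolding f_eq P_def qt by simp_all
  have "is_res n m J rk sh D (\<lambda>_. 1)"
    unfolding is_res_def
  proof (intro conjI allI ballI impI)
    fix g :: "'k bipoly" assume g: "g \<in> poly_carrier n m"
    show "\<exists>v\<in>fvec n m (rk 0). g - lin_comb (rk 0) (\<lambda>_. 1) v \<in> J"
      by (rule bexI[of _ "\<lambda>j. if j = 0 then g else 0"])
        (use g poly_idealD(2)[OF pJ] r0(1) in \<open>simp_all add: lin_comb_def fvec_def\<close>)
  next
    show "(1 :: 'k bipoly) \<in> bihom n m (sh 0 j)" for j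
      unfolding r0(2) using bihom_bconst[where a = "1::'k"] by (simp add: bconst_def)
  next
    show "{v \<in> fvec n m (rk 0). lin_comb (rk 0) (\<lambda>_. 1) v \<in> J}
       = mat_app (rk 0) (rk 1) (D 0) ` fvec n m (rk 1)"
      using r0 by (simp add: lin_comb_def)
  qed (use hm ex in simp_all)
  then show ?thesis by blast
qed

section \<open>Multiplication by a variable on a graded complex\<close>

definition cycles_at ::
  "(nat \<Rightarrow> 'd \<Rightarrow> 'v::ab_group_add set) \<Rightarrow> (nat \<Rightarrow> 'v \<Rightarrow> 'v) \<Rightarrow> nat \<Rightarrow> 'd \<Rightarrow> 'v set" where
  "cycles_at C d i c = {v \<in> C i c. \<forall>k. i = Suc k \<longrightarrow> d k v = 0}"

definition bounds_at ::
  "(nat \<Rightarrow> 'd \<Rightarrow> 'v::ab_group_add set) \<Rightarrow> (nat \<Rightarrow> 'v \<Rightarrow> 'v) \<Rightarrow> nat \<Rightarrow> 'd \<Rightarrow> 'v set" where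
  "bounds_at C d i c = d i ` C (Suc i) c"

definition acyclic_at ::
  "(nat \<Rightarrow> 'd \<Rightarrow> 'v::ab_group_add set) \<Rightarrow> (nat \<Rightarrow> 'v \<Rightarrow> 'v) \<Rightarrow> nat \<Rightarrow> 'd \<Rightarrow> bool" where
  "acyclic_at C d i c \<longleftrightarrow> cycles_at C d i c \<subseteq> bounds_at C d i c"

text \<open>Here \<open>z\<close> stands for the multiplication by a variable of degree \<open>e\<close> on a complex \<open>C\<close> of vectors of
  polynomials, and \<open>p\<close> sets this variable to zero. The quotient of \<open>C\<close> by the image of \<open>z\<close> is
  represented by the vectors \<open>C'\<close> that are free of the variable. The lemmas are the parts of the long
  exact homology sequence of \<open>0 \<rightarrow> C(-e) \<rightarrow> C \<rightarrow> C' \<rightarrow> 0\<close>, each in a single degree.\<close>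

locale mult_sequence =
  fixes C C' :: "nat \<Rightarrow> 'd::ab_group_add \<Rightarrow> 'v::ab_group_add set"
    and d d' :: "nat \<Rightarrow> 'v \<Rightarrow> 'v" and z p :: "'v \<Rightarrow> 'v" and e :: 'd
  assumes C_zero: "0 \<in> C i c"
    and C_diff: "v \<in> C i c \<Longrightarrow> w \<in> C i c \<Longrightarrow> v - w \<in> C i c"
    and d_mem: "v \<in> C (Suc i) c \<Longrightarrow> d i v \<in> C i c"
    and d_diff: "d i (v - w) = d i v - d i w"
    and d_d: "v \<in> C (Suc (Suc i)) c \<Longrightarrow> d i (d (Suc i) v) = 0"
    and z_mem: "v \<in> C i c \<Longrightarrow> z v \<in> C i (c + e)"
    and z_diff: "z (v - w) = z v - z w"
    and z_inj: "z v = 0 \<Longrightarrow> v = 0"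
    and z_d: "d i (z v) = z (d i v)"
    and p_mem: "v \<in> C i c \<Longrightarrow> p v \<in> C' i c"
    and C'_sub: "C' i c \<subseteq> C i c"
    and p_id: "v \<in> C' i c \<Longrightarrow> p v = v"
    and p_diff: "p (v - w) = p v - p w"
    and p_z: "p (z v) = 0"
    and p_ker: "v \<in> C i (c + e) \<Longrightarrow> p v = 0 \<Longrightarrow> \<exists>u\<in>C i c. v = z u"
    and p_d: "p (d i v) = d' i (p v)"
begin

lemma d_zero: "d i 0 = 0"
  using d_diff[of i 0 0] by simp

lemma z_zero: "z 0 = 0"
  using z_diff[of 0 0] by simp

lemma bounds_zero: "0 \<in> bounds_at C d i c"
  unfolding bounds_at_def by (rule image_eqI[where x = 0]) (simp_all add: d_zero C_zero)

lemma bounds_add: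
  assumes "v \<in> bounds_at C d i c" "w \<in> bounds_at C d i c"
  shows "v + w \<in> bounds_at C d i c"
proof -
  obtain v' w' where vw: "v' \<in> C (Suc i) c" "v = d i v'" "w' \<in> C (Suc i) c" "w = d i w'"
    using assms by (auto simp: bounds_at_def)
  have "v' - (0 - w') \<in> C (Suc i) c" using vw C_diff C_zero by blast
  moreover have "v + w = d i (v' - (0 - w'))" by (simp only: d_diff d_zero vw) simp
  ultimately show ?thesis by (auto simp: bounds_at_def)
qed

lemma bounds_z:
  assumes "v \<in> bounds_at C d i c" shows "z v \<in> bounds_at C d i (c + e)"
proof -
  obtain w where w: "w \<in> C (Suc i) c" "v = d i w" using assms by (auto simp: bounds_at_def)
  then have "z v = d i (z w)" by (simp add: z_d)
  then show ?thesis using z_mem[OF w(1)] by (auto simp: bounds_at_def)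
qed

lemma cycles_zero: "0 \<in> cycles_at C d i c"
  by (simp add: cycles_at_def C_zero d_zero)

lemma cycles_z: "v \<in> cycles_at C d i c \<Longrightarrow> z v \<in> cycles_at C d i (c + e)"
  by (auto simp: cycles_at_def z_mem z_d z_zero)

text \<open>The part \<open>H\<^sub>i(C(-e)) \<rightarrow> H\<^sub>i(C) \<rightarrow> H\<^sub>i(C')\<close>.\<close>

lemma z_surj_if_acyclic:
  assumes ac: "acyclic_at C' d' i c" and v: "v \<in> cycles_at C d i c"
  shows "\<exists>u\<in>cycles_at C d i (c - e). v - z u \<in> bounds_at C d i c"
proof -
  have vC: "v \<in> C i c" using v by (simp add: cycles_at_def)
  have "d' k (p v) = 0" if "i = Suc k" for k
  proof -
    have "d' k (p v) = p (d k v)" by (rule p_d[symmetric])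
    also have "d k v = 0" using v that by (simp add: cycles_at_def)
    finally show ?thesis using p_z[of 0] by (simp add: z_zero)
  qed
  then have "p v \<in> cycles_at C' d' i c" using p_mem[OF vC] by (simp add: cycles_at_def)
  then have "p v \<in> bounds_at C' d' i c" using ac by (auto simp: acyclic_at_def)
  then obtain w where w: "w \<in> C' (Suc i) c" "p v = d' i w" by (auto simp: bounds_at_def)
  have wC: "w \<in> C (Suc i) c" using C'_sub w(1) by blast
  have "p (v - d i w) = 0" using w p_id[OF w(1)] by (simp add: p_diff p_d)
  moreover have "v - d i w \<in> C i (c - e + e)" using C_diff[OF vC d_mem[OF wC]] by simp
  ultimately obtain u where u: "u \<in> C i (c - e)" "v - d i w = z u" using p_ker by blast
  have "d k u = 0" if i: "i = Suc k" for k
  proof (rule z_inj)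
    have "z (d k u) = d k (v - d (Suc k) w)" using u(2) i z_d by metis
    also have "\<dots> = 0" using v wC i by (simp add: d_diff d_d cycles_at_def)
    finally show "z (d k u) = 0" .
  qed
  then have "u \<in> cycles_at C d i (c - e)" using u by (simp add: cycles_at_def)
  moreover have "v - z u = d i w" using u(2) by (simp add: algebra_simps)
  ultimately show ?thesis using wC by (auto simp: bounds_at_def)
qed

text \<open>The part \<open>H\<^bsub>i+1\<^esub>(C') \<rightarrow> H\<^sub>i(C(-e)) \<rightarrow> H\<^sub>i(C)\<close>.\<close>

lemma z_inj_if_acyclic:
  assumes ac: "acyclic_at C' d' (Suc i) (c + e)" and u: "u \<in> C i c"
    and zu: "z u \<in> bounds_at C d i (c + e)"
  shows "u \<in> bounds_at C d i c"
proof -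
  obtain v where v: "v \<in> C (Suc i) (c + e)" "z u = d i v" using zu by (auto simp: bounds_at_def)
  have "d' i (p v) = p (z u)" using v by (simp add: p_d)
  then have "p v \<in> cycles_at C' d' (Suc i) (c + e)" using p_mem[OF v(1)] by (simp add: cycles_at_def p_z)
  then have "p v \<in> bounds_at C' d' (Suc i) (c + e)" using ac by (auto simp: acyclic_at_def)
  then obtain w where w: "w \<in> C' (Suc (Suc i)) (c + e)" "p v = d' (Suc i) w" by (auto simp: bounds_at_def)
  have wC: "w \<in> C (Suc (Suc i)) (c + e)" using C'_sub w(1) by blast
  have "p (v - d (Suc i) w) = 0" using w p_id[OF w(1)] by (simp add: p_diff p_d)
  then obtain s where s: "s \<in> C (Suc i) c" "v - d (Suc i) w = z s"
    using p_ker C_diff[OF v(1) d_mem[OF wC]] by blast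
  have "z (u - d i s) = d i v - d i (z s)" using v(2) by (simp add: z_diff z_d)
  also have "\<dots> = d i (v - (v - d (Suc i) w))" unfolding s(2) by (simp add: d_diff)
  also have "\<dots> = 0" using d_d[OF wC] by simp
  finally have "u = d i s" using z_inj by fastforce
  then show ?thesis using s(1) by (auto simp: bounds_at_def)
qed

lemma acyclic_0_if_z_surj:
  assumes sur: "\<And>v. v \<in> cycles_at C d 0 c \<Longrightarrow>
      \<exists>u\<in>cycles_at C d 0 (c - e). v - z u \<in> bounds_at C d 0 c"
  shows "acyclic_at C' d' 0 c"
  unfolding acyclic_at_def
proof
  fix v assume v: "v \<in> cycles_at C' d' 0 c"
  then have v': "v \<in> C' 0 c" by (simp add: cycles_at_def)
  then have "v \<in> cycles_at C d 0 c" using C'_sub by (auto simp: cycles_at_def)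
  then obtain u where "v - z u \<in> bounds_at C d 0 c" using sur by blast
  then obtain w where w: "w \<in> C (Suc 0) c" "v - z u = d 0 w" by (auto simp: bounds_at_def)
  have "v = p (v - z u)" using p_id[OF v'] by (simp add: p_diff p_z)
  also have "\<dots> = d' 0 (p w)" by (simp add: w(2) p_d)
  finally show "v \<in> bounds_at C' d' 0 c" using p_mem[OF w(1)] by (auto simp: bounds_at_def)
qed

text \<open>The part \<open>H\<^bsub>i+1\<^esub>(C(-e)) \<rightarrow> H\<^bsub>i+1\<^esub>(C) \<rightarrow> H\<^bsub>i+1\<^esub>(C') \<rightarrow> H\<^sub>i(C(-e)) \<rightarrow> H\<^sub>i(C)\<close>.\<close>

lemma acyclic_Suc_if_z_surj_z_inj:
  assumes sur: "\<And>v. v \<in> cycles_at C d (Suc i) c \<Longrightarrow>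
      \<exists>u\<in>cycles_at C d (Suc i) (c - e). v - z u \<in> bounds_at C d (Suc i) c"
    and inj: "\<And>u. u \<in> cycles_at C d i (c - e) \<Longrightarrow> z u \<in> bounds_at C d i c \<Longrightarrow>
      u \<in> bounds_at C d i (c - e)"
  shows "acyclic_at C' d' (Suc i) c"
  unfolding acyclic_at_def
proof
  fix v assume v: "v \<in> cycles_at C' d' (Suc i) c"
  then have v': "v \<in> C' (Suc i) c" and dv: "d' i v = 0" by (simp_all add: cycles_at_def)
  have vC: "v \<in> C (Suc i) c" using v' C'_sub by blast
  have "p (d i v) = 0" using p_id[OF v'] dv by (simp add: p_d)
  moreover have "d i v \<in> C i (c - e + e)" using d_mem[OF vC] by simp
  ultimately obtain u where u: "u \<in> C i (c - e)" "d i v = z u" using p_ker by blast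
  have "d k u = 0" if i: "i = Suc k" for k
  proof (rule z_inj)
    have "z (d k u) = d k (d (Suc k) v)" using u(2) i z_d by metis
    also have "\<dots> = 0" using vC i by (simp add: d_d)
    finally show "z (d k u) = 0" .
  qed
  then have "u \<in> cycles_at C d i (c - e)" using u by (simp add: cycles_at_def)
  moreover have "z u \<in> bounds_at C d i c" using u(2) vC unfolding bounds_at_def by (metis imageI)
  ultimately have "u \<in> bounds_at C d i (c - e)" by (rule inj)
  then obtain s where s: "s \<in> C (Suc i) (c - e)" "u = d i s" by (auto simp: bounds_at_def)
  have zs: "z s \<in> C (Suc i) c" using z_mem[OF s(1)] by simp
  have "d i (v - z s) = 0" using u(2) s(2) by (simp add: d_diff z_d)
  then have "v - z s \<in> cycles_at C d (Suc i) c" using C_diff[OF vC zs] by (simp add: cycles_at_def)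
  then obtain u' where "v - z s - z u' \<in> bounds_at C d (Suc i) c" using sur by blast
  then obtain w where w: "w \<in> C (Suc (Suc i)) c" "v - z s - z u' = d (Suc i) w"
    by (auto simp: bounds_at_def)
  have "v = p (v - z s - z u')" using p_id[OF v'] by (simp add: p_diff p_z)
  also have "\<dots> = d' (Suc i) (p w)" by (simp add: w(2) p_d)
  finally show "v \<in> bounds_at C' d' (Suc i) c" using p_mem[OF w(1)] by (auto simp: bounds_at_def)
qed

lemma z_surj_if_acyclic_above:
  assumes "acyclic_at C d i c" "v \<in> cycles_at C d i c"
  shows "\<exists>u\<in>cycles_at C d i (c - e). v - z u \<in> bounds_at C d i c"
proof (rule bexI[OF _ cycles_zero])
  have "v \<in> bounds_at C d i c" using assms by (auto simp: acyclic_at_def)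
  then show "v - z 0 \<in> bounds_at C d i c" by (simp add: z_zero)
qed

end


section \<open>Setting variables to zero in a free resolution\<close>

definition vrestr :: "bimon set \<Rightarrow> (nat \<Rightarrow> 'k::field bipoly) \<Rightarrow> nat \<Rightarrow> 'k bipoly" where
  "vrestr S v = (\<lambda>j. restr S (v j))"

lemma vrestr_diff: "vrestr S (v - w) = vrestr S v - vrestr S w"
  by (rule ext) (simp add: vrestr_def restr_diff)

lemma restr_bihom:
  "f \<in> bihom n m c \<Longrightarrow> restr (mons a b) f \<in> bihom a b c"
  by (auto simp: bihom_iff keys_restr hmons_def)

lemma hvec_restr: "v \<in> hvec n m r s c \<Longrightarrow> vrestr (mons a b) v \<in> hvec a b r s c"
  unfolding hvec_def vrestr_def by (auto intro: restr_bihom)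

lemma bihom_mono: "a \<le> n \<Longrightarrow> b \<le> m \<Longrightarrow> bihom a b c \<subseteq> bihom n m c"
  unfolding bihom_iff[abs_def] subset_iff bihom_iff hmons_def using mons_mono by blast

lemma hvec_mono: "a \<le> n \<Longrightarrow> b \<le> m \<Longrightarrow> hvec a b r s c \<subseteq> hvec n m r s c"
  unfolding hvec_def using bihom_mono[of a n b m] by blast

lemma hvec_restr_id: "v \<in> hvec a b r s c \<Longrightarrow> vrestr (mons a b) v = v"
proof (rule ext)
  fix j assume v: "v \<in> hvec a b r s c"
  have "keys (v j) \<subseteq> mons a b"
  proof (cases "j < r")
    case True
    then show ?thesis using v by (auto simp: hvec_def bihom_iff hmons_def)
  next
    case False
    then show ?thesis using v by (simp add: hvec_def)
  qed
  then show "vrestr (mons a b) v j = v j" by (simp add: vrestr_def restr_id)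
qed

lemma restr_mons_mult:
  "restr (mons a b) (f * g) = restr (mons a b) f * restr (mons a b) g" for f g :: "'k::field bipoly"
  by (rule restr_mult) (rule mons_add)

lemma vrestr_mat_app:
  "vrestr (mons a b) (mat_app p q B v)
    = mat_app p q (\<lambda>k j. restr (mons a b) (B k j)) (vrestr (mons a b) v)"
  by (rule ext) (simp add: vrestr_def mat_app_def restr_sum restr_mons_mult)

lemma divide_by_monomial:
  fixes f :: "'k::field bipoly"
  assumes "keys f \<subseteq> (+) t ` A"
  shows "\<exists>g. f = Poly_Mapping.single t 1 * g \<and> keys g \<subseteq> A"
proof -
  define A' where "A' = {u \<in> A. t + u \<in> keys f}"
  have inj: "inj_on ((+) t) A'" by (simp add: inj_on_def)
  have im: "(+) t ` A' = keys f" using assms by (auto simp: A'_def)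
  then have fin: "finite A'" using inj finite_imageD finite_keys by metis
  define g where "g = (\<Sum>u\<in>A'. Poly_Mapping.single u (lookup f (t + u)))"
  have "Poly_Mapping.single t 1 * g = (\<Sum>u\<in>A'. Poly_Mapping.single (t + u) (lookup f (t + u)))"
    by (simp add: g_def sum_distrib_left mult_single)
  also have "\<dots> = (\<Sum>w\<in>(+) t ` A'. Poly_Mapping.single w (lookup f w))"
    by (simp add: sum.reindex[OF inj])
  also have "\<dots> = f" unfolding im by (rule poly_mapping_expand[symmetric]) simp_all
  finally have "f = Poly_Mapping.single t 1 * g" by simp
  moreover have "keys g \<subseteq> A"
  proof
    fix u assume "u \<in> keys g"
    then have "u \<in> A'" using fin by (auto simp: in_keys_iff g_def lookup_sum_single split: if_splits)
    then show "u \<in> A" by (simp add: A'_def)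
  qed
  ultimately show ?thesis by blast
qed

locale graded_resolution =
  fixes n m :: nat and rk :: "nat \<Rightarrow> nat" and sh :: "nat \<Rightarrow> nat \<Rightarrow> int \<times> int"
    and D :: "nat \<Rightarrow> nat \<Rightarrow> nat \<Rightarrow> 'k::field bipoly"
  assumes hm: "hmat n m (rk i) (rk (Suc i)) (sh i) (sh (Suc i)) (D i)"
    and exact: "{v \<in> fvec n m (rk (Suc i)). mat_app (rk i) (rk (Suc i)) (D i) v = 0}
       = mat_app (rk (Suc i)) (rk (Suc (Suc i))) (D (Suc i)) ` fvec n m (rk (Suc (Suc i)))"
begin

text \<open>The members of the chain of complexes between \<open>F \<otimes> K\<close> and \<open>F\<close>: only the variables \<open>x\<close> below \<open>a\<close>
  and \<open>y\<close> below \<open>b\<close> are kept. At \<open>a = b = 0\<close> the homology is Tor, at \<open>a = n\<close> and \<open>b = m\<close> the complex is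
  the resolution.\<close>

abbreviation Cx :: "nat \<Rightarrow> nat \<Rightarrow> nat \<Rightarrow> int \<times> int \<Rightarrow> (nat \<Rightarrow> 'k bipoly) set" where
  "Cx a b i c \<equiv> hvec a b (rk i) (sh i) c"

definition dx :: "nat \<Rightarrow> nat \<Rightarrow> nat \<Rightarrow> (nat \<Rightarrow> 'k bipoly) \<Rightarrow> nat \<Rightarrow> 'k bipoly" where
  "dx a b i = mat_app (rk i) (rk (Suc i)) (\<lambda>k j. restr (mons a b) (D i k j))"

abbreviation vanishes :: "nat \<Rightarrow> nat \<Rightarrow> nat \<Rightarrow> int \<times> int \<Rightarrow> bool" where
  "vanishes a b \<equiv> acyclic_at (Cx a b) (dx a b)"

lemma hmat_restr:
  "hmat a b (rk i) (rk (Suc i)) (sh i) (sh (Suc i)) (\<lambda>k j. restr (mons a b) (D i k j))"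
  using hm[of i] unfolding hmat_def by (auto intro: restr_bihom)

lemma dx_vrestr: "vrestr (mons a b) (mat_app (rk i) (rk (Suc i)) (D i) v) = dx a b i (vrestr (mons a b) v)"
  unfolding dx_def by (rule vrestr_mat_app)

lemma dx_full: "v \<in> Cx n m (Suc i) c \<Longrightarrow> dx n m i v = mat_app (rk i) (rk (Suc i)) (D i) v"
  using dx_vrestr[of n m i v] mat_app_hvec[OF hm, of v i c] hvec_restr_id by metis

lemma d_d_full: "v \<in> fvec n m (rk (Suc (Suc i))) \<Longrightarrow>
    mat_app (rk i) (rk (Suc i)) (D i) (mat_app (rk (Suc i)) (rk (Suc (Suc i))) (D (Suc i)) v) = 0"
  using exact[of i] by blast

text \<open>The monomials lost on setting the variable \<open>t\<close> to zero are its multiples, so a vector that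
  becomes zero is divisible by \<open>t\<close>.\<close>

lemma mult_sequence_step:
  assumes le: "a \<le> a'" "b \<le> b'" "a' \<le> n" "b' \<le> m"
    and t: "t \<in> mons a' b'" "bideg t = e"
    and div: "\<And>w. w \<in> mons a' b' \<Longrightarrow> w \<notin> mons a b \<longleftrightarrow> (\<exists>u\<in>mons a' b'. w = t + u)"
  shows "mult_sequence (Cx a' b') (Cx a b) (dx a' b') (dx a b)
    (vscale (Poly_Mapping.single t 1)) (vrestr (mons a b)) e"
proof
  fix i :: nat and c :: "int \<times> int" and v w :: "nat \<Rightarrow> 'k bipoly"
  let ?x = "Poly_Mapping.single t (1::'k)"
  have x: "?x \<in> bihom a' b' e" using t by (intro bihom_single)
  show "0 \<in> Cx a' b' i c" by simp
  show "v \<in> Cx a' b' i c \<Longrightarrow> w \<in> Cx a' b' i c \<Longrightarrow> v - w \<in> Cx a' b' i c" by (rule hvec_diff)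
  show "v \<in> Cx a' b' (Suc i) c \<Longrightarrow> dx a' b' i v \<in> Cx a' b' i c"
    unfolding dx_def by (rule mat_app_hvec[OF hmat_restr])
  show "dx a' b' i (v - w) = dx a' b' i v - dx a' b' i w"
    unfolding dx_def by (rule mat_app_diff)
  show "dx a' b' i (dx a' b' (Suc i) v) = 0" if v: "v \<in> Cx a' b' (Suc (Suc i)) c"
  proof -
    have "v \<in> Cx n m (Suc (Suc i)) c" using v hvec_mono[OF le(3,4)] by (rule subsetD[rotated])
    from d_d_full[OF hvec_fvec[OF this]]
    have "dx a' b' i (dx a' b' (Suc i) (vrestr (mons a' b') v)) = vrestr (mons a' b') 0"
      by (metis dx_vrestr)
    also have "vrestr (mons a' b') 0 = (0 :: nat \<Rightarrow> 'k bipoly)" by (rule ext) (simp add: vrestr_def)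
    finally show ?thesis using hvec_restr_id[OF v] by simp
  qed
  show "v \<in> Cx a' b' i c \<Longrightarrow> vscale ?x v \<in> Cx a' b' i (c + e)"
    using hvec_scale[OF x] by (simp add: add.commute)
  show "vscale ?x (v - w) = vscale ?x v - vscale ?x w"
    by (rule ext) (simp add: vscale_def right_diff_distrib)
  show "v = 0" if "vscale ?x v = 0"
  proof (rule ext)
    fix j
    have "?x * v j = 0" using fun_cong[OF that, of j] by (simp add: vscale_def)
    then show "v j = 0 j" by (simp add: single_mult_eq_0_iff)
  qed
  show "dx a' b' i (vscale ?x v) = vscale ?x (dx a' b' i v)"
    unfolding dx_def by (rule mat_app_scale)
  show "v \<in> Cx a' b' i c \<Longrightarrow> vrestr (mons a b) v \<in> Cx a b i c" by (rule hvec_restr)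
  show "Cx a b i c \<subseteq> Cx a' b' i c" by (rule hvec_mono[OF le(1,2)])
  show "v \<in> Cx a b i c \<Longrightarrow> vrestr (mons a b) v = v" by (rule hvec_restr_id)
  show "vrestr (mons a b) (v - w) = vrestr (mons a b) v - vrestr (mons a b) w" by (rule vrestr_diff)
  have tn: "t \<notin> mons a b" using div[OF t(1)] by (metis add.right_neutral zero_in_mons)
  show "vrestr (mons a b) (vscale ?x v) = 0"
  proof (rule ext)
    fix j
    have "keys (?x * v j) \<inter> mons a b = {}" using tn by (auto simp: keys_single_mult mons_add)
    then show "vrestr (mons a b) (vscale ?x v) j = 0 j" by (simp add: vrestr_def vscale_def restr_eq_0)
  qed
  show "\<exists>u\<in>Cx a' b' i c. v = vscale ?x u"
    if v: "v \<in> Cx a' b' i (c + e)" and v0: "vrestr (mons a b) v = 0"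
  proof -
    have "\<exists>g. v j = ?x * g \<and> g \<in> bihom a' b' (c - sh i j)" if j: "j < rk i" for j
    proof -
      have kv: "keys (v j) \<subseteq> hmons a' b' (c + e - sh i j)" using v j by (simp add: hvec_def bihom_iff)
      have "restr (mons a b) (v j) = 0" using fun_cong[OF v0, of j] by (simp add: vrestr_def)
      then have k0: "keys (v j) \<inter> mons a b = {}" by (metis keys_restr keys_zero)
      have "keys (v j) \<subseteq> (+) t ` hmons a' b' (c - sh i j)"
      proof
        fix w assume w: "w \<in> keys (v j)"
        then have wh: "w \<in> mons a' b'" "bideg w = c + e - sh i j" "w \<notin> mons a b"
          using kv k0 by (auto simp: hmons_def)
        then obtain u where u: "u \<in> mons a' b'" "w = t + u" using div by blast
        then have "bideg u = c - sh i j" using wh(2) t(2) by (simp add: bideg_add algebra_simps)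
        then show "w \<in> (+) t ` hmons a' b' (c - sh i j)" using u by (simp add: hmons_def)
      qed
      then show ?thesis using divide_by_monomial by (simp add: bihom_iff)
    qed
    then obtain g where g: "\<And>j. j < rk i \<Longrightarrow> v j = ?x * g j \<and> g j \<in> bihom a' b' (c - sh i j)" by metis
    let ?u = "\<lambda>j. if j < rk i then g j else 0"
    have "?u \<in> Cx a' b' i c" using g by (simp add: hvec_def)
    moreover have "v = vscale ?x ?u"
    proof (rule ext)
      fix j show "v j = vscale ?x ?u j"
        using g[of j] v by (cases "j < rk i") (simp_all add: vscale_def hvec_def)
    qed
    ultimately show ?thesis by blast
  qed
  show "vrestr (mons a b) (dx a' b' i v) = dx a b i (vrestr (mons a b) v)"
  proof -
    have "restr (mons a b) (restr (mons a' b') f) = restr (mons a b) f" for f :: "'k bipoly"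
      using mons_mono[OF le(1,2)] by (simp add: restr_restr Int_absorb2)
    then show ?thesis unfolding dx_def vrestr_mat_app by simp
  qed
qed

end

section \<open>Regularity read off from the variables one at a time\<close>

text \<open>Bidegrees are pairs; statements about all bidegrees refer to their components by \<open>fst\<close> and
  \<open>snd\<close> and are kept unsplit.\<close>

declare split_paired_All [simp del] split_paired_Ex [simp del]

text \<open>The induction hypothesis is available only where the measure is at least \<open>L\<close>, which makes the
  induction well-founded although the measure takes integer values.\<close>

lemma int_measure_induct [case_names step]:
  fixes f :: "'a \<Rightarrow> int"
  assumes "\<And>x. (\<And>y. f y < f x \<Longrightarrow> L \<le> f x \<Longrightarrow> P y) \<Longrightarrow> P x"
  shows "P x"
proof (induction "nat (f x - L + 1)" arbitrary: x rule: less_induct)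
  case less
  show ?case
  proof (rule assms)
    fix y assume "f y < f x" "L \<le> f x"
    then show "P y" by (intro less.hyps) simp
  qed
qed

lemma single_split:
  assumes "lookup u i > 0"
  shows "u = Poly_Mapping.single i (1::nat) + (u - Poly_Mapping.single i 1)"
  using assms by (intro poly_mapping_eqI)
    (auto simp: lookup_add minus_poly_mapping.rep_eq lookup_single when_def)

definition x_mon :: "nat \<Rightarrow> bimon" where
  "x_mon a = (Poly_Mapping.single a 1, 0)"

lemma x_mon_props:
  "x_mon a \<in> mons (Suc a) m" "x_mon a \<notin> mons a m" "bideg (x_mon a) = (1, 0)"
  by (auto simp: x_mon_def mons_def bideg_def)

lemma x_mon_divides:
  assumes "w \<in> mons (Suc a) m" "w \<notin> mons a m"
  shows "\<exists>u\<in>mons (Suc a) m. w = x_mon a + u"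
proof -
  have "a \<in> keys (fst w)" using assms by (auto simp: mons_def less_Suc_eq)
  then have pos: "lookup (fst w) a > 0" by (simp add: in_keys_iff)
  let ?u = "(fst w - Poly_Mapping.single a 1, snd w)"
  have eq: "w = x_mon a + ?u"
    using single_split[OF pos] by (simp add: prod_eq_iff x_mon_def)
  then have "?u \<in> mons (Suc a) m" using assms(1) mons_add by metis
  then show ?thesis using eq by blast
qed

context graded_resolution
begin

text \<open>Injectivity of the multiplication by \<open>x\<^sub>a\<close> on the component of bidegree \<open>c\<close> of the homology in
  position \<open>0\<close>, with the later variables \<open>x\<close> set to zero.\<close>

definition x_injective :: "nat \<Rightarrow> int \<times> int \<Rightarrow> bool" where
  "x_injective a c \<longleftrightarrow> (\<forall>u\<in>Cx (Suc a) m 0 c.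
     vscale (x_var a) u \<in> bounds_at (Cx (Suc a) m) (dx (Suc a) m) 0 (c + (1, 0)) \<longrightarrow>
     u \<in> bounds_at (Cx (Suc a) m) (dx (Suc a) m) 0 c)"

lemma vanishes_full: "vanishes n m (Suc i) c"
  unfolding acyclic_at_def
proof
  fix v assume "v \<in> cycles_at (Cx n m) (dx n m) (Suc i) c"
  then have v: "v \<in> Cx n m (Suc i) c" "dx n m i v = 0" by (simp_all add: cycles_at_def)
  then have "mat_app (rk i) (rk (Suc i)) (D i) v = 0" by (simp add: dx_full)
  then obtain w where w: "w \<in> fvec n m (rk (Suc (Suc i)))"
    "v = mat_app (rk (Suc i)) (rk (Suc (Suc i))) (D (Suc i)) w"
    using exact[of i] hvec_fvec[OF v(1)] by blast
  let ?w = "vcomp (rk (Suc (Suc i))) (sh (Suc (Suc i))) c w"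
  have wC: "?w \<in> Cx n m (Suc (Suc i)) c" by (rule vcomp_hvec[OF w(1)])
  have "v = vcomp (rk (Suc i)) (sh (Suc i)) c v" by (rule vcomp_id[OF v(1), symmetric])
  also have "\<dots> = mat_app (rk (Suc i)) (rk (Suc (Suc i))) (D (Suc i)) ?w"
    unfolding w(2) by (rule vcomp_mat_app[OF hm])
  also have "\<dots> = dx n m (Suc i) ?w" by (rule dx_full[OF wC, symmetric])
  finally show "v \<in> bounds_at (Cx n m) (dx n m) (Suc i) c" using wC unfolding bounds_at_def by (rule image_eqI)
qed

lemma x_step:
  assumes a: "a < n"
  shows "mult_sequence (Cx (Suc a) m) (Cx a m) (dx (Suc a) m) (dx a m)
    (vscale (x_var a)) (vrestr (mons a m)) (1, 0)"
  unfolding x_var_def bimonom_def x_mon_def[symmetric]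
proof (rule mult_sequence_step)
  show "x_mon a \<in> mons (Suc a) m" "bideg (x_mon a) = (1, 0)" by (rule x_mon_props)+
  show "w \<notin> mons a m \<longleftrightarrow> (\<exists>u\<in>mons (Suc a) m. w = x_mon a + u)" if "w \<in> mons (Suc a) m" for w
    using x_mon_divides[OF that] x_mon_props(2)[of a m] mons_add[of "x_mon a" _ a m] by metis
qed (use a in simp_all)

lemma y_step:
  assumes b: "b < m"
  shows "mult_sequence (Cx 0 (Suc b)) (Cx 0 b) (dx 0 (Suc b)) (dx 0 b)
    (vscale (y_var b)) (vrestr (mons 0 b)) (0, 1)"
  unfolding y_var_def bimonom_def
proof (rule mult_sequence_step)
  let ?t = "(0, Poly_Mapping.single b 1) :: bimon"
  show t: "?t \<in> mons 0 (Suc b)" by (simp add: mons_def)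
  show "bideg ?t = (0, 1)" by (simp add: bideg_def)
  fix w assume w: "w \<in> mons 0 (Suc b)"
  show "w \<notin> mons 0 b \<longleftrightarrow> (\<exists>u\<in>mons 0 (Suc b). w = ?t + u)"
  proof
    assume "w \<notin> mons 0 b"
    then have "b \<in> keys (snd w)" using w by (auto simp: mons_def less_Suc_eq)
    then have pos: "lookup (snd w) b > 0" by (simp add: in_keys_iff)
    let ?u = "(fst w, snd w - Poly_Mapping.single b 1)"
    have eq: "w = ?t + ?u"
      using single_split[OF pos] by (simp add: prod_eq_iff)
    then have "?u \<in> mons 0 (Suc b)" using w mons_add by metis
    then show "\<exists>u\<in>mons 0 (Suc b). w = ?t + u" using eq by blast
  next
    assume "\<exists>u\<in>mons 0 (Suc b). w = ?t + u"
    then have "b \<in> keys (snd w)" by (auto simp: in_keys_iff lookup_add)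
    then show "w \<notin> mons 0 b" by (auto simp: mons_def)
  qed
qed (use b in simp_all)

lemma vanishes_x_step:
  assumes a: "a < n"
    and sur: "vanishes (Suc a) m (Suc i) c"
    and inj: "if i = 0 then x_injective a (c - (1, 0)) else vanishes (Suc a) m i (c - (1, 0))"
  shows "vanishes a m (Suc i) c"
proof -
  interpret mult_sequence "Cx (Suc a) m" "Cx a m" "dx (Suc a) m" "dx a m"
    "vscale (x_var a)" "vrestr (mons a m)" "(1, 0)" by (rule x_step[OF a])
  show ?thesis
  proof (rule acyclic_Suc_if_z_surj_z_inj)
    fix u assume u: "u \<in> cycles_at (Cx (Suc a) m) (dx (Suc a) m) i (c - (1, 0))"
      and zu: "vscale (x_var a) u \<in> bounds_at (Cx (Suc a) m) (dx (Suc a) m) i c"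
    show "u \<in> bounds_at (Cx (Suc a) m) (dx (Suc a) m) i (c - (1, 0))"
    proof (cases "i = 0")
      case True
      then have "x_injective a (c - (1, 0))" using inj by simp
      moreover have "u \<in> Cx (Suc a) m 0 (c - (1, 0))" using u True by (simp add: cycles_at_def)
      moreover have "vscale (x_var a) u \<in> bounds_at (Cx (Suc a) m) (dx (Suc a) m) 0 (c - (1, 0) + (1, 0))"
        using zu True by simp
      ultimately show ?thesis unfolding True x_injective_def by blast
    next
      case False
      then show ?thesis using inj u by (auto simp: acyclic_at_def)
    qed
  qed (rule z_surj_if_acyclic_above[OF sur])
qed

text \<open>The variables \<open>x\<^sub>a\<close> with large \<open>a\<close> are set to zero first. As long as each of them is injective
  on the cokernel in large \<open>x\<close>-degree, the positive homology stays zero in large \<open>x\<close>-degree.\<close>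

lemma vanishes_large:
  assumes reg: "\<And>a. a < n \<Longrightarrow> \<exists>B. \<forall>c. fst c > B \<longrightarrow> x_injective a c" and "a \<le> n"
  shows "\<exists>B. \<forall>i c. fst c > B \<longrightarrow> vanishes a m (Suc i) c"
  using \<open>a \<le> n\<close>
proof (induction a rule: inc_induct)
  case base
  show ?case using vanishes_full by blast
next
  case (step a)
  obtain B1 where B1: "\<And>i c. fst c > B1 \<Longrightarrow> vanishes (Suc a) m (Suc i) c" using step.IH by blast
  obtain B2 where B2: "\<And>c. fst c > B2 \<Longrightarrow> x_injective a c" using reg step.hyps by blast
  have "vanishes a m (Suc i) c" if c: "fst c > max B1 B2 + 1" for i c
  proof (rule vanishes_x_step)
    show "vanishes (Suc a) m (Suc i) c" using c by (intro B1) simp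
    show "if i = 0 then x_injective a (c - (1, 0)) else vanishes (Suc a) m i (c - (1, 0))"
    proof (cases i)
      case 0
      then show ?thesis using c B2 by simp
    next
      case (Suc k)
      then show ?thesis using c B1 by simp
    qed
  qed (use step.hyps in simp)
  then show ?case by blast
qed

text \<open>The forward direction needs the bounds of \<open>vanishes_large\<close>: if the homology modulo \<open>x\<^sub>a\<close> vanishes
  above the line of slope one, then \<open>x\<^sub>a\<close> is injective on the positive homology there, while
  this homology is zero in large degrees and hence everywhere above the line.\<close>

lemma vanishes_iff_x_injective:
  assumes reg: "\<And>a. a < n \<Longrightarrow> \<exists>B. \<forall>c. fst c > B \<longrightarrow> x_injective a c" and "a \<le> n"
  shows "(\<forall>i c. fst c > r + int (Suc i) \<longrightarrow> vanishes a m (Suc i) c) \<longleftrightarrow>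
    (\<forall>a'. a \<le> a' \<and> a' < n \<longrightarrow> (\<forall>c. fst c > r \<longrightarrow> x_injective a' c))"
  using \<open>a \<le> n\<close>
proof (induction a rule: inc_induct)
  case base
  show ?case using vanishes_full by auto
next
  case (step a)
  let ?V = "\<lambda>a. \<forall>i c. fst c > r + int (Suc i) \<longrightarrow> vanishes a m (Suc i) c"
  let ?X = "\<lambda>a'. \<forall>c. fst c > r \<longrightarrow> x_injective a' c"
  interpret mult_sequence "Cx (Suc a) m" "Cx a m" "dx (Suc a) m" "dx a m"
    "vscale (x_var a)" "vrestr (mons a m)" "(1, 0)" by (rule x_step) (use step.hyps in simp)
  have "?V a \<longleftrightarrow> ?V (Suc a) \<and> ?X a"
  proof
    assume R: "?V (Suc a) \<and> ?X a"
    show "?V a"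
    proof (intro allI impI)
      fix i :: nat and c :: "int \<times> int" assume c: "fst c > r + int (Suc i)"
      show "vanishes a m (Suc i) c"
      proof (rule vanishes_x_step)
        show "vanishes (Suc a) m (Suc i) c" using R c by blast
        show "if i = 0 then x_injective a (c - (1, 0)) else vanishes (Suc a) m i (c - (1, 0))"
        proof (cases i)
          case 0
          then show ?thesis using c R by simp
        next
          case (Suc k)
          then show ?thesis using c R by simp
        qed
      qed (use step.hyps in simp)
    qed
  next
    assume V: "?V a"
    have "?X a"
    proof (intro allI impI)
      fix c :: "int \<times> int" assume c: "fst c > r"
      have "vanishes a m (Suc 0) (c + (1, 0))" using V c by simp
      then show "x_injective a c" unfolding x_injective_def using z_inj_if_acyclic by blast
    qed
    moreover have "?V (Suc a)"
    proof (intro allI impI)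
      fix i :: nat and c :: "int \<times> int" assume c: "fst c > r + int (Suc i)"
      have "Suc a \<le> n" using step.hyps by simp
      from vanishes_large[OF reg this] obtain B where B: "\<And>i c. fst c > B \<Longrightarrow> vanishes (Suc a) m (Suc i) c"
        by blast
      \<comment> \<open>A nonzero class in low degree would have nonzero multiples by all powers of the variable.\<close>
      have "fst c > r + int (Suc i) \<longrightarrow> vanishes (Suc a) m (Suc i) c" for c :: "int \<times> int"
      proof (induction c rule: int_measure_induct[where f = "\<lambda>c. - fst c" and L = "- B"])
        case (step c)
        show ?case
        proof
          assume c: "fst c > r + int (Suc i)"
          show "vanishes (Suc a) m (Suc i) c"
          proof (cases "fst c > B")
            case False
            then have IH: "vanishes (Suc a) m (Suc i) (c + (1, 0))" using step[of "c + (1, 0)"] c by simp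
            show ?thesis
              unfolding acyclic_at_def
            proof
              fix v assume v: "v \<in> cycles_at (Cx (Suc a) m) (dx (Suc a) m) (Suc i) c"
              then have "vscale (x_var a) v \<in> bounds_at (Cx (Suc a) m) (dx (Suc a) m) (Suc i) (c + (1, 0))"
                using IH cycles_z unfolding acyclic_at_def by blast
              moreover have "vanishes a m (Suc (Suc i)) (c + (1, 0))" using V c by simp
              moreover have "v \<in> Cx (Suc a) m (Suc i) c" using v by (simp add: cycles_at_def)
              ultimately show "v \<in> bounds_at (Cx (Suc a) m) (dx (Suc a) m) (Suc i) c"
                using z_inj_if_acyclic by blast
            qed
          qed (rule B)
        qed
      qed
      then show "vanishes (Suc a) m (Suc i) c" using c by blast
    qed
    ultimately show "?V (Suc a) \<and> ?X a" by blast
  qed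
  moreover have "(\<forall>a'. a \<le> a' \<and> a' < n \<longrightarrow> ?X a') \<longleftrightarrow> ?X a \<and> (\<forall>a'. Suc a \<le> a' \<and> a' < n \<longrightarrow> ?X a')"
    using step.hyps by (metis Suc_le_eq le_neq_implies_less order_refl less_imp_le)
  ultimately show ?case using step.IH by blast
qed

lemma Cx_bounded_below: "\<exists>L. \<forall>c. snd c < L \<longrightarrow> Cx a b i c = {0}"
proof -
  define L where "L = - (\<Sum>j<rk i. \<bar>snd (sh i j)\<bar>)"
  have L: "L \<le> snd (sh i j)" if "j < rk i" for j
  proof -
    have "\<bar>snd (sh i j)\<bar> \<le> (\<Sum>j<rk i. \<bar>snd (sh i j)\<bar>)" using that by (intro member_le_sum) auto
    then show ?thesis by (simp add: L_def)
  qed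
  have "Cx a b i c = {0}" if c: "snd c < L" for c
  proof -
    have "v = 0" if v: "v \<in> Cx a b i c" for v
    proof (rule ext)
      fix j show "v j = 0 j"
      proof (cases "j < rk i")
        case True
        have "keys (v j) = {}"
        proof (rule ccontr)
          assume "keys (v j) \<noteq> {}"
          then obtain w where "w \<in> keys (v j)" by blast
          then have "bideg w = c - sh i j" using v True by (auto simp: hvec_def bihom_iff hmons_def)
          then show False using bideg_nonneg(2)[of w] c L[OF True] by simp
        qed
        then show ?thesis by simp
      next
        case False
        then show ?thesis using v by (simp add: hvec_def)
      qed
    qed
    then show ?thesis using hvec_zero by blast
  qed
  then show ?thesis by blast
qed

text \<open>Setting the variables \<open>y\<^sub>b\<close>, which have \<open>x\<close>-degree 0, to zero does not change the largest
  \<open>x\<close>-degrees: this is Nakayama's lemma, as all homology is bounded below in \<open>y\<close>-degree.\<close>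

lemma vanishes_y_step:
  assumes b: "b < m"
  shows "(\<forall>i c. fst c > r + int i \<longrightarrow> vanishes 0 b i c) \<longleftrightarrow> (\<forall>i c. fst c > r + int i \<longrightarrow> vanishes 0 (Suc b) i c)"
proof -
  interpret mult_sequence "Cx 0 (Suc b)" "Cx 0 b" "dx 0 (Suc b)" "dx 0 b"
    "vscale (y_var b)" "vrestr (mons 0 b)" "(0, 1)" by (rule y_step[OF b])
  show ?thesis
  proof (intro iffI allI impI)
    fix i :: nat and c :: "int \<times> int"
    assume V: "\<forall>i c. fst c > r + int i \<longrightarrow> vanishes 0 (Suc b) i c" and c: "fst c > r + int i"
    show "vanishes 0 b i c"
    proof (cases i)
      case 0
      have "vanishes 0 (Suc b) 0 c" using V c 0 by blast
      from z_surj_if_acyclic_above[OF this] show ?thesis unfolding 0 by (rule acyclic_0_if_z_surj)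
    next
      case (Suc k)
      have "vanishes 0 (Suc b) (Suc k) c" using V c Suc by blast
      note sur = z_surj_if_acyclic_above[OF this]
      have "vanishes 0 (Suc b) k (c - (0, 1))" using V c Suc by simp
      then show ?thesis
        unfolding Suc by (intro acyclic_Suc_if_z_surj_z_inj[OF sur]) (auto simp: acyclic_at_def)
    qed
  next
    fix i :: nat and c :: "int \<times> int"
    assume V: "\<forall>i c. fst c > r + int i \<longrightarrow> vanishes 0 b i c" and c: "fst c > r + int i"
    obtain L where L: "\<And>c. snd c < L \<Longrightarrow> Cx 0 (Suc b) i c = {0}" using Cx_bounded_below by blast
    have "fst c > r + int i \<longrightarrow> vanishes 0 (Suc b) i c" for c :: "int \<times> int"
    proof (induction c rule: int_measure_induct[where f = snd and L = L])
      case (step c)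
      show ?case
      proof
        assume c: "fst c > r + int i"
        show "vanishes 0 (Suc b) i c"
          unfolding acyclic_at_def
        proof
          fix v assume v: "v \<in> cycles_at (Cx 0 (Suc b)) (dx 0 (Suc b)) i c"
          show "v \<in> bounds_at (Cx 0 (Suc b)) (dx 0 (Suc b)) i c"
          proof (cases "snd c < L")
            case True
            then have "v = 0" using v L[OF True] by (simp add: cycles_at_def)
            then show ?thesis using bounds_zero by simp
          next
            case False
            have "vanishes 0 b i c" using V c by blast
            from z_surj_if_acyclic[OF this v] obtain u where
              u: "u \<in> cycles_at (Cx 0 (Suc b)) (dx 0 (Suc b)) i (c - (0, 1))"
              "v - vscale (y_var b) u \<in> bounds_at (Cx 0 (Suc b)) (dx 0 (Suc b)) i c" by blast
            have "vanishes 0 (Suc b) i (c - (0, 1))" using step[of "c - (0, 1)"] c False by simp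
            then have "u \<in> bounds_at (Cx 0 (Suc b)) (dx 0 (Suc b)) i (c - (0, 1))"
              using u(1) unfolding acyclic_at_def by blast
            from bounds_z[OF this]
            have "vscale (y_var b) u \<in> bounds_at (Cx 0 (Suc b)) (dx 0 (Suc b)) i c" by simp
            from bounds_add[OF u(2) this] show ?thesis by simp
          qed
        qed
      qed
    qed
    then show "vanishes 0 (Suc b) i c" using c by blast
  qed
qed

text \<open>From all variables zero, the variables \<open>y\<close> are restored by \<open>vanishes_y_step\<close> and the variables \<open>x\<close> by
  \<open>vanishes_iff_x_injective\<close>. The latter speaks of positive homology, so the homology in position
  \<open>0\<close> contributes a condition of its own.\<close>

theorem regularity_criterion:
  assumes reg: "\<And>a. a < n \<Longrightarrow> \<exists>B. \<forall>c. fst c > B \<longrightarrow> x_injective a c"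
  shows "(\<forall>i c. fst c > r + int i \<longrightarrow> vanishes 0 0 i c) \<longleftrightarrow>
    (\<forall>a<n. \<forall>c. fst c > r \<longrightarrow> x_injective a c) \<and> (\<forall>c. fst c > r \<longrightarrow> vanishes 0 m 0 c)"
proof -
  have "(\<forall>i c. fst c > r + int i \<longrightarrow> vanishes 0 0 i c) \<longleftrightarrow> (\<forall>i c. fst c > r + int i \<longrightarrow> vanishes 0 b i c)"
    if "b \<le> m" for b
    using that
  proof (induction b)
    case (Suc b)
    then have "b < m" by simp
    from vanishes_y_step[OF this, of r] show ?case using Suc by simp
  qed simp
  then have "(\<forall>i c. fst c > r + int i \<longrightarrow> vanishes 0 0 i c) \<longleftrightarrow> (\<forall>i c. fst c > r + int i \<longrightarrow> vanishes 0 m i c)"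
    by blast
  also have "\<dots> \<longleftrightarrow> (\<forall>i c. fst c > r + int (Suc i) \<longrightarrow> vanishes 0 m (Suc i) c) \<and>
      (\<forall>c. fst c > r \<longrightarrow> vanishes 0 m 0 c)"
    (is "?L \<longleftrightarrow> ?R")
  proof
    assume ?L
    show ?R
    proof (intro conjI allI impI)
      show "vanishes 0 m (Suc i) c" if "fst c > r + int (Suc i)" for i and c :: "int \<times> int"
        using \<open>?L\<close> that by blast
      show "vanishes 0 m 0 c" if "fst c > r" for c :: "int \<times> int"
        using \<open>?L\<close>[rule_format, of 0 c] that by simp
    qed
  next
    assume R: ?R
    show ?L
    proof (intro allI impI)
      fix i :: nat and c :: "int \<times> int" assume "fst c > r + int i"
      then show "vanishes 0 m i c" using R by (cases i) simp_all
    qed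
  qed
  finally show ?thesis using vanishes_iff_x_injective[OF reg, of 0 r] by simp
qed

end

section \<open>Regularity in terms of leading monomials\<close>

text \<open>Membership of \<open>f\<close> in the ideal \<open>J + (x\<^sub>a, \<dots>, x\<^bsub>n-1\<^esub>)\<close>, tested on the remaining variables.\<close>

definition agrees :: "nat \<Rightarrow> nat \<Rightarrow> 'k::field bipoly set \<Rightarrow> 'k bipoly \<Rightarrow> bool" where
  "agrees a m J f \<longleftrightarrow> (\<exists>j\<in>J. restr (mons a m) f = restr (mons a m) j)"

lemma agrees_cong: "restr (mons a m) f = restr (mons a m) g \<Longrightarrow> agrees a m J f \<longleftrightarrow> agrees a m J g"
  by (simp add: agrees_def)

lemma agrees_add:
  assumes J: "poly_ideal n m J" and "agrees a m J f" "agrees a m J g"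
  shows "agrees a m J (f + g)"
proof -
  obtain j k where "j \<in> J" "restr (mons a m) f = restr (mons a m) j"
    "k \<in> J" "restr (mons a m) g = restr (mons a m) k" using assms(2,3) by (auto simp: agrees_def)
  then have "restr (mons a m) (f + g) = restr (mons a m) (j + k)" "j + k \<in> J"
    using poly_idealD(3)[OF J] by (simp_all add: restr_add)
  then show ?thesis by (auto simp: agrees_def)
qed

lemma agrees_mult:
  assumes J: "poly_ideal n m J" and f: "agrees a m J f" and g: "g \<in> poly_carrier n m"
  shows "agrees a m J (g * f)"
proof -
  obtain j where "j \<in> J" "restr (mons a m) f = restr (mons a m) j" using f by (auto simp: agrees_def)
  then have "restr (mons a m) (g * f) = restr (mons a m) (g * j)" "g * j \<in> J"
    using poly_idealD(4)[OF J _ g] by (simp_all add: restr_mons_mult)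
  then show ?thesis by (auto simp: agrees_def)
qed

lemma agrees_mem: "j \<in> J \<Longrightarrow> agrees a m J j"
  by (auto simp: agrees_def)

lemma agrees_diff_mem:
  assumes J: "poly_ideal n m J" and j: "f - g \<in> J"
  shows "agrees a m J f \<longleftrightarrow> agrees a m J g"
proof
  assume "agrees a m J g"
  from agrees_add[OF J agrees_mem[OF j] this] show "agrees a m J f" by simp
next
  assume "agrees a m J f"
  from agrees_add[OF J this agrees_mem[OF poly_ideal_uminus[OF J j]]] show "agrees a m J g" by simp
qed

locale ideal_resolution = graded_resolution n m rk sh D
  for n m rk sh and D :: "nat \<Rightarrow> nat \<Rightarrow> nat \<Rightarrow> 'k::field bipoly" +
  fixes J :: "'k bipoly set" and A :: "nat \<Rightarrow> 'k bipoly"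
  assumes J: "bigraded n m J"
    and A: "\<And>j. j < rk 0 \<Longrightarrow> A j \<in> bihom n m (sh 0 j)"
    and onto: "\<And>f. f \<in> poly_carrier n m \<Longrightarrow> \<exists>v\<in>fvec n m (rk 0). f - lin_comb (rk 0) A v \<in> J"
    and exact0: "{v \<in> fvec n m (rk 0). lin_comb (rk 0) A v \<in> J}
       = mat_app (rk 0) (rk 1) (D 0) ` fvec n m (rk 1)"
begin

abbreviation eps :: "(nat \<Rightarrow> 'k bipoly) \<Rightarrow> 'k bipoly" where
  "eps \<equiv> lin_comb (rk 0) A"

lemmas pJ = bigradedD(1)[OF J]

lemma eps_diff: "eps (v - w) = eps v - eps w"
  by (simp add: lin_comb_def left_diff_distrib sum_subtractf)

lemma eps_scale: "eps (vscale f v) = f * eps v"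
  by (simp add: lin_comb_def vscale_def sum_distrib_left mult.assoc)

lemma eps_carrier: "v \<in> fvec n m (rk 0) \<Longrightarrow> eps v \<in> poly_carrier n m"
  unfolding lin_comb_def fvec_def
  by (intro poly_carrier_sum poly_carrier_mult) (auto intro: bihom_carrier[OF A])

lemma eps_bihom:
  assumes "v \<in> Cx n m 0 c" shows "eps v \<in> bihom n m c"
  unfolding lin_comb_def
proof (rule bihom_sum)
  fix j assume j: "j \<in> {..<rk 0}"
  then have "v j \<in> bihom n m (c - sh 0 j)" using assms by (simp add: hvec_def)
  from bihom_mult[OF this A[of j]] show "v j * A j \<in> bihom n m c" using j by simp
qed

lemma restr_eps: "restr (mons a b) (eps (vrestr (mons a b) v)) = restr (mons a b) (eps v)"
  by (simp add: lin_comb_def restr_sum restr_mons_mult vrestr_def restr_restr)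

lemma hcomp_eps: "hcomp c (eps v) = eps (vcomp (rk 0) (sh 0) c v)"
proof -
  have "hcomp c (v j * A j) = vcomp (rk 0) (sh 0) c v j * A j" if "j < rk 0" for j
    using hcomp_mult[OF A[OF that], of c "v j"] that by (simp add: vcomp_def mult.commute)
  then show ?thesis by (simp add: lin_comb_def restr_sum)
qed

lemma unit_preimage: "\<exists>v\<in>Cx n m 0 0. 1 - eps v \<in> J"
proof -
  obtain v where v: "v \<in> fvec n m (rk 0)" "1 - eps v \<in> J" using onto[of 1] by auto
  have "hcomp 0 (1 - eps v) \<in> J" by (rule bigradedD(2)[OF J v(2)])
  moreover have "hcomp 0 (1 :: 'k bipoly) = 1"
    by (rule restr_id) (simp add: zero_prod_def[symmetric])
  ultimately have "1 - eps (vcomp (rk 0) (sh 0) 0 v) \<in> J" by (simp add: restr_diff hcomp_eps)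
  then show ?thesis using vcomp_hvec[OF v(1)] by blast
qed

text \<open>Right exactness: setting variables to zero in the presentation of \<open>S/J\<close> gives a presentation of
  \<open>S/(J + (x\<^sub>a, \<dots>, x\<^bsub>n-1\<^esub>))\<close>.\<close>

lemma bounds_0_iff_agrees:
  assumes a: "a \<le> n" and v: "v \<in> Cx a m 0 c"
  shows "v \<in> bounds_at (Cx a m) (dx a m) 0 c \<longleftrightarrow> agrees a m J (eps v)"
proof
  assume "v \<in> bounds_at (Cx a m) (dx a m) 0 c"
  then obtain w where w: "w \<in> Cx a m (Suc 0) c" "v = dx a m 0 w" by (auto simp: bounds_at_def)
  have wf: "w \<in> fvec n m (rk 1)" using hvec_fvec subsetD[OF hvec_mono[OF a order_refl] w(1)] by fastforce
  let ?v = "mat_app (rk 0) (rk 1) (D 0) w"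
  have "eps ?v \<in> J" using wf exact0 by blast
  moreover have "vrestr (mons a m) ?v = v"
    using dx_vrestr[of a m 0 w] hvec_restr_id[OF w(1)] w(2) by simp
  then have "restr (mons a m) (eps v) = restr (mons a m) (eps ?v)"
    using restr_eps[of a m ?v] by simp
  ultimately show "agrees a m J (eps v)" by (auto simp: agrees_def)
next
  assume "agrees a m J (eps v)"
  then obtain j where j: "j \<in> J" "restr (mons a m) (eps v) = restr (mons a m) j"
    by (auto simp: agrees_def)
  have vf: "v \<in> fvec n m (rk 0)" using hvec_fvec subsetD[OF hvec_mono[OF a order_refl] v] by blast
  \<comment> \<open>The correction \<open>q\<close> lies in the ideal of the vanished variables and is lifted through the
    preimage of \<open>1\<close>.\<close>
  define q where "q = eps v - j"
  have qc: "q \<in> poly_carrier n m"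
    unfolding q_def by (intro poly_carrier_diff eps_carrier vf poly_idealD(1)[OF pJ] j)
  have q0: "restr (mons a m) q = 0" using j(2) by (simp add: q_def restr_diff)
  obtain v1 where v1: "v1 \<in> Cx n m 0 0" "1 - eps v1 \<in> J" using unit_preimage by blast
  have v1f: "v1 \<in> fvec n m (rk 0)" by (rule hvec_fvec[OF v1(1)])
  let ?u = "v - vscale q v1"
  have "eps ?u = j + q * (1 - eps v1)"
    by (simp add: eps_diff eps_scale q_def algebra_simps)
  also have "\<dots> \<in> J" by (intro poly_idealD(3,4)[OF pJ] j v1 qc)
  finally have "eps ?u \<in> J" .
  moreover have "?u \<in> fvec n m (rk 0)" by (intro fvec_diff vf fvec_scale qc v1f)
  ultimately obtain w where w: "w \<in> fvec n m (rk 1)" "?u = mat_app (rk 0) (rk 1) (D 0) w"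
    using exact0 by blast
  have "vrestr (mons a m) (vscale q v1) = 0"
    by (rule ext) (simp add: vrestr_def vscale_def restr_mons_mult q0)
  then have "v = vrestr (mons a m) ?u" using hvec_restr_id[OF v] by (simp add: vrestr_diff)
  also have "\<dots> = dx a m 0 (vrestr (mons a m) w)" unfolding w(2) using dx_vrestr[of a m 0 w] by simp
  finally have v_eq: "v = dx a m 0 (vrestr (mons a m) w)" .
  have wr: "vrestr (mons a m) w \<in> fvec a m (rk (Suc 0))"
    using w(1) by (simp add: fvec_def vrestr_def poly_carrier_iff keys_restr)
  have "v = vcomp (rk 0) (sh 0) c v" by (rule vcomp_id[OF v, symmetric])
  also have "\<dots> = dx a m 0 (vcomp (rk (Suc 0)) (sh (Suc 0)) c (vrestr (mons a m) w))"
    by (subst v_eq) (unfold dx_def, rule vcomp_mat_app[OF hmat_restr])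
  finally have v_eq': "v = dx a m 0 (vcomp (rk (Suc 0)) (sh (Suc 0)) c (vrestr (mons a m) w))" .
  show "v \<in> bounds_at (Cx a m) (dx a m) 0 c"
    unfolding bounds_at_def by (subst v_eq') (intro imageI vcomp_hvec[OF wr])
qed

lemma lift_element:
  assumes a: "a \<le> n" and f: "f \<in> bihom n m c"
  shows "\<exists>u\<in>Cx a m 0 c. \<exists>g. f - g \<in> J \<and> restr (mons a m) (eps u) = restr (mons a m) g"
proof -
  obtain v1 where v1: "v1 \<in> Cx n m 0 0" "1 - eps v1 \<in> J" using unit_preimage by blast
  let ?u = "vrestr (mons a m) (vscale f v1)"
  have "?u \<in> Cx a m 0 c" using hvec_restr[OF hvec_scale[OF f v1(1)]] by simp
  moreover have "f * (1 - eps v1) \<in> J" by (rule poly_idealD(4)[OF pJ v1(2) bihom_carrier[OF f]])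
  then have "f - eps (vscale f v1) \<in> J" by (simp add: eps_scale algebra_simps)
  ultimately show ?thesis using restr_eps by blast
qed

lemma x_injective_iff_agrees:
  assumes a: "a < n"
  shows "x_injective a c \<longleftrightarrow>
    (\<forall>f\<in>bihom n m c. agrees (Suc a) m J (x_var a * f) \<longrightarrow> agrees (Suc a) m J f)"
proof -
  have a': "Suc a \<le> n" using a by simp
  interpret mult_sequence "Cx (Suc a) m" "Cx a m" "dx (Suc a) m" "dx a m"
    "vscale (x_var a)" "vrestr (mons a m)" "(1, 0)" by (rule x_step[OF a])
  have b: "u \<in> bounds_at (Cx (Suc a) m) (dx (Suc a) m) 0 c \<longleftrightarrow> agrees (Suc a) m J (eps u)"
    and xb: "vscale (x_var a) u \<in> bounds_at (Cx (Suc a) m) (dx (Suc a) m) 0 (c + (1, 0)) \<longleftrightarrow>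
      agrees (Suc a) m J (x_var a * eps u)" if "u \<in> Cx (Suc a) m 0 c" for u
    using bounds_0_iff_agrees[OF a' that] bounds_0_iff_agrees[OF a' z_mem[OF that]]
    by (simp_all add: eps_scale)
  show ?thesis
  proof
    assume x: "x_injective a c"
    show "\<forall>f\<in>bihom n m c. agrees (Suc a) m J (x_var a * f) \<longrightarrow> agrees (Suc a) m J f"
    proof (intro ballI impI)
      fix f assume f: "f \<in> bihom n m c" and xf: "agrees (Suc a) m J (x_var a * f)"
      obtain u g where ug: "u \<in> Cx (Suc a) m 0 c" "f - g \<in> J"
        "restr (mons (Suc a) m) (eps u) = restr (mons (Suc a) m) g" using lift_element[OF a' f] by blast
      have "x_var a \<in> poly_carrier n m"
        unfolding x_var_def bimonom_def using a by (intro poly_carrier_single) (simp add: mons_def)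
      then have "x_var a * (f - g) \<in> J" by (rule poly_idealD(4)[OF pJ ug(2)])
      then have "x_var a * f - x_var a * g \<in> J" by (simp only: right_diff_distrib)
      then have "agrees (Suc a) m J (x_var a * g)" using xf agrees_diff_mem[OF pJ] by blast
      moreover have "restr (mons (Suc a) m) (x_var a * g) = restr (mons (Suc a) m) (x_var a * eps u)"
        using ug(3) by (simp add: restr_mons_mult)
      ultimately have "agrees (Suc a) m J (x_var a * eps u)" using agrees_cong by blast
      then have "agrees (Suc a) m J (eps u)" using x ug(1) b xb unfolding x_injective_def by blast
      then have "agrees (Suc a) m J g" using agrees_cong[OF ug(3)] by blast
      then show "agrees (Suc a) m J f" using agrees_diff_mem[OF pJ ug(2)] by blast
    qed
  next
    assume *: "\<forall>f\<in>bihom n m c. agrees (Suc a) m J (x_var a * f) \<longrightarrow> agrees (Suc a) m J f"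
    show "x_injective a c"
      unfolding x_injective_def
    proof (intro ballI impI)
      fix u assume u: "u \<in> Cx (Suc a) m 0 c"
        and xu: "vscale (x_var a) u \<in> bounds_at (Cx (Suc a) m) (dx (Suc a) m) 0 (c + (1, 0))"
      have "u \<in> Cx n m 0 c" by (rule subsetD[OF hvec_mono[OF a' order_refl] u])
      then have "eps u \<in> bihom n m c" by (rule eps_bihom)
      then show "u \<in> bounds_at (Cx (Suc a) m) (dx (Suc a) m) 0 c"
        using * xu b[OF u] xb[OF u] by blast
    qed
  qed
qed

lemma vanishes_0_iff_agrees: "vanishes 0 m 0 c \<longleftrightarrow> (\<forall>f\<in>bihom n m c. agrees 0 m J f)"
proof
  assume v: "vanishes 0 m 0 c"
  show "\<forall>f\<in>bihom n m c. agrees 0 m J f"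
  proof
    fix f :: "'k bipoly" assume f: "f \<in> bihom n m c"
    obtain u g where ug: "u \<in> Cx 0 m 0 c" "f - g \<in> J"
      "restr (mons 0 m) (eps u) = restr (mons 0 m) g" using lift_element[OF _ f] by blast
    have "u \<in> bounds_at (Cx 0 m) (dx 0 m) 0 c"
      using v ug(1) unfolding acyclic_at_def cycles_at_def by blast
    then have "agrees 0 m J (eps u)" using bounds_0_iff_agrees[OF _ ug(1)] by blast
    then have "agrees 0 m J g" using agrees_cong[OF ug(3)] by blast
    then show "agrees 0 m J f" using agrees_diff_mem[OF pJ ug(2)] by blast
  qed
next
  assume *: "\<forall>f\<in>bihom n m c. agrees 0 m J f"
  show "vanishes 0 m 0 c"
    unfolding acyclic_at_def
  proof
    fix u assume "u \<in> cycles_at (Cx 0 m) (dx 0 m) 0 c"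
    then have u: "u \<in> Cx 0 m 0 c" by (simp add: cycles_at_def)
    have "u \<in> Cx n m 0 c" by (rule subsetD[OF hvec_mono[OF _ order_refl] u]) simp
    then have "eps u \<in> bihom n m c" by (rule eps_bihom)
    then show "u \<in> bounds_at (Cx 0 m) (dx 0 m) 0 c" using * bounds_0_iff_agrees[OF _ u] by blast
  qed
qed

end

text \<open>In the reverse lexicographic order the monomials that involve a variable set to zero are smaller
  than those that do not, so restoring these terms does not change the leading monomial.\<close>

lemma lead_mon_in_leads_if_agrees:
  assumes J: "bigraded n m J" and b: "b \<le> n"
    and g: "g \<in> bihom b m c" "g \<noteq> 0" "agrees b m J g"
  shows "lead_mon g \<in> lead_set J"
proof -
  obtain j where j: "j \<in> J" "restr (mons b m) g = restr (mons b m) j" using g(3) by (auto simp: agrees_def)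
  have kg: "keys g \<subseteq> hmons b m c" using g(1) by (simp add: bihom_iff)
  have gj: "lookup g w = lookup j w" if "w \<in> mons b m" for w
    using arg_cong[OF j(2), of "\<lambda>f. lookup f w"] that by (simp add: lookup_restr)
  let ?j = "hcomp c j"
  have jJ: "?j \<in> J" by (rule bigradedD(2)[OF J j(1)])
  have lg: "lead_mon g \<in> mons b m" "bideg (lead_mon g) = c"
    using kg lead_mon_in_keys[OF g(2)] by (auto simp: hmons_def)
  have ne: "lookup ?j (lead_mon g) \<noteq> 0"
    using lookup_lead_mon[OF g(2)] lg by (simp add: lookup_restr gj)
  have "lead_mon ?j = lead_mon g"
  proof (rule lead_mon_eqI[OF ne], rule ccontr)
    fix w assume w: "mon_greater w (lead_mon g)" "lookup ?j w \<noteq> 0"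
    then have wc: "bideg w = c" "lookup j w \<noteq> 0" by (auto simp: lookup_restr split: if_splits)
    have wm: "w \<in> mons n m"
      using poly_idealD(1)[OF bigradedD(1)[OF J] j(1)] wc(2) by (auto simp: poly_carrier_iff in_keys_iff)
    show False
    proof (cases "w \<in> mons b m")
      case True
      then show ?thesis using lookup_above_lead_mon[OF w(1)] gj wc(2) by simp
    next
      case False
      have "mon_greater (lead_mon g) w"
        by (rule mon_greater_mons[OF lg(1) wm False]) (simp add: lg wc)
      then show ?thesis using w(1) mon_greater_asym by blast
    qed
  qed
  moreover have "?j \<noteq> 0" using ne by auto
  ultimately show ?thesis using lead_setI[OF jJ] by metis
qed

lemma agrees_with_lead:
  assumes J: "bigraded n m J" and b: "b \<le> n" and w: "w \<in> lead_set J" "w \<in> hmons b m c"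
  shows "\<exists>g. g \<in> bihom b m c \<and> agrees b m J g \<and> g \<noteq> 0 \<and> lead_mon g = w"
proof -
  obtain j where j: "j \<in> J" "j \<in> bihom n m (bideg w)" "j \<noteq> 0" "lead_mon j = w"
    by (rule lead_set_homogeneous[OF J w(1)])
  have wc: "bideg w = c" "w \<in> mons b m" using w(2) by (simp_all add: hmons_def)
  let ?g = "restr (mons b m) j"
  have "?g \<in> bihom b m c" using j(2) wc(1) restr_bihom by blast
  moreover have "agrees b m J ?g" using j(1) by (auto simp: agrees_def restr_restr)
  moreover have ne: "lookup ?g w \<noteq> 0" using lookup_lead_mon[OF j(3)] j(4) wc by (simp add: lookup_restr)
  moreover have "lead_mon ?g = w"
    using ne by (rule lead_mon_eqI) (use lookup_above_lead_mon[of _ j] j(4) in \<open>simp add: lookup_restr\<close>)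
  moreover have "?g \<noteq> 0" using ne by auto
  ultimately show ?thesis by blast
qed

lemma agrees_subspace_eq:
  assumes J: "bigraded n m J" and b: "b \<le> n"
    and V'sub: "V' \<subseteq> bihom b m c"
    and V'diff: "\<And>f g r. f \<in> V' \<Longrightarrow> g \<in> bihom b m c \<Longrightarrow> agrees b m J g \<Longrightarrow> f - bconst r * g \<in> V'"
    and lead: "lead_set V' \<subseteq> lead_set J"
  shows "\<forall>f\<in>V'. agrees b m J f"
proof -
  let ?V = "{g \<in> bihom b m c. agrees b m J g}"
  note pJ = bigradedD(1)[OF J]
  have "V' \<subseteq> ?V"
  proof (rule subspace_eq_if_same_leads[OF finite_hmons[of b m c]])
    show "keys f \<subseteq> hmons b m c" if "f \<in> V'" for f using subsetD[OF V'sub that] by (simp only: bihom_iff)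
    show "0 \<in> ?V" using agrees_mem[OF poly_idealD(2)[OF pJ]] by simp
    show "f + bconst r * g \<in> ?V" if "f \<in> ?V" "g \<in> ?V" for f g r
      using that bihom_add[of f b m c "bconst r * g"] bihom_scale[of g b m c r] agrees_add[OF pJ, of b f "bconst r * g"]
        agrees_mult[OF pJ, of b g "bconst r"] by simp
    show "f - bconst r * g \<in> V'" if "f \<in> V'" "g \<in> ?V" for f g r using that V'diff by simp
    show "lead_set V' \<subseteq> lead_set ?V"
    proof
      fix w assume w: "w \<in> lead_set V'"
      then obtain f where f: "f \<in> V'" "f \<noteq> 0" "lead_mon f = w" by (rule lead_setE)
      have "keys f \<subseteq> hmons b m c" using subsetD[OF V'sub f(1)] by (simp only: bihom_iff)
      then have "w \<in> hmons b m c" using lead_mon_in_keys[OF f(2)] f(3) by blast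
      from agrees_with_lead[OF J b subsetD[OF lead w] this] obtain g where
        g: "g \<in> bihom b m c" "agrees b m J g" "g \<noteq> 0" "lead_mon g = w" by (elim exE conjE)
      then have "g \<in> ?V" by simp
      from lead_setI[OF this g(3)] show "w \<in> lead_set ?V" unfolding g(4) .
    qed
  qed
  then show ?thesis by blast
qed

text \<open>The reverse lexicographic order turns the injectivity of \<open>x\<^sub>a\<close> into a condition on monomials: a form
  in the variables up to \<open>x\<^sub>a\<close> is divisible by \<open>x\<^sub>a\<close> as soon as its leading monomial is, because the
  monomials free of \<open>x\<^sub>a\<close> are larger.\<close>

lemma agrees_x_iff_leads:
  assumes J: "bigraded n m J" and a: "a < n"
  shows "(\<forall>f\<in>bihom n m c. agrees (Suc a) m J (x_var a * f) \<longrightarrow> agrees (Suc a) m J f) \<longleftrightarrow>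
    (\<forall>w\<in>hmons (Suc a) m c. x_mon a + w \<in> lead_set J \<longrightarrow> w \<in> lead_set J)"
proof
  have a': "Suc a \<le> n" using a by simp
  note pJ = bigradedD(1)[OF J]
  have xv: "x_var a = Poly_Mapping.single (x_mon a) (1::'a)" by (simp add: x_var_def bimonom_def x_mon_def)
  {
    assume *: "\<forall>f\<in>bihom n m c. agrees (Suc a) m J (x_var a * f) \<longrightarrow> agrees (Suc a) m J f"
    show "\<forall>w\<in>hmons (Suc a) m c. x_mon a + w \<in> lead_set J \<longrightarrow> w \<in> lead_set J"
    proof (intro ballI impI)
      fix w assume w: "w \<in> hmons (Suc a) m c" and xw: "x_mon a + w \<in> lead_set J"
      have xwh: "x_mon a + w \<in> hmons (Suc a) m ((1, 0) + c)"
        using w x_mon_props by (auto simp: hmons_def mons_add bideg_add)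
      obtain g where g: "g \<in> bihom (Suc a) m ((1, 0) + c)" "agrees (Suc a) m J g" "g \<noteq> 0"
        "lead_mon g = x_mon a + w" using agrees_with_lead[OF J a' xw xwh] by blast
      have "keys g \<subseteq> (+) (x_mon a) ` hmons (Suc a) m c"
      proof
        fix v assume v: "v \<in> keys g"
        then have vh: "v \<in> mons (Suc a) m" "bideg v = (1, 0) + c"
          using g(1) by (auto simp: bihom_iff hmons_def)
        have "v \<notin> mons a m"
        proof
          assume va: "v \<in> mons a m"
          have "x_mon a + w \<notin> mons a m" using x_mon_props(2) by (simp add: mons_add)
          then have "mon_greater v (x_mon a + w)"
            using mon_greater_mons[OF va, of "x_mon a + w" "Suc a"] xwh vh(2) by (simp add: hmons_def)
          then show False using lookup_above_lead_mon[of v g] g(4) v by (simp add: in_keys_iff)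
        qed
        from x_mon_divides[OF vh(1) this] obtain u where u: "u \<in> mons (Suc a) m" "v = x_mon a + u" by blast
        then have "bideg u = c" using vh(2) by (simp add: bideg_add x_mon_props)
        then show "v \<in> (+) (x_mon a) ` hmons (Suc a) m c" using u by (simp add: hmons_def)
      qed
      from divide_by_monomial[OF this] obtain f where
        f: "g = Poly_Mapping.single (x_mon a) 1 * f" "f \<in> bihom (Suc a) m c" by (auto simp: bihom_iff)
      have f0: "f \<noteq> 0" using g(3) f(1) by auto
      have "x_mon a + lead_mon f = x_mon a + w"
        using g(4) f(1) lead_mon_single_mult[OF one_neq_zero f0] by metis
      then have lf: "lead_mon f = w" by simp
      have "f \<in> bihom n m c" by (rule subsetD[OF bihom_mono[OF a' order_refl] f(2)])
      then have "agrees (Suc a) m J f" using * g(2) f(1) xv by metis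
      then show "w \<in> lead_set J" using lead_mon_in_leads_if_agrees[OF J a' f(2) f0] lf by metis
    qed
  next
    assume *: "\<forall>w\<in>hmons (Suc a) m c. x_mon a + w \<in> lead_set J \<longrightarrow> w \<in> lead_set J"
    let ?V' = "{g \<in> bihom (Suc a) m c. agrees (Suc a) m J (x_var a * g)}"
    have "\<forall>g\<in>?V'. agrees (Suc a) m J g"
    proof (rule agrees_subspace_eq[OF J a'])
      show "f - bconst r * g \<in> ?V'" if f: "f \<in> ?V'" and g: "g \<in> bihom (Suc a) m c" "agrees (Suc a) m J g" for f g r
      proof -
        have "x_var a * bconst (- r) \<in> poly_carrier n m"
          unfolding xv using subsetD[OF mons_mono[OF a' order_refl] x_mon_props(1)]
          by (intro poly_carrier_mult poly_carrier_single) simp_all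
        from agrees_add[OF pJ _ agrees_mult[OF pJ g(2) this], of "x_var a * f"] f
        have "agrees (Suc a) m J (x_var a * f + x_var a * bconst (- r) * g)" by simp
        moreover have "x_var a * f + x_var a * bconst (- r) * g = x_var a * (f - bconst r * g)"
          by (simp add: bconst_def single_uminus algebra_simps)
        ultimately show ?thesis
          using f g(1) bihom_diff[of f "Suc a" m c "bconst r * g"] bihom_scale[of g "Suc a" m c r] by simp
      qed
      show "lead_set ?V' \<subseteq> lead_set J"
      proof
        fix w assume "w \<in> lead_set ?V'"
        then obtain g where g: "g \<in> ?V'" "g \<noteq> 0" "lead_mon g = w" by (rule lead_setE)
        have wh: "w \<in> hmons (Suc a) m c" using g lead_mon_in_keys[OF g(2)] by (auto simp: bihom_iff)
        have "x_var a * g \<in> bihom (Suc a) m ((1, 0) + c)"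
          unfolding xv using g x_mon_props by (intro bihom_mult bihom_single) auto
        moreover have "x_var a * g \<noteq> 0" unfolding xv using g(2) by (simp add: single_mult_eq_0_iff)
        ultimately have "lead_mon (x_var a * g) \<in> lead_set J"
          using g(1) lead_mon_in_leads_if_agrees[OF J a'] by blast
        then have "x_mon a + w \<in> lead_set J"
          unfolding xv using lead_mon_single_mult[OF one_neq_zero g(2)] g(3) by metis
        then show "w \<in> lead_set J" using * wh by blast
      qed
    qed blast
    then show "\<forall>f\<in>bihom n m c. agrees (Suc a) m J (x_var a * f) \<longrightarrow> agrees (Suc a) m J f"
    proof (intro ballI impI)
      fix f assume V: "\<forall>g\<in>?V'. agrees (Suc a) m J g"
        and f: "f \<in> bihom n m c" "agrees (Suc a) m J (x_var a * f)"
      let ?g = "restr (mons (Suc a) m) f"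
      have eq: "restr (mons (Suc a) m) ?g = restr (mons (Suc a) m) f" by (simp add: restr_restr)
      then have "restr (mons (Suc a) m) (x_var a * ?g) = restr (mons (Suc a) m) (x_var a * f)"
        by (simp add: restr_mons_mult)
      then have "agrees (Suc a) m J (x_var a * ?g)" using f(2) agrees_cong by blast
      then have "agrees (Suc a) m J ?g" using V restr_bihom[OF f(1)] by blast
      then show "agrees (Suc a) m J f" using agrees_cong[OF eq] by blast
    qed
  }
qed

lemma agrees_all_iff_leads:
  assumes J: "bigraded n m J"
  shows "(\<forall>f\<in>bihom n m c. agrees 0 m J f) \<longleftrightarrow> hmons 0 m c \<subseteq> lead_set J"
proof
  assume *: "\<forall>f\<in>bihom n m c. agrees 0 m J f"
  show "hmons 0 m c \<subseteq> lead_set J"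
  proof
    fix w assume w: "w \<in> hmons 0 m c"
    let ?g = "Poly_Mapping.single w (1::'a)"
    have g: "?g \<in> bihom 0 m c" using w by (simp add: bihom_iff)
    have "w \<in> keys ?g" by simp
    then have g0: "?g \<noteq> 0" by force
    have "agrees 0 m J ?g" using * subsetD[OF bihom_mono[OF _ order_refl] g] by blast
    from lead_mon_in_leads_if_agrees[OF J _ g g0 this]
    show "w \<in> lead_set J" using lead_mon_in_keys[OF g0] by simp
  qed
next
  assume *: "hmons 0 m c \<subseteq> lead_set J"
  have V: "\<forall>g\<in>bihom 0 m c. agrees 0 m J g"
  proof (rule agrees_subspace_eq[OF J, of 0 _ c])
    show "lead_set (bihom 0 m c :: 'a bipoly set) \<subseteq> lead_set J"
    proof
      fix w assume "w \<in> lead_set (bihom 0 m c :: 'a bipoly set)"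
      then obtain g :: "'a bipoly" where g: "g \<in> bihom 0 m c" "g \<noteq> 0" "lead_mon g = w" by (rule lead_setE)
      then have "w \<in> hmons 0 m c" using lead_mon_in_keys[OF g(2)] by (auto simp: bihom_iff)
      then show "w \<in> lead_set J" using * by blast
    qed
  qed (simp_all add: bihom_diff bihom_scale)
  show "\<forall>f\<in>bihom n m c. agrees 0 m J f"
  proof
    fix f :: "'a bipoly" assume "f \<in> bihom n m c"
    then have "agrees 0 m J (restr (mons 0 m) f)" using V restr_bihom by blast
    moreover have "restr (mons 0 m) (restr (mons 0 m) f) = restr (mons 0 m) f" by (simp add: restr_restr)
    ultimately show "agrees 0 m J f" using agrees_cong by blast
  qed
qed

text \<open>The right-hand side of the regularity criterion for the ideal spanned by the monomials in \<open>L\<close>.\<close>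

definition x_reg_le :: "nat \<Rightarrow> nat \<Rightarrow> bimon set \<Rightarrow> int \<Rightarrow> bool" where
  "x_reg_le n m L r \<longleftrightarrow>
    (\<forall>a<n. \<forall>w\<in>mons (Suc a) m. fst (bideg w) > r \<longrightarrow> x_mon a + w \<in> L \<longrightarrow> w \<in> L) \<and>
    (\<forall>w\<in>mons 0 m. fst (bideg w) > r \<longrightarrow> w \<in> L)"

text \<open>The sequence \<open>x\<^bsub>n-1\<^esub>, \<dots>, x\<^sub>0\<close> is regular on the quotient by the ideal spanned by \<open>L\<close>, up to finitely
  many \<open>x\<close>-degrees.\<close>

definition x_filter_regular :: "nat \<Rightarrow> nat \<Rightarrow> bimon set \<Rightarrow> bool" where
  "x_filter_regular n m L \<longleftrightarrow>
    (\<forall>a<n. \<exists>B. \<forall>w\<in>mons (Suc a) m. fst (bideg w) > B \<longrightarrow> x_mon a + w \<in> L \<longrightarrow> w \<in> L)"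

theorem (in ideal_resolution) regularity_by_leads:
  assumes reg: "x_filter_regular n m (lead_set J)"
  shows "(\<forall>i c. fst c > r + int i \<longrightarrow> vanishes 0 0 i c) \<longleftrightarrow> x_reg_le n m (lead_set J) r"
proof -
  have x: "x_injective a c \<longleftrightarrow> (\<forall>w\<in>hmons (Suc a) m c. x_mon a + w \<in> lead_set J \<longrightarrow> w \<in> lead_set J)"
    if "a < n" for a c
    using x_injective_iff_agrees[OF that] agrees_x_iff_leads[OF J that] by blast
  have "\<exists>B. \<forall>c. fst c > B \<longrightarrow> x_injective a c" if a: "a < n" for a
  proof -
    obtain B where "\<forall>w\<in>mons (Suc a) m. fst (bideg w) > B \<longrightarrow> x_mon a + w \<in> lead_set J \<longrightarrow> w \<in> lead_set J"
      using reg a unfolding x_filter_regular_def by blast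
    then show ?thesis using x[OF a] by (intro exI[of _ B]) (simp add: hmons_def)
  qed
  from regularity_criterion[OF this]
  have "(\<forall>i c. fst c > r + int i \<longrightarrow> vanishes 0 0 i c) \<longleftrightarrow>
      (\<forall>a<n. \<forall>c. fst c > r \<longrightarrow> x_injective a c) \<and> (\<forall>c. fst c > r \<longrightarrow> vanishes 0 m 0 c)" by blast
  also have "(\<forall>a<n. \<forall>c. fst c > r \<longrightarrow> x_injective a c) \<longleftrightarrow>
      (\<forall>a<n. \<forall>w\<in>mons (Suc a) m. fst (bideg w) > r \<longrightarrow> x_mon a + w \<in> lead_set J \<longrightarrow> w \<in> lead_set J)"
    using x unfolding hmons_def by blast
  also have "(\<forall>c. fst c > r \<longrightarrow> vanishes 0 m 0 c) \<longleftrightarrow>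
      (\<forall>w\<in>mons 0 m. fst (bideg w) > r \<longrightarrow> w \<in> lead_set J)"
  proof -
    have "(\<forall>c. fst c > r \<longrightarrow> hmons 0 m c \<subseteq> lead_set J) \<longleftrightarrow>
        (\<forall>w\<in>mons 0 m. fst (bideg w) > r \<longrightarrow> w \<in> lead_set J)"
      (is "?l \<longleftrightarrow> ?r")
    proof
      assume l: ?l
      show ?r
      proof (intro ballI impI)
        fix w assume "w \<in> mons 0 m" "fst (bideg w) > r"
        moreover from this(1) have "w \<in> hmons 0 m (bideg w)" by (simp add: hmons_def)
        ultimately show "w \<in> lead_set J" using l by blast
      qed
    qed (auto simp: hmons_def)
    then show ?thesis by (simp only: vanishes_0_iff_agrees agrees_all_iff_leads[OF J])
  qed
  finally show ?thesis unfolding x_reg_le_def .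
qed

section \<open>Resolutions of the quotient by an ideal as vectors and matrices\<close>

lemma coset_eq: "J +>\<^bsub>bipoly_ring n m\<^esub> f = (\<lambda>j. j + f) ` J"
  by (auto simp: a_r_coset_def')

lemma coset_eq_iff:
  assumes J: "poly_ideal n m J"
  shows "J +>\<^bsub>bipoly_ring n m\<^esub> f = J +>\<^bsub>bipoly_ring n m\<^esub> g \<longleftrightarrow> f - g \<in> J"
proof
  assume eq: "J +>\<^bsub>bipoly_ring n m\<^esub> f = J +>\<^bsub>bipoly_ring n m\<^esub> g"
  have "0 + f \<in> (\<lambda>j. j + f) ` J" using poly_idealD(2)[OF J] by (rule imageI)
  then have "f \<in> (\<lambda>j. j + g) ` J" using eq by (simp add: coset_eq)
  then show "f - g \<in> J" by auto
next
  assume fg: "f - g \<in> J"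
  have "(\<lambda>j. j + f) ` J \<subseteq> (\<lambda>j. j + g) ` J"
  proof (rule image_subsetI)
    fix j assume "j \<in> J"
    then have "j + (f - g) \<in> J" using fg by (rule poly_idealD(3)[OF J])
    then show "j + f \<in> (\<lambda>j. j + g) ` J" by (rule rev_image_eqI) simp
  qed
  moreover have "(\<lambda>j. j + g) ` J \<subseteq> (\<lambda>j. j + f) ` J"
  proof (rule image_subsetI)
    fix j assume "j \<in> J"
    then have "j - (f - g) \<in> J" using fg by (rule poly_ideal_diff[OF J])
    then show "j + g \<in> (\<lambda>j. j + f) ` J" by (rule rev_image_eqI) simp
  qed
  ultimately show "J +>\<^bsub>bipoly_ring n m\<^esub> f = J +>\<^bsub>bipoly_ring n m\<^esub> g" by (simp add: coset_eq)
qed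

lemma coset_eq_ideal_iff:
  assumes J: "poly_ideal n m J"
  shows "J +>\<^bsub>bipoly_ring n m\<^esub> f = J \<longleftrightarrow> f \<in> J"
proof -
  have "J +>\<^bsub>bipoly_ring n m\<^esub> 0 = J" by (simp add: coset_eq)
  then show ?thesis using coset_eq_iff[OF J, of f 0] by simp
qed

lemma quot_module_simps:
  "carrier (quot_module n m J) = (\<lambda>f. J +>\<^bsub>bipoly_ring n m\<^esub> f) ` poly_carrier n m"
  "zero (quot_module n m J) = J"
  "module.smult (quot_module n m J) f X = (J +>\<^bsub>bipoly_ring n m\<^esub> f) \<otimes>\<^bsub>bipoly_ring n m Quot J\<^esub> X"
  by (auto simp: quot_module_def Let_def FactRing_def A_RCOSETS_def')

lemma aug_map_quot_module:
  fixes F :: "('k::field, 'k bipoly set) free_complex"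
  assumes J: "poly_ideal n m J"
    and aug: "\<And>j. j < rank F 0 \<Longrightarrow> aug F j = J +>\<^bsub>bipoly_ring n m\<^esub> A j"
    and A: "\<And>j. j < rank F 0 \<Longrightarrow> A j \<in> poly_carrier n m"
    and v: "v \<in> fvec n m (rank F 0)"
  shows "aug_map (quot_module n m J) F (vec (rank F 0) v)
    = J +>\<^bsub>bipoly_ring n m\<^esub> lin_comb (rank F 0) A v"
proof -
  let ?S = "bipoly_ring n m :: 'k bipoly ring"
  let ?Q = "?S Quot J"
  interpret I: ideal J ?S using J by (simp add: ideal_iff_poly_ideal)
  interpret Q: ring ?Q by (rule I.quotient_is_ring)
  have mem: "J +>\<^bsub>?S\<^esub> f \<in> carrier ?Q" if "f \<in> poly_carrier n m" for f
    using that by (auto simp: FactRing_def A_RCOSETS_def')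
  have vA: "v j * A j \<in> poly_carrier n m" if "j < rank F 0" for j
    using v A that by (intro poly_carrier_mult) (simp_all add: fvec_def)
  have sum: "finsum ?Q (\<lambda>j. J +>\<^bsub>?S\<^esub> (v j * A j)) {..<r} = J +>\<^bsub>?S\<^esub> (\<Sum>j<r. v j * A j)"
    if "r \<le> rank F 0" for r
    using that
  proof (induction r)
    case 0
    have "finsum ?Q (\<lambda>j. J +>\<^bsub>?S\<^esub> (v j * A j)) {..<0} = \<zero>\<^bsub>?Q\<^esub>" by simp
    also have "\<dots> = J +>\<^bsub>?S\<^esub> 0" by (simp add: FactRing_def coset_eq)
    finally show ?case by simp
  next
    case (Suc r)
    have "finsum ?Q (\<lambda>j. J +>\<^bsub>?S\<^esub> (v j * A j)) (insert r {..<r})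
        = (J +>\<^bsub>?S\<^esub> (v r * A r)) \<oplus>\<^bsub>?Q\<^esub> finsum ?Q (\<lambda>j. J +>\<^bsub>?S\<^esub> (v j * A j)) {..<r}"
      using Suc.prems by (intro Q.finsum_insert) (auto intro!: mem vA)
    also have "\<dots> = (J +>\<^bsub>?S\<^esub> (v r * A r)) <+>\<^bsub>?S\<^esub> (J +>\<^bsub>?S\<^esub> (\<Sum>j<r. v j * A j))"
      using Suc by (simp add: FactRing_def)
    also have "\<dots> = J +>\<^bsub>?S\<^esub> (v r * A r \<oplus>\<^bsub>?S\<^esub> (\<Sum>j<r. v j * A j))"
      using Suc.prems by (intro I.a_rcos_sum vA poly_carrier_sum) simp_all
    finally show ?case by (simp add: lessThan_Suc add.commute)
  qed
  have "aug_map (quot_module n m J) F (vec (rank F 0) v)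
      = finsum ?Q (\<lambda>j. (vec (rank F 0) v $ j) \<odot>\<^bsub>quot_module n m J\<^esub> aug F j) {..<rank F 0}"
    by (simp add: aug_map_def finsum_def finprod_def quot_module_def Let_def)
  also have "\<dots> = finsum ?Q (\<lambda>j. J +>\<^bsub>?S\<^esub> (v j * A j)) {..<rank F 0}"
  proof (rule Q.finsum_cong')
    fix j assume "j \<in> {..<rank F 0}"
    then have j: "j < rank F 0" by simp
    have vj: "v j \<in> poly_carrier n m" using v j by (simp add: fvec_def)
    show "(vec (rank F 0) v $ j) \<odot>\<^bsub>quot_module n m J\<^esub> aug F j = J +>\<^bsub>?S\<^esub> (v j * A j)"
      using I.rcoset_mult_add[OF vj A[OF j]] j
      by (simp add: quot_module_simps aug FactRing_def)
  qed (auto intro!: mem vA)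
  also have "\<dots> = J +>\<^bsub>?S\<^esub> lin_comb (rank F 0) A v" unfolding lin_comb_def by (rule sum) simp
  finally show ?thesis .
qed

lemma free_vecs_eq: "free_vecs n m F i = vec (rank F i) ` fvec n m (rank F i)"
proof
  show "free_vecs n m F i \<subseteq> vec (rank F i) ` fvec n m (rank F i)"
  proof
    fix z assume z: "z \<in> free_vecs n m F i"
    let ?v = "\<lambda>j. if j < rank F i then z $ j else 0"
    have "z = vec (rank F i) ?v" using z by (intro eq_vecI) (auto simp: free_vecs_def)
    moreover have "?v \<in> fvec n m (rank F i)" using z by (simp add: free_vecs_def fvec_def)
    ultimately show "z \<in> vec (rank F i) ` fvec n m (rank F i)" by (rule image_eqI)
  qed
qed (auto simp: free_vecs_def fvec_def)

lemma inj_on_vec: "inj_on (vec r) (fvec n m r)"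
proof (rule inj_onI)
  fix v w :: "nat \<Rightarrow> 'a bipoly"
  assume v: "v \<in> fvec n m r" and w: "w \<in> fvec n m r" and eq: "vec r v = vec r w"
  show "v = w"
  proof (rule ext)
    fix j show "v j = w j"
    proof (cases "j < r")
      case True
      then show ?thesis using arg_cong[OF eq, of "\<lambda>z. z $ j"] by simp
    next
      case False
      then show ?thesis using v w by (simp add: fvec_def)
    qed
  qed
qed

lemma mat_mult_vec_fun:
  assumes "M \<in> carrier_mat p q"
  shows "M *\<^sub>v vec q v = vec p (\<lambda>k. \<Sum>j<q. M $$ (k, j) * v j)"
  using assms by (intro eq_vecI) (auto simp: scalar_prod_def lessThan_atLeast0)

lemma mat_mult_vec_eq_mat_app:
  assumes "M \<in> carrier_mat p q"
  shows "M *\<^sub>v vec q v = vec p (mat_app p q (\<lambda>k j. M $$ (k, j)) v)"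
  unfolding mat_mult_vec_fun[OF assms] by (intro eq_vecI) (simp_all add: mat_app_def)

text \<open>The bijection \<open>vec\<close> from functions to vectors carries kernels and images of the maps given by
  coefficient functions to those given by matrices.\<close>

lemma resolution_iff_is_res:
  fixes F :: "('k::field, 'k bipoly set) free_complex"
  defines "D \<equiv> \<lambda>i k j. diff F i $$ (k, j)"
  assumes J: "poly_ideal n m J"
    and dims: "\<And>i. diff F i \<in> carrier_mat (rank F i) (rank F (Suc i))"
    and aug: "\<And>j. j < rank F 0 \<Longrightarrow> aug F j = J +>\<^bsub>bipoly_ring n m\<^esub> A j"
    and A: "\<And>j. j < rank F 0 \<Longrightarrow> A j \<in> bihom n m (shift F 0 j)"
  shows "bigraded_free_resolution n m (quot_module n m J) (quot_bihom n m J) F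
    \<longleftrightarrow> is_res n m J (rank F) (shift F) D A"
proof -
  let ?S = "bipoly_ring n m :: 'k bipoly ring"
  have Ac: "A j \<in> poly_carrier n m" if "j < rank F 0" for j using A[OF that] by (rule bihom_carrier)
  let ?fv = "\<lambda>i. fvec n m (rank F i) :: (nat \<Rightarrow> 'k bipoly) set"
  let ?b = "\<lambda>i. vec (rank F i) :: (nat \<Rightarrow> 'k bipoly) \<Rightarrow> _"
  let ?m = "\<lambda>i. mat_app (rank F i) (rank F (Suc i)) (D i)"
  have am: "aug_map (quot_module n m J) F (?b 0 v) = J +>\<^bsub>?S\<^esub> lin_comb (rank F 0) A v" if "v \<in> ?fv 0" for v
    by (rule aug_map_quot_module[OF J aug Ac that])
  have lc: "lin_comb (rank F 0) A v \<in> poly_carrier n m" if "v \<in> ?fv 0" for v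
    unfolding lin_comb_def using that Ac by (intro poly_carrier_sum poly_carrier_mult) (simp_all add: fvec_def)
  have 1: "(\<forall>j<rank F 0. aug F j \<in> quot_bihom n m J (shift F 0 j))" using aug A by (auto simp: quot_bihom_def)
  have 2: "(\<forall>i. \<forall>k<rank F i. \<forall>j<rank F (Suc i).
       diff F i $$ (k, j) \<in> bihom n m (shift F (Suc i) j - shift F i k)) \<longleftrightarrow>
     (\<forall>i. hmat n m (rank F i) (rank F (Suc i)) (shift F i) (shift F (Suc i)) (D i))"
    by (simp add: hmat_def D_def)
  have 3: "aug_map (quot_module n m J) F ` free_vecs n m F 0 = carrier (quot_module n m J) \<longleftrightarrow>
      (\<forall>f\<in>poly_carrier n m. \<exists>v\<in>?fv 0. f - lin_comb (rank F 0) A v \<in> J)"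
  proof -
    let ?g = "\<lambda>v. J +>\<^bsub>?S\<^esub> lin_comb (rank F 0) A v"
    let ?h = "\<lambda>f. J +>\<^bsub>?S\<^esub> f"
    have e: "aug_map (quot_module n m J) F ` free_vecs n m F 0 = ?g ` ?fv 0"
      unfolding free_vecs_eq image_image by (rule image_cong[OF refl am])
    have "?g ` ?fv 0 \<subseteq> ?h ` poly_carrier n m"
      by (rule image_subsetI) (rule imageI, rule lc)
    then have "?g ` ?fv 0 = ?h ` poly_carrier n m \<longleftrightarrow> ?h ` poly_carrier n m \<subseteq> ?g ` ?fv 0"
      by (simp only: set_eq_subset simp_thms)
    also have "\<dots> \<longleftrightarrow> (\<forall>f\<in>poly_carrier n m. \<exists>v\<in>?fv 0. f - lin_comb (rank F 0) A v \<in> J)"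
      by (simp only: image_subset_iff image_iff coset_eq_iff[OF J])
    finally show ?thesis by (simp only: e quot_module_simps)
  qed
  have dm: "diff F i *\<^sub>v ?b (Suc i) v = ?b i (?m i v)" for i v
    unfolding D_def by (rule mat_mult_vec_eq_mat_app[OF dims])
  have conv: "{z \<in> free_vecs n m F i. P z} = (\<lambda>z. diff F i *\<^sub>v z) ` free_vecs n m F (Suc i) \<longleftrightarrow>
      {v \<in> ?fv i. P (?b i v)} = ?m i ` ?fv (Suc i)"
    if hm: "hmat n m (rank F i) (rank F (Suc i)) (shift F i) (shift F (Suc i)) (D i)" for i P
  proof -
    have e1: "{z \<in> free_vecs n m F i. P z} = ?b i ` {v \<in> ?fv i. P (?b i v)}" unfolding free_vecs_eq by blast
    have e2: "(\<lambda>z. diff F i *\<^sub>v z) ` free_vecs n m F (Suc i) = ?b i ` (?m i ` ?fv (Suc i))"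
      unfolding free_vecs_eq image_image dm ..
    have "?m i ` ?fv (Suc i) \<subseteq> ?fv i" using mat_app_fvec[OF hm] by blast
    then have "?b i ` {v \<in> ?fv i. P (?b i v)} = ?b i ` (?m i ` ?fv (Suc i)) \<longleftrightarrow>
        {v \<in> ?fv i. P (?b i v)} = ?m i ` ?fv (Suc i)"
      by (intro inj_on_image_eq_iff[OF inj_on_vec]) (rule Collect_restrict)
    then show ?thesis by (simp only: e1 e2)
  qed
  have 4: "{z \<in> free_vecs n m F 0. aug_map (quot_module n m J) F z = \<zero>\<^bsub>quot_module n m J\<^esub>} =
      (\<lambda>z. diff F 0 *\<^sub>v z) ` free_vecs n m F 1 \<longleftrightarrow>
      {v \<in> ?fv 0. lin_comb (rank F 0) A v \<in> J} = mat_app (rank F 0) (rank F 1) (D 0) ` ?fv 1"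
    if hm: "\<forall>i. hmat n m (rank F i) (rank F (Suc i)) (shift F i) (shift F (Suc i)) (D i)"
  proof -
    have "{v \<in> ?fv 0. aug_map (quot_module n m J) F (?b 0 v) = \<zero>\<^bsub>quot_module n m J\<^esub>}
        = {v \<in> ?fv 0. lin_comb (rank F 0) A v \<in> J}"
      by (rule Collect_cong, rule conj_cong[OF refl]) (simp only: am quot_module_simps coset_eq_ideal_iff[OF J])
    then show ?thesis using conv[OF hm[rule_format, of 0]] by simp
  qed
  have 5: "{z \<in> free_vecs n m F (Suc i). diff F i *\<^sub>v z = 0\<^sub>v (rank F i)} =
      (\<lambda>z. diff F (Suc i) *\<^sub>v z) ` free_vecs n m F (Suc (Suc i)) \<longleftrightarrow>
      {v \<in> ?fv (Suc i). ?m i v = 0} = ?m (Suc i) ` ?fv (Suc (Suc i))"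
    if hm: "\<forall>i. hmat n m (rank F i) (rank F (Suc i)) (shift F i) (shift F (Suc i)) (D i)" for i
  proof -
    have "diff F i *\<^sub>v ?b (Suc i) v = 0\<^sub>v (rank F i) \<longleftrightarrow> ?m i v = 0" if v: "v \<in> ?fv (Suc i)" for v
    proof -
      have "0\<^sub>v (rank F i) = ?b i 0" by (intro eq_vecI) simp_all
      then have "diff F i *\<^sub>v ?b (Suc i) v = 0\<^sub>v (rank F i) \<longleftrightarrow> ?b i (?m i v) = ?b i 0" by (simp add: dm)
      also have "\<dots> \<longleftrightarrow> ?m i v = 0"
        using inj_on_eq_iff[OF inj_on_vec mat_app_fvec[OF hm[rule_format] v] fvec_zero] .
      finally show ?thesis .
    qed
    then have "{v \<in> ?fv (Suc i). diff F i *\<^sub>v ?b (Suc i) v = 0\<^sub>v (rank F i)} = {v \<in> ?fv (Suc i). ?m i v = 0}"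
      by blast
    then show ?thesis using conv[OF hm[rule_format, of "Suc i"]] by simp
  qed
  have dims': "\<forall>i. diff F i \<in> carrier_mat (rank F i) (rank F (Suc i))" using dims by blast
  have A': "\<forall>j<rank F 0. A j \<in> bihom n m (shift F 0 j)" using A by blast
  show ?thesis
  proof (cases "\<forall>i. hmat n m (rank F i) (rank F (Suc i)) (shift F i) (shift F (Suc i)) (D i)")
    case True
    show ?thesis
      unfolding bigraded_free_resolution_def is_res_def
      by (simp only: eqTrueI[OF 1] 2 3 4[OF True] 5[OF True] eqTrueI[OF dims'] eqTrueI[OF A']
          eqTrueI[OF True] simp_thms)
  next
    case False
    then show ?thesis
      unfolding bigraded_free_resolution_def is_res_def by (simp only: 2 simp_thms)
  qed
qed

lemma resolution_obtain_is_res: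
  fixes F :: "('k::field, 'k bipoly set) free_complex"
  assumes J: "poly_ideal n m J"
    and F: "bigraded_free_resolution n m (quot_module n m J) (quot_bihom n m J) F"
  shows "\<exists>A. is_res n m J (rank F) (shift F) (\<lambda>i k j. diff F i $$ (k, j)) A"
proof -
  have dims: "\<And>i. diff F i \<in> carrier_mat (rank F i) (rank F (Suc i))"
    and aug: "\<And>j. j < rank F 0 \<Longrightarrow> aug F j \<in> quot_bihom n m J (shift F 0 j)"
    using F[unfolded bigraded_free_resolution_def, THEN conjunct2, THEN conjunct1]
      F[unfolded bigraded_free_resolution_def, THEN conjunct1] by simp_all
  have "\<forall>j. \<exists>f. j < rank F 0 \<longrightarrow> aug F j = J +>\<^bsub>bipoly_ring n m\<^esub> f \<and> f \<in> bihom n m (shift F 0 j)"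
  proof (intro allI)
    fix j
    show "\<exists>f. j < rank F 0 \<longrightarrow> aug F j = J +>\<^bsub>bipoly_ring n m\<^esub> f \<and> f \<in> bihom n m (shift F 0 j)"
    proof (cases "j < rank F 0")
      case True
      from aug[OF True] obtain f where
        "f \<in> bihom n m (shift F 0 j)" "aug F j = J +>\<^bsub>bipoly_ring n m\<^esub> f"
        unfolding quot_bihom_def by (rule imageE)
      then show ?thesis by (intro exI[of _ f]) simp
    qed simp
  qed
  from choice[OF this] obtain A where
    "\<And>j. j < rank F 0 \<Longrightarrow> aug F j = J +>\<^bsub>bipoly_ring n m\<^esub> A j \<and> A j \<in> bihom n m (shift F 0 j)" by blast
  then show ?thesis using resolution_iff_is_res[OF J dims, of A] F by blast
qed

lemma bigraded_free_resolution_exists: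
  fixes J :: "'k::field bipoly set"
  assumes J: "bigraded n m J"
  shows "\<exists>F. bigraded_free_resolution n m (quot_module n m J) (quot_bihom n m J) F"
proof -
  obtain rk sh D A where res: "is_res n m J rk sh D A" using resolution_exists[OF J] by blast
  let ?F = "\<lparr>rank = rk, shift = sh, diff = (\<lambda>i. mat (rk i) (rk (Suc i)) (\<lambda>(k, j). D i k j)),
    aug = (\<lambda>j. J +>\<^bsub>bipoly_ring n m\<^esub> A j)\<rparr>"
  have ma: "mat_app (rk i) (rk (Suc i)) (\<lambda>k j. diff ?F i $$ (k, j)) = mat_app (rk i) (rk (Suc i)) (D i)" for i
    by (intro ext) (simp add: mat_app_def)
  have ma0: "mat_app (rk 0) (rk 1) (\<lambda>k j. diff ?F 0 $$ (k, j)) = mat_app (rk 0) (rk 1) (D 0)"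
    using ma[of 0] by simp
  have "is_res n m J rk sh (\<lambda>i k j. diff ?F i $$ (k, j)) A"
    using res unfolding is_res_def ma ma0 by (simp add: hmat_def)
  moreover have "A j \<in> bihom n m (sh 0 j)" if "j < rk 0" for j using res that unfolding is_res_def by blast
  ultimately show ?thesis
    using resolution_iff_is_res[OF bigradedD(1)[OF J], of ?F A] by (intro exI[of _ ?F]) simp
qed


section \<open>Tor and the regularity\<close>

lemma restr_mons_0_0: "restr (mons 0 0) f = bconst (lookup f 0)"
  by (rule poly_mapping_eqI) (simp add: lookup_restr mons_0_0 bconst_def lookup_single when_def)

lemma bihom_0_0_iff: "f \<in> bihom 0 0 c \<longleftrightarrow> f = bconst (lookup f 0) \<and> (lookup f 0 \<noteq> 0 \<longrightarrow> c = 0)"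
proof
  assume f: "f \<in> bihom 0 0 c"
  then have "keys f \<subseteq> mons 0 0" by (auto simp: bihom_iff hmons_def)
  then have "restr (mons 0 0) f = f" by (rule restr_id)
  moreover have "lookup f 0 \<noteq> 0 \<longrightarrow> c = 0" using f by (auto simp: bihom_iff hmons_def in_keys_iff)
  ultimately show "f = bconst (lookup f 0) \<and> (lookup f 0 \<noteq> 0 \<longrightarrow> c = 0)" by (simp add: restr_mons_0_0)
next
  assume *: "f = bconst (lookup f 0) \<and> (lookup f 0 \<noteq> 0 \<longrightarrow> c = 0)"
  show "f \<in> bihom 0 0 c"
  proof (cases "lookup f 0 = 0")
    case True
    then have "f = 0" using * by (simp add: bconst_def)
    then show ?thesis by simp
  next
    case False
    then show ?thesis using * bihom_bconst by metis
  qed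
qed

definition const_vec :: "nat \<Rightarrow> (nat \<Rightarrow> 'k::field bipoly) \<Rightarrow> 'k vec" where
  "const_vec r v = vec r (\<lambda>j. lookup (v j) 0)"

lemma vecs_K_eq:
  "vecs_K F i c = const_vec (rank F i) ` hvec 0 0 (rank F i) (shift F i) c"
proof
  show "vecs_K F i c \<subseteq> const_vec (rank F i) ` hvec 0 0 (rank F i) (shift F i) c"
  proof
    fix z assume z: "z \<in> vecs_K F i c"
    let ?v = "\<lambda>j. if j < rank F i then bconst (z $ j) else 0"
    have "z = const_vec (rank F i) ?v"
      using z by (intro eq_vecI) (auto simp: vecs_K_def const_vec_def bconst_def)
    moreover have "?v \<in> hvec 0 0 (rank F i) (shift F i) c"
      using z by (auto simp: hvec_def bihom_0_0_iff vecs_K_def bconst_def)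
    ultimately show "z \<in> const_vec (rank F i) ` hvec 0 0 (rank F i) (shift F i) c" by (rule image_eqI)
  qed
qed (auto simp: vecs_K_def const_vec_def hvec_def bihom_0_0_iff)

lemma inj_on_const_vec: "inj_on (const_vec r) (fvec 0 0 r)"
proof (rule inj_onI)
  fix v w :: "nat \<Rightarrow> 'a bipoly"
  assume v: "v \<in> fvec 0 0 r" and w: "w \<in> fvec 0 0 r" and eq: "const_vec r v = const_vec r w"
  have const: "f = bconst (lookup f 0)" if "f \<in> poly_carrier 0 0" for f :: "'a bipoly"
    using restr_id[of f "mons 0 0"] that by (simp add: poly_carrier_iff restr_mons_0_0)
  show "v = w"
  proof (rule ext)
    fix j show "v j = w j"
    proof (cases "j < r")
      case True
      then have "lookup (v j) 0 = lookup (w j) 0"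
        using arg_cong[OF eq, of "\<lambda>z. z $ j"] by (simp add: const_vec_def)
      moreover have "v j \<in> poly_carrier 0 0" "w j \<in> poly_carrier 0 0" using v w True by (simp_all add: fvec_def)
      ultimately show ?thesis using const by metis
    next
      case False
      then show ?thesis using v w by (simp add: fvec_def)
    qed
  qed
qed

lemma homology_K_trivial_iff:
  fixes F :: "('k::field, 'b) free_complex"
  assumes dim: "\<And>i. diff F i \<in> carrier_mat (rank F i) (rank F (Suc i))"
  shows "carrier (homology_K F i c) = {\<one>\<^bsub>homology_K F i c\<^esub>} \<longleftrightarrow> cycles_K F i c \<subseteq> boundaries_K F i c"
proof -
  let ?H = "boundaries_K F i c" and ?Z = "cycles_K F i c"
  let ?c = "\<lambda>z. (\<Union>h\<in>?H. {h + z})"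
  have car: "carrier (homology_K F i c) = ?c ` ?Z" and one: "\<one>\<^bsub>homology_K F i c\<^esub> = ?H"
    unfolding homology_K_def A_FactGroup_def' A_RCOSETS_def' a_r_coset_def' by (auto simp: module_vec_def)
  have dK: "diff_K F i \<in> carrier_mat (rank F i) (rank F (Suc i))" for i using dim by (simp add: diff_K_def)
  have Vc: "vecs_K F j c \<subseteq> carrier_vec (rank F j)" for j by (auto simp: vecs_K_def)
  have Hadd: "h + z \<in> ?H" and Hsub: "h - z \<in> ?H" if hz: "h \<in> ?H" "z \<in> ?H" for h z
  proof -
    obtain h' z' where h': "h' \<in> vecs_K F (Suc i) c" "h = diff_K F i *\<^sub>v h'"
      and z': "z' \<in> vecs_K F (Suc i) c" "z = diff_K F i *\<^sub>v z'" using hz by (auto simp: boundaries_K_def)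
    have "h' + z' \<in> vecs_K F (Suc i) c" "h' - z' \<in> vecs_K F (Suc i) c"
      using h'(1) z'(1) unfolding vecs_K_def by (auto intro!: add_carrier_vec minus_carrier_vec)
    moreover have "h + z = diff_K F i *\<^sub>v (h' + z')" "h - z = diff_K F i *\<^sub>v (h' - z')"
      using mult_add_distrib_mat_vec[OF dK, of h' i z'] mult_minus_distrib_mat_vec[OF dK, of h' i z']
        subsetD[OF Vc h'(1)] subsetD[OF Vc z'(1)] h'(2) z'(2) by simp_all
    ultimately show "h + z \<in> ?H" "h - z \<in> ?H" unfolding boundaries_K_def by blast+
  qed
  have z0: "0\<^sub>v (rank F (Suc i)) \<in> vecs_K F (Suc i) c" by (auto simp: vecs_K_def)
  have d0: "diff_K F i *\<^sub>v 0\<^sub>v (rank F (Suc i)) = 0\<^sub>v (rank F i)" for i using dK[of i] by (intro eq_vecI) auto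
  have H0: "0\<^sub>v (rank F i) \<in> ?H" using imageI[OF z0, of "(*\<^sub>v) (diff_K F i)"] unfolding boundaries_K_def d0 .
  have Zc: "?Z \<subseteq> carrier_vec (rank F i)" using Vc[of i] by (cases i) auto
  have Hc: "?H \<subseteq> carrier_vec (rank F i)" 
    unfolding boundaries_K_def using mult_mat_vec_carrier[OF dK[of i]] Vc[of "Suc i"] by blast
  have coset: "?c z = ?H \<longleftrightarrow> z \<in> ?H" if z: "z \<in> ?Z" for z
  proof
    assume "?c z = ?H"
    moreover have "0\<^sub>v (rank F i) + z = z" using z Zc by auto
    ultimately show "z \<in> ?H" using H0 by force
  next
    assume zH: "z \<in> ?H"
    have "h \<in> ?c z" if h: "h \<in> ?H" for h
    proof -
      have "h \<in> carrier_vec (rank F i)" "z \<in> carrier_vec (rank F i)" using h zH Hc by blast+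
      then have eq: "h = (h - z) + z" by (intro eq_vecI) auto
      show ?thesis by (rule UN_I[OF Hsub[OF h zH]]) (simp add: eq[symmetric])
    qed
    then show "?c z = ?H" using Hadd zH by blast
  qed
  have "0\<^sub>v (rank F i) \<in> ?Z"
  proof (cases i)
    case (Suc k)
    then show ?thesis using d0[of k] by (auto simp: vecs_K_def)
  qed (auto simp: vecs_K_def)
  show ?thesis
    unfolding car one
  proof
    assume *: "?c ` ?Z = {?H}"
    show "?Z \<subseteq> ?H"
    proof
      fix z assume z: "z \<in> ?Z"
      then have "?c z \<in> {?H}" unfolding *[symmetric] by (rule imageI)
      then show "z \<in> ?H" using coset[OF z] by simp
    qed
  next
    assume *: "?Z \<subseteq> ?H"
    then have "?c z = ?H" if "z \<in> ?Z" for z using that coset[OF that] by blast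
    moreover have "?Z \<noteq> {}" using \<open>0\<^sub>v (rank F i) \<in> ?Z\<close> by blast
    ultimately show "?c ` ?Z = {?H}" by (simp add: image_constant_conv cong: image_cong_simp)
  qed
qed

text \<open>The complex \<open>F \<otimes> K\<close> is the resolution with all variables set to zero.\<close>

definition tor_nonzero ::
  "(nat \<Rightarrow> nat) \<Rightarrow> (nat \<Rightarrow> nat \<Rightarrow> int \<times> int) \<Rightarrow> (nat \<Rightarrow> nat \<Rightarrow> nat \<Rightarrow> 'k::field bipoly) \<Rightarrow>
   nat \<Rightarrow> int \<times> int \<Rightarrow> bool" where
  "tor_nonzero rk sh D i c \<longleftrightarrow>
    \<not> acyclic_at (\<lambda>i. hvec 0 0 (rk i) (sh i)) (graded_resolution.dx rk D 0 0) i c"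

lemma homology_K_iff_tor_nonzero:
  fixes F :: "('k::field, 'b) free_complex"
  defines "D \<equiv> \<lambda>i k j. diff F i $$ (k, j)"
  assumes dim: "\<And>i. diff F i \<in> carrier_mat (rank F i) (rank F (Suc i))"
    and res: "graded_resolution n m (rank F) (shift F) D"
  shows "carrier (homology_K F i c) \<noteq> {\<one>\<^bsub>homology_K F i c\<^esub>} \<longleftrightarrow> tor_nonzero (rank F) (shift F) D i c"
proof -
  interpret graded_resolution n m "rank F" "shift F" D by (rule res)
  let ?\<psi> = "\<lambda>i. const_vec (rank F i) :: (nat \<Rightarrow> 'k bipoly) \<Rightarrow> _"
  let ?C = "\<lambda>i. hvec 0 0 (rank F i) (shift F i)"
  have dK: "diff_K F i \<in> carrier_mat (rank F i) (rank F (Suc i))" for i using dim by (simp add: diff_K_def)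
  have comm: "diff_K F i *\<^sub>v ?\<psi> (Suc i) v = ?\<psi> i (dx 0 0 i v)" for i v
  proof -
    have "diff_K F i *\<^sub>v ?\<psi> (Suc i) v
        = vec (rank F i) (\<lambda>k. \<Sum>j<rank F (Suc i). diff_K F i $$ (k, j) * lookup (v j) 0)"
      unfolding const_vec_def by (rule mat_mult_vec_fun[OF dK])
    also have "\<dots> = ?\<psi> i (dx 0 0 i v)"
    proof (rule eq_vecI)
      fix k assume "k < dim_vec (?\<psi> i (dx 0 0 i v))"
      then have k: "k < rank F i" by (simp add: const_vec_def)
      have "diff_K F i $$ (k, j) = lookup (D i k j) 0" if "j < rank F (Suc i)" for j
        using dim[of i] k that by (simp add: diff_K_def D_def)
      then show "vec (rank F i) (\<lambda>k. \<Sum>j<rank F (Suc i). diff_K F i $$ (k, j) * lookup (v j) 0) $ k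
          = ?\<psi> i (dx 0 0 i v) $ k"
        using k by (simp add: const_vec_def dx_def mat_app_def lookup_sum restr_mons_0_0 lookup_bconst_mult)
    qed (simp add: const_vec_def)
    finally show ?thesis .
  qed
  have fC: "?C i c \<subseteq> fvec 0 0 (rank F i)" for i using hvec_fvec by blast
  have d_mem: "dx 0 0 i v \<in> ?C i c" if "v \<in> ?C (Suc i) c" for i v
    unfolding dx_def by (rule mat_app_hvec[OF hmat_restr that])
  have bnd: "boundaries_K F i c = ?\<psi> i ` bounds_at ?C (dx 0 0) i c"
    unfolding boundaries_K_def bounds_at_def vecs_K_eq image_image comm ..
  have zero: "?\<psi> i v = 0\<^sub>v (rank F i) \<longleftrightarrow> v = 0" if "v \<in> ?C i c" for i v
  proof -
    have "0\<^sub>v (rank F i) = ?\<psi> i 0" by (intro eq_vecI) (simp_all add: const_vec_def)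
    then show ?thesis
      using inj_on_eq_iff[OF inj_on_const_vec subsetD[OF fC that] fvec_zero] by simp
  qed
  have cyc: "cycles_K F i c = ?\<psi> i ` cycles_at ?C (dx 0 0) i c"
  proof (cases i)
    case 0
    then show ?thesis by (simp add: vecs_K_eq cycles_at_def)
  next
    case (Suc k)
    have "cycles_K F (Suc k) c = ?\<psi> (Suc k) ` {v \<in> ?C (Suc k) c. diff_K F k *\<^sub>v ?\<psi> (Suc k) v = 0\<^sub>v (rank F k)}"
      unfolding cycles_K.simps vecs_K_eq by blast
    also have "{v \<in> ?C (Suc k) c. diff_K F k *\<^sub>v ?\<psi> (Suc k) v = 0\<^sub>v (rank F k)}
        = {v \<in> ?C (Suc k) c. dx 0 0 k v = 0}"
      by (rule Collect_cong, rule conj_cong[OF refl]) (simp only: comm zero[OF d_mem])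
    also have "\<dots> = cycles_at ?C (dx 0 0) (Suc k) c" by (simp add: cycles_at_def)
    finally show ?thesis unfolding Suc .
  qed
  have "cycles_at ?C (dx 0 0) i c \<subseteq> fvec 0 0 (rank F i)"
    using fC[of i] by (auto simp: cycles_at_def)
  moreover have "bounds_at ?C (dx 0 0) i c \<subseteq> fvec 0 0 (rank F i)"
    using fC[of i] d_mem by (auto simp: bounds_at_def)
  ultimately have "cycles_K F i c \<subseteq> boundaries_K F i c \<longleftrightarrow>
      cycles_at ?C (dx 0 0) i c \<subseteq> bounds_at ?C (dx 0 0) i c"
    unfolding cyc bnd using inj_on_image_mem_iff[OF inj_on_const_vec] by blast
  then show ?thesis
    unfolding homology_K_trivial_iff[OF dim] tor_nonzero_def acyclic_at_def by simp
qed

lemma is_res_graded_resolution: "is_res n m J rk sh D A \<Longrightarrow> graded_resolution n m rk sh D"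
  unfolding is_res_def graded_resolution_def by blast

lemma is_res_ideal_resolution:
  "bigraded n m J \<Longrightarrow> is_res n m J rk sh D A \<Longrightarrow> ideal_resolution n m rk sh D J A"
  unfolding is_res_def ideal_resolution_def ideal_resolution_axioms_def graded_resolution_def by blast

lemma reg_x_quot_from_resolution:
  fixes J :: "'k::field bipoly set"
  assumes J: "bigraded n m J"
  shows "\<exists>rk sh D A. is_res n m J rk sh D A \<and>
    reg_x_quot n m J = Sup {ereal (real_of_int a) | a i b. tor_nonzero rk sh D i (a + int i, b)}"
proof -
  let ?P = "bigraded_free_resolution n m (quot_module n m J) (quot_bihom n m J)"
  define F where "F = (SOME F. ?P F)"
  have F: "?P F" unfolding F_def by (rule someI_ex[OF bigraded_free_resolution_exists[OF J]])
  obtain A where res: "is_res n m J (rank F) (shift F) (\<lambda>i k j. diff F i $$ (k, j)) A"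
    using resolution_obtain_is_res[OF bigradedD(1)[OF J] F] by blast
  have dim: "diff F i \<in> carrier_mat (rank F i) (rank F (Suc i))" for i
    using F[unfolded bigraded_free_resolution_def, THEN conjunct2, THEN conjunct1] by simp
  have "reg_x_quot n m J = Sup {ereal (real_of_int a) | a i b.
      tor_nonzero (rank F) (shift F) (\<lambda>i k j. diff F i $$ (k, j)) i (a + int i, b)}"
    unfolding reg_x_def Tor_K_def F_def[symmetric]
    by (simp only: homology_K_iff_tor_nonzero[OF dim is_res_graded_resolution[OF res]])
  then show ?thesis using res by blast
qed

text \<open>The degree shift by \<open>i\<close> in the definition of the regularity is the slope of the line in the
  regularity criterion.\<close>

lemma tor_bound_by_leads:
  fixes J :: "'k::field bipoly set"
  assumes J: "bigraded n m J" and res: "is_res n m J rk sh D A"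
    and reg: "x_filter_regular n m (lead_set J)"
  shows "(\<forall>a i b. tor_nonzero rk sh D i (a + int i, b) \<longrightarrow> a \<le> r) \<longleftrightarrow> x_reg_le n m (lead_set J) r"
proof -
  interpret ideal_resolution n m rk sh D J A by (rule is_res_ideal_resolution[OF J res])
  have "(\<forall>a i b. tor_nonzero rk sh D i (a + int i, b) \<longrightarrow> a \<le> r) \<longleftrightarrow>
      (\<forall>i c. fst c > r + int i \<longrightarrow> vanishes 0 0 i c)"
    unfolding tor_nonzero_def
  proof (intro iffI allI impI)
    fix i :: nat and c :: "int \<times> int"
    assume *: "\<forall>a i b. \<not> vanishes 0 0 i (a + int i, b) \<longrightarrow> a \<le> r" and c: "fst c > r + int i"
    show "vanishes 0 0 i c"
    proof (rule ccontr)
      assume "\<not> vanishes 0 0 i c"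
      then have "\<not> vanishes 0 0 i (fst c - int i + int i, snd c)" by simp
      then have "fst c - int i \<le> r" using * by blast
      then show False using c by simp
    qed
  next
    fix a i b
    assume *: "\<forall>i c. fst c > r + int i \<longrightarrow> vanishes 0 0 i c" and n: "\<not> vanishes 0 0 i (a + int i, b)"
    show "a \<le> r"
    proof (rule ccontr)
      assume "\<not> a \<le> r"
      then have "fst (a + int i, b) > r + int i" by simp
      then show False using * n by blast
    qed
  qed
  then show ?thesis using regularity_by_leads[OF reg, of r] by simp
qed

text \<open>A supremum of integers is determined by the integer upper bounds, also when it is infinite.\<close>

lemma Sup_ereal_int_eq:
  fixes P Q :: "int \<Rightarrow> bool"
  assumes "\<And>r. (\<forall>a. P a \<longrightarrow> a \<le> r) \<longleftrightarrow> (\<forall>a. Q a \<longrightarrow> a \<le> r)"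
  shows "Sup {ereal (real_of_int a) | a. P a} = Sup {ereal (real_of_int a) | a. Q a}"
proof -
  have le: "Sup {ereal (real_of_int a) | a. P a} \<le> Sup {ereal (real_of_int a) | a. Q a}"
    if *: "\<And>r. (\<forall>a. P a \<longrightarrow> a \<le> r) \<longleftrightarrow> (\<forall>a. Q a \<longrightarrow> a \<le> r)" for P Q :: "int \<Rightarrow> bool"
  proof (rule Sup_least)
    fix x assume "x \<in> {ereal (real_of_int a) | a. P a}"
    then obtain a where a: "x = ereal (real_of_int a)" "P a" by blast
    have "\<not> (\<forall>a. P a \<longrightarrow> a \<le> a' - 1)" if "a' = a" for a' using a(2) that by force
    then have "\<not> (\<forall>b. Q b \<longrightarrow> b \<le> a - 1)" using *[of "a - 1"] by blast
    then obtain b where b: "Q b" "a \<le> b" by force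
    have "x \<le> ereal (real_of_int b)" using a(1) b(2) by simp
    also have "\<dots> \<le> Sup {ereal (real_of_int a) | a. Q a}" using b(1) by (intro Sup_upper) blast
    finally show "x \<le> Sup {ereal (real_of_int a) | a. Q a}" .
  qed
  show ?thesis using le[of P Q] le[of Q P] assms by (intro antisym) blast+
qed

section \<open>Linear changes of coordinates\<close>

lemma coeff_hom_bconst: "coeff_hom (bconst :: 'k::field \<Rightarrow> 'k bipoly)"
  by unfold_locales (simp_all add: bconst_def single_add mult_single)

interpretation bc: coeff_hom "bconst :: 'k::field \<Rightarrow> 'k bipoly"
  by (rule coeff_hom_bconst)

definition x_image :: "nat \<Rightarrow> 'k::field mat \<Rightarrow> nat \<Rightarrow> 'k bipoly" where
  "x_image n A j = (\<Sum>i<n. bconst (A $$ (i, j)) * x_var i)"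

definition y_image :: "nat \<Rightarrow> 'k::field mat \<Rightarrow> nat \<Rightarrow> 'k bipoly" where
  "y_image m A j = (\<Sum>i<m. bconst (A $$ (i, j)) * y_var i)"

definition mon_image :: "nat \<Rightarrow> nat \<Rightarrow> 'k::field mat \<times> 'k mat \<Rightarrow> bimon \<Rightarrow> 'k bipoly" where
  "mon_image n m g w = mon_prod (x_image n (fst g)) (fst w) * mon_prod (y_image m (snd g)) (snd w)"

lemma act_eq_lin_ext: "act n m g = lin_ext bconst (mon_image n m g)"
  by (rule ext) (simp add: act_def lin_ext_def mon_image_def mon_prod_def x_image_def y_image_def
      split_beta mult.assoc)

lemma mon_image_add: "mon_image n m g (u + v) = mon_image n m g u * mon_image n m g v"
  by (simp add: mon_image_def mon_prod_add mult_ac)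

lemma act_add: "act n m g (f + h) = act n m g f + act n m g h"
  by (simp add: act_eq_lin_ext bc.lin_ext_add)

lemma act_diff: "act n m g (f - h) = act n m g f - act n m g h"
  by (simp add: act_eq_lin_ext bc.lin_ext_diff)

lemma act_zero [simp]: "act n m g 0 = 0"
  by (simp add: act_eq_lin_ext)

lemma act_sum: "act n m g (\<Sum>i\<in>I. f i) = (\<Sum>i\<in>I. act n m g (f i))"
  by (simp add: act_eq_lin_ext bc.lin_ext_sum)

lemma act_mult: "act n m g (f * h) = act n m g f * act n m g h"
  unfolding act_eq_lin_ext by (rule bc.lin_ext_mult) (rule mon_image_add)

lemma act_single: "act n m g (Poly_Mapping.single w a) = bconst a * mon_image n m g w"
  by (simp add: act_eq_lin_ext bc.lin_ext_single)

lemma act_bconst: "act n m g (bconst a) = bconst a"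
  using act_single[of n m g 0 a] by (simp add: bconst_def mon_image_def mult_single)

lemma act_one: "act n m g 1 = 1"
  using act_bconst[of n m g 1] by (simp add: bconst_def)

lemma act_power: "act n m g (f ^ k) = act n m g f ^ k"
  by (induction k) (simp_all add: act_one act_mult)

lemma act_prod: "act n m g (\<Prod>i\<in>I. f i) = (\<Prod>i\<in>I. act n m g (f i))"
  by (induction I rule: infinite_finite_induct) (simp_all add: act_one act_mult)

lemma act_x_var: "act n m g (x_var i) = x_image n (fst g) i"
  by (simp add: x_var_def bimonom_def act_single mon_image_def mon_prod_single bconst_def)

lemma act_y_var: "act n m g (y_var i) = y_image m (snd g) i"
  by (simp add: y_var_def bimonom_def act_single mon_image_def mon_prod_single bconst_def)

lemma x_var_bihom: "i < n \<Longrightarrow> x_var i \<in> bihom n m (1, 0)"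
  unfolding x_var_def bimonom_def by (rule bihom_single) (simp_all add: mons_def bideg_def)

lemma y_var_bihom: "i < m \<Longrightarrow> y_var i \<in> bihom n m (0, 1)"
  unfolding y_var_def bimonom_def by (rule bihom_single) (simp_all add: mons_def bideg_def)

lemma bihom_one: "(1 :: 'k::field bipoly) \<in> bihom n m 0"
  using bihom_bconst[where a = "1::'k"] by (simp add: bconst_def)

lemma bihom_prod:
  fixes f :: "'i \<Rightarrow> 'k::field bipoly"
  shows "(\<And>i. i \<in> I \<Longrightarrow> f i \<in> bihom n m (d i)) \<Longrightarrow> (\<Prod>i\<in>I. f i) \<in> bihom n m (\<Sum>i\<in>I. d i)"
  by (induction I rule: infinite_finite_induct) (simp_all add: bihom_mult bihom_one)

lemma bihom_power_x:
  fixes f :: "'k::field bipoly"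
  shows "f \<in> bihom n m (1, 0) \<Longrightarrow> f ^ k \<in> bihom n m (int k, 0)"
proof (induction k)
  case (Suc k)
  then have "f * f ^ k \<in> bihom n m ((1, 0) + (int k, 0))" by (intro bihom_mult) simp_all
  then show ?case by simp
qed (use bihom_one in \<open>simp add: zero_prod_def\<close>)

lemma bihom_power_y:
  fixes f :: "'k::field bipoly"
  shows "f \<in> bihom n m (0, 1) \<Longrightarrow> f ^ k \<in> bihom n m (0, int k)"
proof (induction k)
  case (Suc k)
  then have "f * f ^ k \<in> bihom n m ((0, 1) + (0, int k))" by (intro bihom_mult) simp_all
  then show ?case by simp
qed (use bihom_one in \<open>simp add: zero_prod_def\<close>)

lemma x_image_bihom: "x_image n A j \<in> bihom n m (1, 0)"
  unfolding x_image_def by (intro bihom_sum bihom_scale x_var_bihom) simp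

lemma y_image_bihom: "y_image m A j \<in> bihom n m (0, 1)"
  unfolding y_image_def by (intro bihom_sum bihom_scale y_var_bihom) simp

lemma mon_image_bihom: "mon_image n m g w \<in> bihom n m (bideg w)"
proof -
  have "mon_prod (x_image n (fst g)) (fst w) \<in> bihom n m (\<Sum>j\<in>keys (fst w). (int (lookup (fst w) j), 0))"
    unfolding mon_prod_def by (intro bihom_prod bihom_power_x x_image_bihom)
  moreover have "mon_prod (y_image m (snd g)) (snd w) \<in> bihom n m (\<Sum>j\<in>keys (snd w). (0, int (lookup (snd w) j)))"
    unfolding mon_prod_def by (intro bihom_prod bihom_power_y y_image_bihom)
  moreover have "(\<Sum>j\<in>keys (fst w). (int (lookup (fst w) j), 0)) +
      (\<Sum>j\<in>keys (snd w). (0, int (lookup (snd w) j))) = bideg w"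
    by (simp add: bideg_def mdeg_def sum_prod)
  ultimately show ?thesis unfolding mon_image_def using bihom_mult by metis
qed

lemma hcomp_act: "hcomp c (act n m g f) = act n m g (hcomp c f)"
proof -
  have "hcomp c (act n m g f) = (\<Sum>w\<in>keys f. hcomp c (bconst (lookup f w) * mon_image n m g w))"
    unfolding act_eq_lin_ext lin_ext_def by (rule restr_sum)
  also have "\<dots> = (\<Sum>w\<in>keys f \<inter> {w. bideg w = c}. bconst (lookup f w) * mon_image n m g w)"
  proof (rule sum.mono_neutral_cong_right)
    fix w
    have mi: "bconst (lookup f w) * mon_image n m g w \<in> bihom n m (bideg w)"
      by (rule bihom_scale[OF mon_image_bihom])
    show "hcomp c (bconst (lookup f w) * mon_image n m g w) = bconst (lookup f w) * mon_image n m g w"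
      if "w \<in> keys f \<inter> {w. bideg w = c}" using hcomp_id[OF mi] that by simp
  next
    show "\<forall>w\<in>keys f - keys f \<inter> {w. bideg w = c}. hcomp c (bconst (lookup f w) * mon_image n m g w) = 0"
    proof
      fix w assume "w \<in> keys f - keys f \<inter> {w. bideg w = c}"
      then have ne: "bideg w \<noteq> c" by simp
      have mi: "bconst (lookup f w) * mon_image n m g w \<in> bihom n m (bideg w)"
        by (rule bihom_scale[OF mon_image_bihom])
      show "hcomp c (bconst (lookup f w) * mon_image n m g w) = 0"
        by (rule restr_eq_0) (use mi ne in \<open>auto simp: bihom_iff hmons_def\<close>)
    qed
  qed simp_all
  also have "\<dots> = act n m g (hcomp c f)"
    unfolding act_eq_lin_ext lin_ext_def keys_restr by (rule sum.cong) (simp_all add: lookup_restr)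
  finally show ?thesis .
qed

lemma act_carrier: "act n m g f \<in> poly_carrier n m"
  unfolding act_eq_lin_ext lin_ext_def
  by (intro poly_carrier_sum poly_carrier_mult poly_carrier_bconst bihom_carrier[OF mon_image_bihom])

lemma act_bihom:
  assumes "f \<in> bihom n m c" shows "act n m g f \<in> bihom n m c"
proof -
  have "hcomp c (act n m g f) \<in> bihom n m c" by (rule hcomp_bihom[OF act_carrier])
  then show ?thesis unfolding hcomp_act hcomp_id[OF assms] .
qed

lemma mdeg_eq_0_iff: "mdeg u = 0 \<longleftrightarrow> u = 0"
proof
  assume "mdeg u = 0"
  then have "lookup u i = 0" for i
    by (cases "i \<in> keys u") (simp_all add: mdeg_def in_keys_iff)
  then show "u = 0" by (intro poly_mapping_eqI) simp
qed simp

lemma bideg_eq_0_iff: "bideg w = 0 \<longleftrightarrow> w = 0"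
  by (simp add: bideg_def zero_prod_def mdeg_eq_0_iff prod_eq_iff)

text \<open>The action preserves bidegrees, and constant terms are the components of bidegree \<open>0\<close>.\<close>

lemma lookup_act_0: "lookup (act n m g f) 0 = lookup f 0"
proof -
  have "hcomp 0 f = bconst (lookup f 0)" for f :: "'a bipoly"
    by (rule poly_mapping_eqI) (simp add: lookup_restr bideg_eq_0_iff bconst_def lookup_single when_def)
  then have "bconst (lookup (act n m g f) 0) = bconst (lookup f 0)"
    using hcomp_act[of 0 n m g f] by (simp add: act_bconst)
  from arg_cong[OF this, of "\<lambda>f. lookup f 0"] show ?thesis by (simp add: bconst_def)
qed

lemma x_image_mult:
  assumes "A \<in> carrier_mat n n" "B \<in> carrier_mat n n" "j < n"
  shows "act n m (A, E) (x_image n B j) = x_image n (A * B) j"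
proof -
  have "act n m (A, E) (x_image n B j) = (\<Sum>i<n. bconst (B $$ (i, j)) * (\<Sum>k<n. bconst (A $$ (k, i)) * x_var k))"
    by (simp add: x_image_def[of n B] act_sum act_mult act_bconst act_x_var) (simp add: x_image_def)
  also have "\<dots> = (\<Sum>i<n. \<Sum>k<n. bconst (A $$ (k, i) * B $$ (i, j)) * x_var k)"
    by (simp add: sum_distrib_left bc.hom_mult mult_ac)
  also have "\<dots> = (\<Sum>k<n. (\<Sum>i<n. bconst (A $$ (k, i) * B $$ (i, j))) * x_var k)"
    by (subst sum.swap) (simp add: sum_distrib_right)
  also have "\<dots> = (\<Sum>k<n. bconst ((A * B) $$ (k, j)) * x_var k)"
  proof (rule sum.cong[OF refl])
    fix k assume "k \<in> {..<n}"
    then have "(A * B) $$ (k, j) = (\<Sum>i<n. A $$ (k, i) * B $$ (i, j))"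
      using assms by (simp add: scalar_prod_def lessThan_atLeast0)
    moreover have "bconst (\<Sum>i<n. A $$ (k, i) * B $$ (i, j)) = (\<Sum>i<n. bconst (A $$ (k, i) * B $$ (i, j)))"
      by (induction n) (simp_all add: bc.hom_add bc.hom_zero)
    ultimately show "(\<Sum>i<n. bconst (A $$ (k, i) * B $$ (i, j))) * x_var k = bconst ((A * B) $$ (k, j)) * x_var k"
      by simp
  qed
  finally show ?thesis by (simp add: x_image_def)
qed

lemma y_image_mult:
  assumes "A \<in> carrier_mat m m" "B \<in> carrier_mat m m" "j < m"
  shows "act n m (E, A) (y_image m B j) = y_image m (A * B) j"
proof -
  have "act n m (E, A) (y_image m B j) = (\<Sum>i<m. bconst (B $$ (i, j)) * (\<Sum>k<m. bconst (A $$ (k, i)) * y_var k))"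
    by (simp add: y_image_def[of m B] act_sum act_mult act_bconst act_y_var) (simp add: y_image_def)
  also have "\<dots> = (\<Sum>i<m. \<Sum>k<m. bconst (A $$ (k, i) * B $$ (i, j)) * y_var k)"
    by (simp add: sum_distrib_left bc.hom_mult mult_ac)
  also have "\<dots> = (\<Sum>k<m. (\<Sum>i<m. bconst (A $$ (k, i) * B $$ (i, j))) * y_var k)"
    by (subst sum.swap) (simp add: sum_distrib_right)
  also have "\<dots> = (\<Sum>k<m. bconst ((A * B) $$ (k, j)) * y_var k)"
  proof (rule sum.cong[OF refl])
    fix k assume "k \<in> {..<m}"
    then have "(A * B) $$ (k, j) = (\<Sum>i<m. A $$ (k, i) * B $$ (i, j))"
      using assms by (simp add: scalar_prod_def lessThan_atLeast0)
    moreover have "bconst (\<Sum>i<m. A $$ (k, i) * B $$ (i, j)) = (\<Sum>i<m. bconst (A $$ (k, i) * B $$ (i, j)))"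
      by (induction m) (simp_all add: bc.hom_add bc.hom_zero)
    ultimately show "(\<Sum>i<m. bconst (A $$ (k, i) * B $$ (i, j))) * y_var k = bconst ((A * B) $$ (k, j)) * y_var k"
      by simp
  qed
  finally show ?thesis by (simp add: y_image_def)
qed

definition gmult :: "'k::field mat \<times> 'k mat \<Rightarrow> 'k mat \<times> 'k mat \<Rightarrow> 'k mat \<times> 'k mat" where
  "gmult g h = (fst g * fst h, snd g * snd h)"

abbreviation mat_pairs :: "nat \<Rightarrow> nat \<Rightarrow> ('k mat \<times> 'k mat) set" where
  "mat_pairs n m \<equiv> carrier_mat n n \<times> carrier_mat m m"

lemma act_act:
  assumes g: "g \<in> mat_pairs n m" and h: "h \<in> mat_pairs n m" and f: "f \<in> poly_carrier n m"
  shows "act n m g (act n m h f) = act n m (gmult g h) f"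
proof -
  have "act n m g (mon_image n m h w) = mon_image n m (gmult g h) w" if w: "w \<in> mons n m" for w
  proof -
    have "act n m g (x_image n (fst h) j) = x_image n (fst g * fst h) j" if "j \<in> keys (fst w)" for j
    proof -
      have "j < n" using that w unfolding mons_def by blast
      then show ?thesis using x_image_mult[of "fst g" n "fst h" j m "snd g"] g h by (simp add: mem_Times_iff)
    qed
    moreover have "act n m g (y_image m (snd h) j) = y_image m (snd g * snd h) j" if "j \<in> keys (snd w)" for j
    proof -
      have "j < m" using that w unfolding mons_def by blast
      then show ?thesis using y_image_mult[of "snd g" m "snd h" j n "fst g"] g h by (simp add: mem_Times_iff)
    qed
    ultimately show ?thesis
      by (simp add: mon_image_def mon_prod_def act_mult act_prod act_power gmult_def)
  qed
  then have "bconst (lookup f w) * act n m g (mon_image n m h w)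
      = bconst (lookup f w) * mon_image n m (gmult g h) w" if "w \<in> keys f" for w
  proof -
    have "w \<in> mons n m" using f that unfolding poly_carrier_iff by blast
    then show ?thesis using \<open>\<And>w. w \<in> mons n m \<Longrightarrow> act n m g (mon_image n m h w) = mon_image n m (gmult g h) w\<close> by simp
  qed
  then show ?thesis
    by (simp add: act_eq_lin_ext[of n m h] act_eq_lin_ext[of n m "gmult g h"] lin_ext_def
        act_sum act_mult act_bconst)
qed

lemma mon_prod_x_var: "mon_prod x_var u = (bimonom (u, 0) :: 'k::field bipoly)"
proof -
  have pow: "x_var j ^ k = (bimonom (Poly_Mapping.single j k, 0) :: 'k bipoly)" for j k
    by (induction k) (simp_all add: x_var_def bimonom_def mult_single single_add[symmetric]
        zero_prod_def[symmetric])
  have "(\<Prod>j\<in>S. x_var j ^ lookup u j) = (bimonom (\<Sum>j\<in>S. Poly_Mapping.single j (lookup u j), 0) :: 'k bipoly)"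
    if "finite S" for S
    using that by induction (simp_all add: pow bimonom_def mult_single zero_prod_def[symmetric])
  then show ?thesis
    unfolding mon_prod_def using poly_mapping_expand[of "keys u" u] by simp
qed

lemma mon_prod_y_var: "mon_prod y_var u = (bimonom (0, u) :: 'k::field bipoly)"
proof -
  have pow: "y_var j ^ k = (bimonom (0, Poly_Mapping.single j k) :: 'k bipoly)" for j k
    by (induction k) (simp_all add: y_var_def bimonom_def mult_single single_add[symmetric]
        zero_prod_def[symmetric])
  have "(\<Prod>j\<in>S. y_var j ^ lookup u j) = (bimonom (0, \<Sum>j\<in>S. Poly_Mapping.single j (lookup u j)) :: 'k bipoly)"
    if "finite S" for S
    using that by induction (simp_all add: pow bimonom_def mult_single zero_prod_def[symmetric])
  then show ?thesis
    unfolding mon_prod_def using poly_mapping_expand[of "keys u" u] by simp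
qed

lemma x_image_one: "j < n \<Longrightarrow> x_image n (1\<^sub>m n) j = (x_var j :: 'k::field bipoly)"
proof -
  assume j: "j < n"
  have "x_image n (1\<^sub>m n) j = (\<Sum>i<n. if i = j then x_var i else 0 :: 'k bipoly)"
    unfolding x_image_def using j by (intro sum.cong) (auto simp: bc.hom_one bc.hom_zero)
  then show ?thesis using j by simp
qed

lemma y_image_one: "j < m \<Longrightarrow> y_image m (1\<^sub>m m) j = (y_var j :: 'k::field bipoly)"
proof -
  assume j: "j < m"
  have "y_image m (1\<^sub>m m) j = (\<Sum>i<m. if i = j then y_var i else 0 :: 'k bipoly)"
    unfolding y_image_def using j by (intro sum.cong) (auto simp: bc.hom_one bc.hom_zero)
  then show ?thesis using j by simp
qed

lemma act_identity:
  fixes f :: "'k::field bipoly"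
  assumes f: "f \<in> poly_carrier n m"
  shows "act n m (1\<^sub>m n, 1\<^sub>m m) f = f"
proof -
  have mi: "mon_image n m (1\<^sub>m n, 1\<^sub>m m) w = (bimonom w :: 'k bipoly)" if w: "w \<in> mons n m" for w
  proof -
    have kw: "\<And>j. j \<in> keys (fst w) \<Longrightarrow> j < n" "\<And>j. j \<in> keys (snd w) \<Longrightarrow> j < m"
      using w unfolding mons_def by blast+
    have "mon_prod (x_image n (1\<^sub>m n)) (fst w) = (mon_prod x_var (fst w) :: 'k bipoly)"
      unfolding mon_prod_def by (rule prod.cong) (simp_all add: x_image_one kw(1))
    moreover have "mon_prod (y_image m (1\<^sub>m m)) (snd w) = (mon_prod y_var (snd w) :: 'k bipoly)"
      unfolding mon_prod_def by (rule prod.cong) (simp_all add: y_image_one kw(2))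
    ultimately show ?thesis
      by (simp add: mon_image_def mon_prod_x_var mon_prod_y_var bimonom_def mult_single)
  qed
  have "act n m (1\<^sub>m n, 1\<^sub>m m) f = (\<Sum>w\<in>keys f. Poly_Mapping.single w (lookup f w))"
    unfolding act_eq_lin_ext lin_ext_def
  proof (rule sum.cong[OF refl])
    fix w assume "w \<in> keys f"
    then have "w \<in> mons n m" using f unfolding poly_carrier_iff by blast
    then show "bconst (lookup f w) * mon_image n m (1\<^sub>m n, 1\<^sub>m m) w = Poly_Mapping.single w (lookup f w)"
      by (simp add: mi single_eq_bconst_bimonom)
  qed
  then show ?thesis using poly_mapping_expand[of "keys f" f] by simp
qed

lemma GL_inverse:
  assumes "A \<in> GL n"
  shows "\<exists>B\<in>GL n. A * B = 1\<^sub>m n \<and> B * A = 1\<^sub>m n"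
proof -
  have A: "A \<in> carrier_mat n n" using assms by (simp add: GL_def)
  obtain B where B: "inverts_mat A B" "inverts_mat B A"
    using assms by (auto simp: GL_def invertible_mat_def)
  have AB: "A * B = 1\<^sub>m n" using B(1) A by (simp add: inverts_mat_def)
  have BA: "B * A = 1\<^sub>m (dim_row B)" using B(2) by (simp add: inverts_mat_def)
  have "dim_col B = n" using arg_cong[OF AB, of dim_col] by simp
  moreover have "dim_row B = n" using arg_cong[OF BA, of dim_col] A by simp
  ultimately have Bc: "B \<in> carrier_mat n n" by auto
  then have "invertible_mat B" using A B by (auto simp: invertible_mat_def)
  then show ?thesis using AB BA Bc by (auto simp: GL_def)
qed

lemma GL_pairs_inverse:
  assumes "g \<in> GL n \<times> GL m"
  shows "\<exists>h\<in>GL n \<times> GL m. gmult g h = (1\<^sub>m n, 1\<^sub>m m) \<and> gmult h g = (1\<^sub>m n, 1\<^sub>m m)"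
proof -
  obtain A E where g: "g = (A, E)" "A \<in> GL n" "E \<in> GL m" using assms by auto
  obtain B where "B \<in> GL n" "A * B = 1\<^sub>m n" "B * A = 1\<^sub>m n" using GL_inverse[OF g(2)] by blast
  moreover obtain C where "C \<in> GL m" "E * C = 1\<^sub>m m" "C * E = 1\<^sub>m m" using GL_inverse[OF g(3)] by blast
  ultimately show ?thesis using g(1) by (intro bexI[of _ "(B, C)"]) (auto simp: gmult_def)
qed

lemma GL_pairs_mat_pairs: "g \<in> GL n \<times> GL m \<Longrightarrow> g \<in> mat_pairs n m"
  by (auto simp: GL_def)

lemma act_inverse:
  assumes g: "g \<in> GL n \<times> GL m"
  shows "\<exists>h\<in>GL n \<times> GL m. \<forall>f\<in>poly_carrier n m.
    act n m h (act n m g f) = f \<and> act n m g (act n m h f) = f"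
proof -
  obtain h where h: "h \<in> GL n \<times> GL m" "gmult g h = (1\<^sub>m n, 1\<^sub>m m)" "gmult h g = (1\<^sub>m n, 1\<^sub>m m)"
    using GL_pairs_inverse[OF g] by blast
  have "act n m h (act n m g f) = f \<and> act n m g (act n m h f) = f" if "f \<in> poly_carrier n m" for f
    using that act_act[OF GL_pairs_mat_pairs[OF h(1)] GL_pairs_mat_pairs[OF g] that]
      act_act[OF GL_pairs_mat_pairs[OF g] GL_pairs_mat_pairs[OF h(1)] that] h(2,3)
    by (simp add: act_identity)
  then show ?thesis using h(1) by blast
qed

lemma bigraded_act:
  assumes J: "bigraded n m J" and g: "g \<in> GL n \<times> GL m"
  shows "bigraded n m (act n m g ` J)"
proof -
  note pJ = bigradedD(1)[OF J]
  obtain h where h: "\<And>f. f \<in> poly_carrier n m \<Longrightarrow> act n m g (act n m h f) = f"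
    using act_inverse[OF g] by blast
  show ?thesis
    unfolding bigraded_def poly_ideal_def
  proof (intro conjI ballI allI)
    show "act n m g ` J \<subseteq> poly_carrier n m" using act_carrier by blast
    show "0 \<in> act n m g ` J" using poly_idealD(2)[OF pJ] by (rule rev_image_eqI) simp
    fix f assume "f \<in> act n m g ` J"
    then obtain j where j: "j \<in> J" "f = act n m g j" by blast
    show "f + f' \<in> act n m g ` J" if "f' \<in> act n m g ` J" for f'
    proof -
      from that have "\<exists>j'\<in>J. f' = act n m g j'" by blast
      then obtain j' where "j' \<in> J" "f' = act n m g j'" by blast
      then show ?thesis using j poly_idealD(3)[OF pJ, of j j'] by (intro image_eqI[of _ _ "j + j'"]) (simp_all add: act_add)
    qed
    show "f' * f \<in> act n m g ` J" if f': "f' \<in> poly_carrier n m" for f'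
    proof (rule image_eqI)
      show "act n m h f' * j \<in> J" by (rule poly_idealD(4)[OF pJ j(1) act_carrier])
      show "f' * f = act n m g (act n m h f' * j)" using h[OF f'] j(2) by (simp add: act_mult)
    qed
    show "hcomp c f \<in> act n m g ` J" for c
      unfolding j(2) hcomp_act by (intro imageI bigradedD(2)[OF J] j)
  qed
qed

text \<open>An automorphism of the polynomial ring applied to all entries carries kernels to kernels and
  images to images.\<close>

lemma is_res_act:
  assumes J: "bigraded n m J" and g: "g \<in> GL n \<times> GL m" and res: "is_res n m J rk sh D A"
  shows "is_res n m (act n m g ` J) rk sh (\<lambda>i k j. act n m g (D i k j)) (\<lambda>j. act n m g (A j))"
proof -
  note pJ = bigradedD(1)[OF J]
  obtain h where h1: "\<And>f. f \<in> poly_carrier n m \<Longrightarrow> act n m h (act n m g f) = f"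
    and h2: "\<And>f. f \<in> poly_carrier n m \<Longrightarrow> act n m g (act n m h f) = f"
    using act_inverse[OF g] by blast
  let ?a = "act n m g" and ?r = "\<lambda>v j. act n m g (v j)"
  have r_fvec: "fvec n m r = ?r ` fvec n m r" for r
  proof
    show "fvec n m r \<subseteq> ?r ` fvec n m r"
    proof
      fix v :: "nat \<Rightarrow> 'a bipoly" assume v: "v \<in> fvec n m r"
      have "?r (\<lambda>j. act n m h (v j)) = v"
      proof (rule ext)
        fix j show "act n m g (act n m h (v j)) = v j"
          using v h2 by (cases "j < r") (simp_all add: fvec_def)
      qed
      moreover have "(\<lambda>j. act n m h (v j)) \<in> fvec n m r"
        using v by (simp add: fvec_def act_carrier)
      ultimately show "v \<in> ?r ` fvec n m r" by (metis image_eqI)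
    qed
    show "?r ` fvec n m r \<subseteq> fvec n m r" by (auto simp: fvec_def act_carrier)
  qed
  have lc: "lin_comb r (\<lambda>j. ?a (A j)) (?r v) = ?a (lin_comb r A v)" for r v
    by (simp add: lin_comb_def act_sum act_mult)
  have ma: "mat_app p q (\<lambda>k j. ?a (B k j)) (?r v) = ?r (mat_app p q B v)" for p q v and B :: "nat \<Rightarrow> nat \<Rightarrow> 'a bipoly"
    by (rule ext) (simp add: mat_app_def act_sum act_mult)
  have lcc: "lin_comb (rk 0) A v \<in> poly_carrier n m" if "v \<in> fvec n m (rk 0)" for v
    using ideal_resolution.eps_carrier[OF is_res_ideal_resolution[OF J res] that] .
  have inJ: "?a f \<in> ?a ` J \<longleftrightarrow> f \<in> J" if f: "f \<in> poly_carrier n m" for f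
  proof
    assume "?a f \<in> ?a ` J"
    then obtain j where "j \<in> J" "?a f = ?a j" by blast
    then show "f \<in> J" using h1[OF f] h1[OF poly_idealD(1)[OF pJ]] by metis
  qed simp
  have r0: "?r v = 0 \<longleftrightarrow> v = 0" if v: "v \<in> fvec n m r" for v r
  proof
    assume z: "?r v = 0"
    show "v = 0"
    proof (rule ext)
      fix j
      have "?a (v j) = 0" using fun_cong[OF z, of j] by simp
      moreover have "v j \<in> poly_carrier n m" using v by (cases "j < r") (simp_all add: fvec_def)
      ultimately show "v j = 0 j" using h1[of "v j"] by simp
    qed
  qed (simp add: fun_eq_iff)
  note r = res[unfolded is_res_def]
  note res' = r[THEN conjunct1] r[THEN conjunct2, THEN conjunct1, rule_format]
    r[THEN conjunct2, THEN conjunct2, THEN conjunct1, rule_format]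
    r[THEN conjunct2, THEN conjunct2, THEN conjunct2, THEN conjunct1]
    r[THEN conjunct2, THEN conjunct2, THEN conjunct2, THEN conjunct2, rule_format]
  have img: "mat_app p q (\<lambda>k j. ?a (B k j)) ` fvec n m q = ?r ` (mat_app p q B ` fvec n m q)" for p q and B :: "nat \<Rightarrow> nat \<Rightarrow> 'a bipoly"
  proof -
    have "mat_app p q (\<lambda>k j. ?a (B k j)) ` fvec n m q = mat_app p q (\<lambda>k j. ?a (B k j)) ` (?r ` fvec n m q)"
      by (rule arg_cong[OF r_fvec])
    then show ?thesis unfolding image_image ma .
  qed
  have col: "{v \<in> fvec n m r. P v} = ?r ` {v \<in> fvec n m r. P (?r v)}" for r and P :: "(nat \<Rightarrow> 'a bipoly) \<Rightarrow> bool"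
  proof -
    have "{v \<in> fvec n m r. P v} = {v \<in> ?r ` fvec n m r. P v}"
      by (rule arg_cong[OF r_fvec, of "\<lambda>S. {v \<in> S. P v}"])
    also have "\<dots> = ?r ` {v \<in> fvec n m r. P (?r v)}" by blast
    finally show ?thesis .
  qed
  show ?thesis
    unfolding is_res_def
  proof (intro conjI allI ballI)
    show "j < rk 0 \<longrightarrow> ?a (A j) \<in> bihom n m (sh 0 j)" for j using res'(1) act_bihom by blast
    show "hmat n m (rk i) (rk (Suc i)) (sh i) (sh (Suc i)) (\<lambda>k j. ?a (D i k j))" for i
      using res'(2)[of i] act_bihom unfolding hmat_def by blast
    show "\<exists>v\<in>fvec n m (rk 0). f - lin_comb (rk 0) (\<lambda>j. ?a (A j)) v \<in> ?a ` J"
      if f: "f \<in> poly_carrier n m" for f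
    proof -
      obtain v where v: "v \<in> fvec n m (rk 0)" "act n m h f - lin_comb (rk 0) A v \<in> J"
        using res'(3)[OF act_carrier] by blast
      have "f - lin_comb (rk 0) (\<lambda>j. ?a (A j)) (?r v) = ?a (act n m h f - lin_comb (rk 0) A v)"
        unfolding lc by (simp add: act_diff h2[OF f])
      moreover have "?r v \<in> fvec n m (rk 0)" using v(1) r_fvec by blast
      ultimately show ?thesis using v(2) by (metis imageI)
    qed
    show "{v \<in> fvec n m (rk 0). lin_comb (rk 0) (\<lambda>j. ?a (A j)) v \<in> ?a ` J}
        = mat_app (rk 0) (rk 1) (\<lambda>k j. ?a (D 0 k j)) ` fvec n m (rk 1)"
    proof -
      have "{v \<in> fvec n m (rk 0). lin_comb (rk 0) (\<lambda>j. ?a (A j)) (?r v) \<in> ?a ` J}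
          = {v \<in> fvec n m (rk 0). lin_comb (rk 0) A v \<in> J}"
        by (rule Collect_cong, rule conj_cong[OF refl]) (simp only: lc inJ[OF lcc])
      then show ?thesis unfolding img res'(4)[symmetric] by (subst col) simp
    qed
    show "{v \<in> fvec n m (rk (Suc i)). mat_app (rk i) (rk (Suc i)) (\<lambda>k j. ?a (D i k j)) v = 0}
        = mat_app (rk (Suc i)) (rk (Suc (Suc i))) (\<lambda>k j. ?a (D (Suc i) k j)) ` fvec n m (rk (Suc (Suc i)))" for i
    proof -
      have "{v \<in> fvec n m (rk (Suc i)). mat_app (rk i) (rk (Suc i)) (\<lambda>k j. ?a (D i k j)) (?r v) = 0}
          = {v \<in> fvec n m (rk (Suc i)). mat_app (rk i) (rk (Suc i)) (D i) v = 0}"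
        by (rule Collect_cong, rule conj_cong[OF refl]) (simp only: ma r0[OF mat_app_fvec[OF res'(2)]])
      then show ?thesis unfolding img res'(5)[symmetric] by (subst col) simp
    qed
  qed
qed

text \<open>Only the constant terms of the matrices enter into Tor.\<close>

lemma tor_nonzero_act:
  assumes J: "bigraded n m J" and g: "g \<in> GL n \<times> GL m" and res: "is_res n m J rk sh D A"
  shows "tor_nonzero rk sh (\<lambda>i k j. act n m g (D i k j)) = tor_nonzero rk sh D"
proof -
  let ?D = "\<lambda>i k j. act n m g (D i k j)"
  have "graded_resolution.dx rk ?D 0 0 = graded_resolution.dx rk D 0 0"
    unfolding graded_resolution.dx_def[OF is_res_graded_resolution[OF res]]
      graded_resolution.dx_def[OF is_res_graded_resolution[OF is_res_act[OF J g res]]]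
    by (simp only: restr_mons_0_0 lookup_act_0)
  then show ?thesis by (intro ext) (simp add: tor_nonzero_def)
qed

section \<open>Polynomial functions on pairs of matrices\<close>

interpretation idc: coeff_hom "\<lambda>a :: 'k::comm_ring_1. a"
  by unfold_locales simp_all

lemma entry_eval_eq: "entry_eval p g = lin_ext (\<lambda>a. a) (mon_prod (entry g)) p"
  by (simp add: entry_eval_def lin_ext_def mon_prod_def)

definition entry_vars :: "nat \<Rightarrow> nat \<Rightarrow> entry_var set" where
  "entry_vars n m = ({..<n} \<times> {..<n}) <+> ({..<m} \<times> {..<m})"

lemma entry_polys_iff: "p \<in> entry_polys n m \<longleftrightarrow> (\<forall>w\<in>keys p. keys w \<subseteq> entry_vars n m)"
  by (simp add: entry_polys_def entry_vars_def)

text \<open>Polynomial functions of the matrix entries: as functions they can be multiplied and summed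
  pointwise.\<close>

definition gpoly :: "nat \<Rightarrow> nat \<Rightarrow> ('k::field mat \<times> 'k mat \<Rightarrow> 'k) \<Rightarrow> bool" where
  "gpoly n m \<phi> \<longleftrightarrow> (\<exists>p\<in>entry_polys n m. \<forall>g. \<phi> g = entry_eval p g)"

lemma gpoly_const: "gpoly n m (\<lambda>_. a)"
  unfolding gpoly_def
proof (rule bexI)
  show "Poly_Mapping.single 0 a \<in> entry_polys n m" by (simp add: entry_polys_iff)
  show "\<forall>g. a = entry_eval (Poly_Mapping.single 0 a) g" by (simp add: entry_eval_eq idc.lin_ext_single)
qed

lemma gpoly_entry:
  assumes "z \<in> entry_vars n m" shows "gpoly n m (\<lambda>g. entry g z)"
  unfolding gpoly_def
proof (rule bexI)
  show "Poly_Mapping.single (Poly_Mapping.single z 1) 1 \<in> entry_polys n m" using assms by (simp add: entry_polys_iff)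
  show "\<forall>g. entry g z = entry_eval (Poly_Mapping.single (Poly_Mapping.single z 1) 1) g"
    by (simp add: entry_eval_eq idc.lin_ext_single mon_prod_single)
qed

lemma gpoly_add:
  assumes "gpoly n m \<phi>" "gpoly n m \<psi>" shows "gpoly n m (\<lambda>g. \<phi> g + \<psi> g)"
proof -
  obtain p q where "p \<in> entry_polys n m" "\<forall>g. \<phi> g = entry_eval p g"
    "q \<in> entry_polys n m" "\<forall>g. \<psi> g = entry_eval q g" using assms by (auto simp: gpoly_def)
  moreover from this have "p + q \<in> entry_polys n m"
    using Poly_Mapping.keys_add[of p q] unfolding entry_polys_iff by blast
  ultimately show ?thesis
    unfolding gpoly_def by (intro bexI[of _ "p + q"]) (simp_all add: entry_eval_eq idc.lin_ext_add)
qed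

lemma gpoly_mult:
  assumes "gpoly n m \<phi>" "gpoly n m \<psi>" shows "gpoly n m (\<lambda>g. \<phi> g * \<psi> g)"
proof -
  obtain p q where pq: "p \<in> entry_polys n m" "\<forall>g. \<phi> g = entry_eval p g"
    "q \<in> entry_polys n m" "\<forall>g. \<psi> g = entry_eval q g" using assms by (auto simp: gpoly_def)
  have "p * q \<in> entry_polys n m"
    unfolding entry_polys_iff
  proof
    fix w assume "w \<in> keys (p * q)"
    then obtain u v where "u \<in> keys p" "v \<in> keys q" "w = u + v" using keys_mult[of p q] by blast
    then show "keys w \<subseteq> entry_vars n m" using pq by (simp add: entry_polys_iff keys_add_nat)
  qed
  then show ?thesis
    unfolding gpoly_def
    by (intro bexI[of _ "p * q"]) (simp_all add: pq entry_eval_eq idc.lin_ext_mult mon_prod_add)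
qed

lemma gpoly_sum: "(\<And>i. i \<in> I \<Longrightarrow> gpoly n m (\<phi> i)) \<Longrightarrow> gpoly n m (\<lambda>g. \<Sum>i\<in>I. \<phi> i g)"
  by (induction I rule: infinite_finite_induct) (simp_all add: gpoly_const gpoly_add)

lemma gpoly_prod: "(\<And>i. i \<in> I \<Longrightarrow> gpoly n m (\<phi> i)) \<Longrightarrow> gpoly n m (\<lambda>g. \<Prod>i\<in>I. \<phi> i g)"
  by (induction I rule: infinite_finite_induct) (simp_all add: gpoly_const gpoly_mult)

definition polyfun :: "('k::field \<Rightarrow> 'k) \<Rightarrow> bool" where
  "polyfun \<psi> \<longleftrightarrow> (\<exists>q. \<forall>t. \<psi> t = poly q t)"

lemma polyfun_const [simp]: "polyfun (\<lambda>_. a)"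
  unfolding polyfun_def by (rule exI[of _ "[:a:]"]) simp

lemma polyfun_id [simp]: "polyfun (\<lambda>t. t)"
  unfolding polyfun_def by (rule exI[of _ "[:0, 1:]"]) simp

lemma polyfun_add: "polyfun \<phi> \<Longrightarrow> polyfun \<psi> \<Longrightarrow> polyfun (\<lambda>t. \<phi> t + \<psi> t)"
  unfolding polyfun_def by (metis poly_add)

lemma polyfun_mult: "polyfun \<phi> \<Longrightarrow> polyfun \<psi> \<Longrightarrow> polyfun (\<lambda>t. \<phi> t * \<psi> t)"
  unfolding polyfun_def by (metis poly_mult)

lemma polyfun_sum: "(\<And>i. i \<in> I \<Longrightarrow> polyfun (\<phi> i)) \<Longrightarrow> polyfun (\<lambda>t. \<Sum>i\<in>I. \<phi> i t)"
  by (induction I rule: infinite_finite_induct) (simp_all add: polyfun_add)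

lemma polyfun_prod: "(\<And>i. i \<in> I \<Longrightarrow> polyfun (\<phi> i)) \<Longrightarrow> polyfun (\<lambda>t. \<Prod>i\<in>I. \<phi> i t)"
  by (induction I rule: infinite_finite_induct) (simp_all add: polyfun_mult)

lemma polyfun_power: "polyfun \<phi> \<Longrightarrow> polyfun (\<lambda>t. \<phi> t ^ k)"
  by (induction k) (simp_all add: polyfun_mult)

lemma polyfun_finite_zeros:
  assumes "polyfun \<psi>" "\<psi> t0 \<noteq> 0" shows "finite {t. \<psi> t = 0}"
proof -
  obtain q where q: "\<And>t. \<psi> t = poly q t" using assms(1) by (auto simp: polyfun_def)
  then have "q \<noteq> 0" using assms(2) by auto
  then show ?thesis unfolding q by (rule poly_roots_finite)
qed

lemma gpoly_along_curve:
  assumes \<phi>: "gpoly n m \<phi>" and L: "\<And>z. z \<in> entry_vars n m \<Longrightarrow> polyfun (\<lambda>t. entry (L t) z)"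
  shows "polyfun (\<lambda>t. \<phi> (L t))"
proof -
  obtain p where p: "p \<in> entry_polys n m" "\<And>g. \<phi> g = entry_eval p g" using \<phi> by (auto simp: gpoly_def)
  show ?thesis
    unfolding p(2) entry_eval_def using p(1)
    by (intro polyfun_sum polyfun_mult polyfun_prod polyfun_power polyfun_const L)
      (auto simp: entry_polys_iff)
qed

text \<open>A polynomial function that describes a nonempty principal open set. The point where it does not
  vanish may be singular; \<open>nonzero_gpoly_point_in_GL\<close> moves it into the group.\<close>

definition nonzero_gpoly :: "nat \<Rightarrow> nat \<Rightarrow> ('k::field mat \<times> 'k mat \<Rightarrow> 'k) \<Rightarrow> bool" where
  "nonzero_gpoly n m \<phi> \<longleftrightarrow> gpoly n m \<phi> \<and> (\<exists>g\<in>mat_pairs n m. \<phi> g \<noteq> 0)"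

text \<open>On the line through two points, each of two polynomial functions has finitely many zeros
  if it does not vanish at one of the points.\<close>

lemma nonzero_gpoly_mult:
  fixes \<phi> \<psi> :: "'k::field mat \<times> 'k mat \<Rightarrow> 'k"
  assumes inf: "infinite (UNIV :: 'k set)" and "nonzero_gpoly n m \<phi>" "nonzero_gpoly n m \<psi>"
  shows "nonzero_gpoly n m (\<lambda>g. \<phi> g * \<psi> g)"
proof -
  obtain g1 g2 where g: "g1 \<in> mat_pairs n m" "\<phi> g1 \<noteq> 0" "g2 \<in> mat_pairs n m" "\<psi> g2 \<noteq> 0"
    and gp: "gpoly n m \<phi>" "gpoly n m \<psi>" using assms by (auto simp: nonzero_gpoly_def)
  define L where "L = (\<lambda>t. (mat n n (\<lambda>ij. fst g1 $$ ij + t * (fst g2 $$ ij - fst g1 $$ ij)),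
    mat m m (\<lambda>ij. snd g1 $$ ij + t * (snd g2 $$ ij - snd g1 $$ ij))))"
  have M0: "mat r r (\<lambda>ij. A $$ ij + 0 * (B $$ ij - A $$ ij)) = A" if "A \<in> carrier_mat r r" for r and A B :: "'k mat"
    by (rule eq_matI) (use that in simp_all)
  have M1: "mat r r (\<lambda>ij. A $$ ij + 1 * (B $$ ij - A $$ ij)) = B" if "B \<in> carrier_mat r r" for r and A B :: "'k mat"
    by (rule eq_matI) (use that in simp_all)
  have gc: "fst g1 \<in> carrier_mat n n" "snd g1 \<in> carrier_mat m m" "fst g2 \<in> carrier_mat n n" "snd g2 \<in> carrier_mat m m"
    using g(1,3) by (simp_all add: mem_Times_iff)
  have L0: "L 0 = g1" unfolding L_def M0[OF gc(1)] M0[OF gc(2)] by (rule prod.collapse)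
  have L1: "L 1 = g2" unfolding L_def M1[OF gc(3)] M1[OF gc(4)] by (rule prod.collapse)
  have "polyfun (\<lambda>t. entry (L t) z)" if z: "z \<in> entry_vars n m" for z
  proof (cases z)
    case (Inl ij)
    then have "ij \<in> {..<n} \<times> {..<n}" using z by (auto simp: entry_vars_def)
    then have "entry (L t) z = fst g1 $$ ij + t * (fst g2 $$ ij - fst g1 $$ ij)" for t
      by (cases ij) (simp add: Inl entry_def L_def)
    then show ?thesis by (simp add: polyfun_add polyfun_mult)
  next
    case (Inr ij)
    then have "ij \<in> {..<m} \<times> {..<m}" using z by (auto simp: entry_vars_def)
    then have "entry (L t) z = snd g1 $$ ij + t * (snd g2 $$ ij - snd g1 $$ ij)" for t
      by (cases ij) (simp add: Inr entry_def L_def)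
    then show ?thesis by (simp add: polyfun_add polyfun_mult)
  qed
  then have "polyfun (\<lambda>t. \<phi> (L t))" "polyfun (\<lambda>t. \<psi> (L t))" using gp by (auto intro: gpoly_along_curve)
  then have "finite {t. \<phi> (L t) = 0}" "finite {t. \<psi> (L t) = 0}"
    using polyfun_finite_zeros[of "\<lambda>t. \<phi> (L t)" 0] polyfun_finite_zeros[of "\<lambda>t. \<psi> (L t)" 1] g(2,4)
    by (simp_all add: L0 L1)
  then have "finite ({t. \<phi> (L t) = 0} \<union> {t. \<psi> (L t) = 0})" by simp
  then obtain t where "t \<notin> {t. \<phi> (L t) = 0} \<union> {t. \<psi> (L t) = 0}" using ex_new_if_finite[OF inf] by blast
  then have "\<phi> (L t) * \<psi> (L t) \<noteq> 0" by simp
  moreover have "L t \<in> mat_pairs n m" by (simp add: L_def)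
  ultimately show ?thesis unfolding nonzero_gpoly_def by (intro conjI gpoly_mult[OF gp] bexI[of _ "L t"])
qed

lemma nonzero_gpoly_prod:
  fixes \<phi> :: "'i \<Rightarrow> 'k::field mat \<times> 'k mat \<Rightarrow> 'k"
  assumes inf: "infinite (UNIV :: 'k set)" and "finite I" and "\<And>i. i \<in> I \<Longrightarrow> nonzero_gpoly n m (\<phi> i)"
  shows "nonzero_gpoly n m (\<lambda>g. \<Prod>i\<in>I. \<phi> i g)"
  using assms(2,3)
proof (induction I rule: finite_induct)
  case empty
  have "(1\<^sub>m n, 1\<^sub>m m) \<in> mat_pairs n m" by simp
  then show ?case unfolding nonzero_gpoly_def using gpoly_const[of n m 1] by (auto intro!: bexI)
next
  case (insert i I)
  then show ?case by (simp add: nonzero_gpoly_mult[OF inf])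
qed

lemma GL_iff_det:
  assumes A: "A \<in> carrier_mat n n" shows "A \<in> GL n \<longleftrightarrow> det A \<noteq> (0 :: 'k::field)"
proof
  assume "A \<in> GL n"
  then obtain B where B: "B \<in> GL n" "A * B = 1\<^sub>m n" using GL_inverse by blast
  have "det A * det B = 1" using det_mult[OF A, of B] B by (simp add: GL_def)
  then show "det A \<noteq> 0" by auto
next
  assume "det A \<noteq> 0"
  from det_non_zero_imp_unit[OF A this, of "()"] obtain B where
    "B \<in> carrier_mat n n" "B * A = 1\<^sub>m n" "A * B = 1\<^sub>m n"
    by (auto simp: Units_def ring_mat_def)
  then have "inverts_mat A B" "inverts_mat B A" using A by (simp_all add: inverts_mat_def)
  then show "A \<in> GL n" using A unfolding GL_def invertible_mat_def by auto
qed

text \<open>The product of the two determinants by the formula of Leibniz in terms of \<open>entry\<close>, which makes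
  it a polynomial function on all pairs of matrices, whatever their dimensions.\<close>

definition det_pair :: "nat \<Rightarrow> nat \<Rightarrow> 'k::field mat \<times> 'k mat \<Rightarrow> 'k" where
  "det_pair n m g =
    (\<Sum>p\<in>{p. p permutes {0..<n}}. signof p * (\<Prod>i=0..<n. entry g (Inl (i, p i)))) *
    (\<Sum>p\<in>{p. p permutes {0..<m}}. signof p * (\<Prod>i=0..<m. entry g (Inr (i, p i))))"

lemma det_pair_eq: "g \<in> mat_pairs n m \<Longrightarrow> det_pair n m g = det (fst g) * det (snd g)"
  by (auto simp: det_pair_def det_def' entry_def)

lemma nonzero_gpoly_det_pair: "nonzero_gpoly n m (det_pair n m :: 'k::field mat \<times> 'k mat \<Rightarrow> 'k)"
  unfolding nonzero_gpoly_def
proof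
  have perm: "p i < r" if "p permutes {0..<r}" "i < r" for p and i r :: nat
    using permutes_in_image[OF that(1), of i] that(2) by simp
  show "gpoly n m (det_pair n m :: 'k mat \<times> 'k mat \<Rightarrow> 'k)"
    unfolding det_pair_def[abs_def]
    by (intro gpoly_mult gpoly_sum gpoly_prod gpoly_const gpoly_entry) (auto simp: entry_vars_def perm)
  let ?g = "(1\<^sub>m n, 1\<^sub>m m) :: 'k mat \<times> 'k mat"
  have "?g \<in> mat_pairs n m" by simp
  from det_pair_eq[OF this] have "det_pair n m ?g \<noteq> 0" by simp
  then show "\<exists>g\<in>mat_pairs n m. det_pair n m g \<noteq> (0 :: 'k)" using \<open>?g \<in> mat_pairs n m\<close> by blast
qed

lemma GL_pairs_iff_det_pair: "g \<in> mat_pairs n m \<Longrightarrow> g \<in> GL n \<times> GL m \<longleftrightarrow> det_pair n m g \<noteq> 0"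
  using GL_iff_det[of "fst g" n] GL_iff_det[of "snd g" m] by (auto simp: det_pair_eq mem_Times_iff)

lemma nonzero_gpoly_point_in_GL:
  fixes \<phi> :: "'k::field mat \<times> 'k mat \<Rightarrow> 'k"
  assumes inf: "infinite (UNIV :: 'k set)" and "nonzero_gpoly n m \<phi>"
  shows "\<exists>g\<in>GL n \<times> GL m. \<phi> g \<noteq> 0"
proof -
  obtain g where "g \<in> mat_pairs n m" "\<phi> g * det_pair n m g \<noteq> 0"
    using nonzero_gpoly_mult[OF inf assms(2) nonzero_gpoly_det_pair] unfolding nonzero_gpoly_def by blast
  then show ?thesis using GL_pairs_iff_det_pair by (metis mult_zero_left mult_zero_right)
qed

text \<open>Polynomials whose coefficients are polynomial functions of a pair of matrices. The finite set \<open>W\<close>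
  bounds the supports uniformly, so that products are finite sums over fixed index sets.\<close>

definition gpoly_family :: "nat \<Rightarrow> nat \<Rightarrow> ('k::field mat \<times> 'k mat \<Rightarrow> 'k bipoly) \<Rightarrow> bool" where
  "gpoly_family n m \<Phi> \<longleftrightarrow> (\<exists>W. finite W \<and> (\<forall>g. keys (\<Phi> g) \<subseteq> W)) \<and> (\<forall>w. gpoly n m (\<lambda>g. lookup (\<Phi> g) w))"

lemma gpoly_family_const: "gpoly_family n m (\<lambda>_. f)"
  unfolding gpoly_family_def using finite_keys gpoly_const by blast

lemma gpoly_family_bconst:
  assumes "gpoly n m \<phi>" shows "gpoly_family n m (\<lambda>g. bconst (\<phi> g))"
  unfolding gpoly_family_def
proof (intro conjI allI)
  show "\<exists>W. finite W \<and> (\<forall>g. keys (bconst (\<phi> g)) \<subseteq> W)"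
    by (rule exI[of _ "{0}"]) (simp add: bconst_def)
  show "gpoly n m (\<lambda>g. lookup (bconst (\<phi> g)) w)" for w
    by (cases "w = 0") (simp_all add: bconst_def lookup_single assms gpoly_const)
qed

lemma gpoly_family_add:
  assumes "gpoly_family n m \<Phi>" "gpoly_family n m \<Psi>" shows "gpoly_family n m (\<lambda>g. \<Phi> g + \<Psi> g)"
proof -
  obtain W W' where W: "finite W" "\<And>g. keys (\<Phi> g) \<subseteq> W" "finite W'" "\<And>g. keys (\<Psi> g) \<subseteq> W'"
    using assms by (auto simp: gpoly_family_def)
  have "keys (\<Phi> g + \<Psi> g) \<subseteq> W \<union> W'" for g
    using W(2,4)[of g] Poly_Mapping.keys_add[of "\<Phi> g" "\<Psi> g"] by blast
  moreover have "gpoly n m (\<lambda>g. lookup (\<Phi> g + \<Psi> g) w)" for w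
    using assms by (simp add: lookup_add gpoly_family_def gpoly_add)
  moreover have "finite (W \<union> W')" using W by simp
  ultimately show ?thesis unfolding gpoly_family_def by (intro conjI exI[of _ "W \<union> W'"] allI)
qed

lemma gpoly_family_mult:
  assumes "gpoly_family n m \<Phi>" "gpoly_family n m \<Psi>" shows "gpoly_family n m (\<lambda>g. \<Phi> g * \<Psi> g)"
proof -
  obtain W W' where W: "finite W" "\<And>g. keys (\<Phi> g) \<subseteq> W" "finite W'" "\<And>g. keys (\<Psi> g) \<subseteq> W'"
    using assms by (auto simp: gpoly_family_def)
  have prod: "\<Phi> g * \<Psi> g = (\<Sum>u\<in>W. \<Sum>v\<in>W'. Poly_Mapping.single (u + v) (lookup (\<Phi> g) u * lookup (\<Psi> g) v))" for g
  proof -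
    have "\<Phi> g * \<Psi> g = (\<Sum>u\<in>W. Poly_Mapping.single u (lookup (\<Phi> g) u)) * (\<Sum>v\<in>W'. Poly_Mapping.single v (lookup (\<Psi> g) v))"
      by (rule arg_cong2[of _ _ _ _ "(*)", OF poly_mapping_expand[OF W(1,2)] poly_mapping_expand[OF W(3,4)]])
    then show ?thesis by (simp add: sum_product mult_single)
  qed
  have "keys (\<Phi> g * \<Psi> g) \<subseteq> (\<lambda>(u, v). u + v) ` (W \<times> W')" for g
  proof
    fix w assume "w \<in> keys (\<Phi> g * \<Psi> g)"
    then obtain u v where "u \<in> keys (\<Phi> g)" "v \<in> keys (\<Psi> g)" "w = u + v"
      using keys_mult[of "\<Phi> g" "\<Psi> g"] by blast
    then show "w \<in> (\<lambda>(u, v). u + v) ` (W \<times> W')" using W(2,4)[of g] by (intro image_eqI[of _ _ "(u, v)"]) auto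
  qed
  moreover have "gpoly n m (\<lambda>g. lookup (\<Phi> g * \<Psi> g) w)" for w
  proof -
    have "lookup (\<Phi> g * \<Psi> g) w
        = (\<Sum>u\<in>W. \<Sum>v\<in>W'. (if u + v = w then 1 else 0) * (lookup (\<Phi> g) u * lookup (\<Psi> g) v))" for g
      unfolding prod lookup_sum by (intro sum.cong refl) (simp add: lookup_single when_def)
    then show ?thesis
      using assms by (simp only:) (intro gpoly_sum gpoly_mult gpoly_const, auto simp: gpoly_family_def)
  qed
  moreover have "finite ((\<lambda>(u, v). u + v) ` (W \<times> W'))" using W by simp
  ultimately show ?thesis
    unfolding gpoly_family_def by (intro conjI exI[of _ "(\<lambda>(u, v). u + v) ` (W \<times> W')"] allI)
qed

lemma gpoly_family_sum: "(\<And>i. i \<in> I \<Longrightarrow> gpoly_family n m (\<Phi> i)) \<Longrightarrow> gpoly_family n m (\<lambda>g. \<Sum>i\<in>I. \<Phi> i g)"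
  by (induction I rule: infinite_finite_induct) (simp_all add: gpoly_family_const gpoly_family_add)

lemma gpoly_family_prod: "(\<And>i. i \<in> I \<Longrightarrow> gpoly_family n m (\<Phi> i)) \<Longrightarrow> gpoly_family n m (\<lambda>g. \<Prod>i\<in>I. \<Phi> i g)"
  by (induction I rule: infinite_finite_induct) (simp_all add: gpoly_family_const gpoly_family_mult)

lemma gpoly_family_power: "gpoly_family n m \<Phi> \<Longrightarrow> gpoly_family n m (\<lambda>g. \<Phi> g ^ k)"
  by (induction k) (simp_all add: gpoly_family_const gpoly_family_mult)

lemma gpoly_family_act:
  fixes f :: "'k::field bipoly"
  assumes f: "f \<in> poly_carrier n m" shows "gpoly_family n m (\<lambda>g. act n m g f)"
proof -
  have x: "gpoly_family n m (\<lambda>g :: 'k mat \<times> 'k mat. x_image n (fst g) j)" if "j < n" for j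
    unfolding x_image_def
  proof (intro gpoly_family_sum gpoly_family_mult gpoly_family_const gpoly_family_bconst)
    fix i assume "i \<in> {..<n}"
    then have "Inl (i, j) \<in> entry_vars n m" using that by (simp add: entry_vars_def InlI)
    from gpoly_entry[OF this] show "gpoly n m (\<lambda>g :: 'k mat \<times> 'k mat. fst g $$ (i, j))" by (simp add: entry_def)
  qed
  have y: "gpoly_family n m (\<lambda>g :: 'k mat \<times> 'k mat. y_image m (snd g) j)" if "j < m" for j
    unfolding y_image_def
  proof (intro gpoly_family_sum gpoly_family_mult gpoly_family_const gpoly_family_bconst)
    fix i assume "i \<in> {..<m}"
    then have "Inr (i, j) \<in> entry_vars n m" using that by (simp add: entry_vars_def InrI)
    from gpoly_entry[OF this] show "gpoly n m (\<lambda>g :: 'k mat \<times> 'k mat. snd g $$ (i, j))" by (simp add: entry_def)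
  qed
  have "gpoly_family n m (\<lambda>g :: 'k mat \<times> 'k mat. mon_image n m g w)" if w: "w \<in> mons n m" for w
    unfolding mon_image_def mon_prod_def
  proof (intro gpoly_family_mult gpoly_family_prod gpoly_family_power x y)
    show "i \<in> keys (fst w) \<Longrightarrow> i < n" "i \<in> keys (snd w) \<Longrightarrow> i < m" for i
      using w unfolding mons_def by blast+
  qed
  then show ?thesis
    unfolding act_eq_lin_ext lin_ext_def using f
    by (intro gpoly_family_sum gpoly_family_mult gpoly_family_const) (auto simp: poly_carrier_iff)
qed

section \<open>Generic leading monomials\<close>

interpretation vs: vector_space "\<lambda>c (f :: 'k::field bipoly). bconst c * f"
  by unfold_locales (simp_all add: algebra_simps bc.hom_add bc.hom_mult bc.hom_one)

lemma span_lookup_zero: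
  assumes "f \<in> vs.span S" "\<And>s. s \<in> S \<Longrightarrow> lookup s w = 0"
  shows "lookup f w = 0"
  using assms(1)
proof (induction rule: vs.span_induct_alt)
  case (step c x y)
  then show ?case using assms(2)[of x] by (simp add: lookup_add lookup_bconst_mult)
qed simp

text \<open>The largest leading monomial among the terms with nonzero coefficients cannot cancel.\<close>

lemma independent_if_inj_leads:
  assumes nz: "0 \<notin> B" and inj: "inj_on lead_mon B"
  shows "vs.independent B"
  unfolding vs.independent_explicit_finite_subsets
proof (intro allI impI ballI)
  fix T u v
  assume T: "T \<subseteq> B" "finite T" and sum0: "(\<Sum>v\<in>T. bconst (u v) * v) = 0" and v: "v \<in> T"
  show "u v = 0"
  proof (rule ccontr)
    assume "u v \<noteq> 0"
    define T' where "T' = {v \<in> T. u v \<noteq> 0}"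
    have "finite (lead_mon ` T')" "lead_mon ` T' \<noteq> {}"
      using T(2) v \<open>u v \<noteq> 0\<close> by (auto simp: T'_def)
    then obtain w where w: "w \<in> lead_mon ` T'" "\<forall>w'\<in>lead_mon ` T'. w' \<noteq> w \<longrightarrow> mon_greater w w'"
      using finite_has_greatest_mon by meson
    then obtain f where f: "f \<in> T'" "w = lead_mon f" by blast
    have fT: "f \<in> T" "u f \<noteq> 0" using f(1) by (simp_all add: T'_def)
    have "lookup (bconst (u v) * v) w = (if v = f then u f * lookup f w else 0)" if v: "v \<in> T" for v
    proof (cases "v = f \<or> u v = 0")
      case True
      then show ?thesis using fT by (auto simp: lookup_bconst_mult)
    next
      case False
      then have "v \<in> T'" "v \<noteq> f" using v by (simp_all add: T'_def)
      moreover have "lead_mon v \<noteq> w" using inj_onD[OF inj, of v f] \<open>v \<noteq> f\<close> v fT(1) T(1) f(2) by blast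
      ultimately have "mon_greater w (lead_mon v)" using w(2) by blast
      from lookup_above_lead_mon[OF this] show ?thesis using \<open>v \<noteq> f\<close> by (simp add: lookup_bconst_mult)
    qed
    then have "lookup (\<Sum>v\<in>T. bconst (u v) * v) w = (\<Sum>v\<in>T. if v = f then u f * lookup f w else 0)"
      unfolding lookup_sum by (intro sum.cong refl)
    also have "\<dots> = u f * lookup f w" using T(2) fT(1) by simp
    finally have "u f * lookup f w = 0" using sum0 by simp
    moreover have "f \<noteq> 0" using fT(1) T(1) nz by blast
    ultimately show False using fT(2) lookup_lead_mon[of f] f(2) by simp
  qed
qed

text \<open>Fraction-free elimination: the pivot \<open>q\<close> is a coefficient at the largest monomial that occurs in
  some member of the family for some pair of matrices. Where \<open>q\<close> does not vanish, this monomial is a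
  leading monomial of the span, and the others are those of the family cleared at it.\<close>

lemma generic_lead_set:
  fixes Fs :: "('k::field mat \<times> 'k mat \<Rightarrow> 'k bipoly) set"
  assumes inf: "infinite (UNIV :: 'k set)" and W: "finite W" and "finite Fs"
    and "\<And>F. F \<in> Fs \<Longrightarrow> (\<forall>g. keys (F g) \<subseteq> W) \<and> (\<forall>w. gpoly n m (\<lambda>g. lookup (F g) w))"
  shows "\<exists>p L. nonzero_gpoly n m p \<and> (\<forall>g\<in>mat_pairs n m. p g \<noteq> 0 \<longrightarrow> lead_set (vs.span ((\<lambda>F. F g) ` Fs)) = L)"
  using assms(3,4)
proof (induction "card Fs" arbitrary: Fs rule: less_induct)
  case less
  have kW: "keys (F g) \<subseteq> W" and gp: "gpoly n m (\<lambda>g. lookup (F g) w)" if "F \<in> Fs" for F g w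
    using less.prems(2)[OF that] by simp_all
  define N where "N = {w \<in> W. \<exists>F\<in>Fs. \<exists>g\<in>mat_pairs n m. lookup (F g) w \<noteq> 0}"
  have finN: "finite N" using W by (simp add: N_def)
  have outside: "lookup (F g) w = 0" if "F \<in> Fs" "g \<in> mat_pairs n m" "w \<notin> N" for F g w
  proof (rule ccontr)
    assume ne: "lookup (F g) w \<noteq> 0"
    then have "w \<in> keys (F g)" by (simp add: in_keys_iff)
    then have "w \<in> W" using kW[OF that(1)] by blast
    then have "w \<in> N" using that(1,2) ne unfolding N_def by blast
    then show False using that(3) by blast
  qed
  show ?case
  proof (cases "N = {}")
    case True
    have "lead_set (vs.span ((\<lambda>F. F g) ` Fs)) = {}" if g: "g \<in> mat_pairs n m" for g
    proof -
      have "f = 0" if "f \<in> vs.span ((\<lambda>F. F g) ` Fs)" for f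
      proof (rule poly_mapping_eqI)
        fix w
        have "lookup f w = 0"
        proof (rule span_lookup_zero[OF that])
          fix s assume "s \<in> (\<lambda>F. F g) ` Fs"
          then obtain F where "F \<in> Fs" "s = F g" by blast
          then show "lookup s w = 0" using outside[of F g w] g True by simp
        qed
        then show "lookup f w = lookup 0 w" by simp
      qed
      then show ?thesis unfolding lead_set_def by blast
    qed
    moreover have "nonzero_gpoly n m (\<lambda>_. 1 :: 'k)" using nonzero_gpoly_prod[OF inf, of "{}" n m "\<lambda>_ _. 1"] by simp
    ultimately show ?thesis by blast
  next
    case False
    obtain w where w: "w \<in> N" "\<forall>w'\<in>N. w' \<noteq> w \<longrightarrow> mon_greater w w'"
      using finite_has_greatest_mon[OF finN False] by blast
    then obtain F g0 where F: "F \<in> Fs" "g0 \<in> mat_pairs n m" "lookup (F g0) w \<noteq> 0" unfolding N_def by blast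
    have above: "v \<notin> N" if "mon_greater v w" for v
      using w(2) that mon_greater_asym[of v w] mon_greater_irrefl[of v] by metis
    define q where "q = (\<lambda>g. lookup (F g) w)"
    have q: "nonzero_gpoly n m q" using F less.prems(2)[OF F(1)] unfolding nonzero_gpoly_def q_def by blast
    define el where "el = (\<lambda>F' g. bconst (q g) * F' g + bconst (- lookup (F' g) w) * F g)"
    let ?Fs = "el ` (Fs - {F})"
    have "card ?Fs \<le> card (Fs - {F})" using less.prems(1) by (intro card_image_le) simp
    also have "\<dots> < card Fs" using less.prems(1) F(1) by (rule card_Diff1_less)
    finally have cardlt: "card ?Fs < card Fs" .
    have elprop: "(\<forall>g. keys (G g) \<subseteq> W) \<and> (\<forall>w. gpoly n m (\<lambda>g. lookup (G g) w))" if G: "G \<in> ?Fs" for G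
    proof -
      obtain F' where F': "F' \<in> Fs" "G = el F'" using G by blast
      have lG: "lookup (G g) v = q g * lookup (F' g) v + (- 1 * lookup (F' g) w) * lookup (F g) v" for g v
        by (simp add: F'(2) el_def lookup_add lookup_minus lookup_bconst_mult)
      have "keys (G g) \<subseteq> W" for g
      proof
        fix v assume "v \<in> keys (G g)"
        then have "lookup (F' g) v \<noteq> 0 \<or> lookup (F g) v \<noteq> 0" unfolding in_keys_iff lG by auto
        then have "v \<in> keys (F' g) \<or> v \<in> keys (F g)" by (simp add: in_keys_iff)
        then show "v \<in> W" using kW[OF F(1), of g] kW[OF F'(1), of g] by blast
      qed
      moreover have "gpoly n m (\<lambda>g. lookup (G g) v)" for v
        unfolding lG q_def by (intro gpoly_add gpoly_mult gpoly_const gp F(1) F'(1))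
      ultimately show ?thesis by blast
    qed
    have "finite ?Fs" using less.prems(1) by simp
    from less.hyps[OF cardlt this elprop, simplified simp_thms] have
      "\<exists>p L. nonzero_gpoly n m p \<and> (\<forall>g\<in>mat_pairs n m. p g \<noteq> 0 \<longrightarrow> lead_set (vs.span ((\<lambda>F. F g) ` ?Fs)) = L)" by blast
    then obtain p' L' where p'0: "nonzero_gpoly n m p'"
      "\<forall>g\<in>mat_pairs n m. p' g \<noteq> 0 \<longrightarrow> lead_set (vs.span ((\<lambda>F. F g) ` ?Fs)) = L'" by (elim exE conjE)
    note p' = p'0(1) p'0(2)[rule_format]
    have "lead_set (vs.span ((\<lambda>F. F g) ` Fs)) = insert w L'"
      if g: "g \<in> mat_pairs n m" and pg: "q g * p' g \<noteq> 0" for g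
    proof -
      have qg: "q g \<noteq> 0" and L': "lead_set (vs.span ((\<lambda>F. F g) ` ?Fs)) = L'"
        using pg p'(2)[OF g] by auto
      let ?S = "(\<lambda>F. F g) ` Fs" and ?S' = "(\<lambda>F. F g) ` ?Fs"
      have FS: "F g \<in> vs.span ?S" using F(1) by (intro vs.span_base) blast
      have S'S: "vs.span ?S' \<subseteq> vs.span ?S"
      proof (rule vs.span_minimal[OF _ vs.subspace_span])
        show "?S' \<subseteq> vs.span ?S"
        proof
          fix f assume "f \<in> ?S'"
          then obtain F' where F': "F' \<in> Fs" "f = el F' g" by blast
          have "F' g \<in> vs.span ?S" using F'(1) by (intro vs.span_base) blast
          then show "f \<in> vs.span ?S" unfolding F'(2) el_def by (intro vs.span_add vs.span_scale FS)
        qed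
      qed
      have "?S \<subseteq> vs.span (insert (F g) ?S')"
      proof
        fix f assume "f \<in> ?S"
        then obtain F' where F': "F' \<in> Fs" "f = F' g" by blast
        show "f \<in> vs.span (insert (F g) ?S')"
        proof (cases "F' = F")
          case True
          then show ?thesis using F'(2) by (intro vs.span_base) simp
        next
          case False
          have "bconst (inverse (q g)) * (el F' g + bconst (lookup (F' g) w) * F g) \<in> vs.span (insert (F g) ?S')"
            using F' False by (intro vs.span_scale vs.span_add) (auto intro: vs.span_base)
          moreover have "bconst (inverse (q g)) * (el F' g + bconst (lookup (F' g) w) * F g) = f"
            by (rule poly_mapping_eqI) (simp add: el_def lookup_add lookup_minus lookup_bconst_mult F'(2) qg)
          ultimately show ?thesis by simp
        qed
      qed
      then have span_sub: "vs.span ?S \<subseteq> vs.span (insert (F g) ?S')"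
        by (rule vs.span_minimal[OF _ vs.subspace_span])
      have S'0: "lookup f v = 0" if f: "f \<in> vs.span ?S'" and v: "v = w \<or> mon_greater v w" for f v
      proof (rule span_lookup_zero[OF f])
        fix s assume "s \<in> ?S'"
        then obtain F' where F': "F' \<in> Fs" "s = el F' g" by blast
        show "lookup s v = 0"
        proof (cases "v = w")
          case True
          then show ?thesis by (simp add: F'(2) el_def lookup_add lookup_minus lookup_bconst_mult q_def)
        next
          case False
          then have "v \<notin> N" using v above by blast
          then show ?thesis
            using outside[OF F'(1) g] outside[OF F(1) g] by (simp add: F'(2) el_def lookup_add lookup_minus lookup_bconst_mult)
        qed
      qed
      have leadF: "lead_mon (bconst k * F g + y) = w" if y: "y \<in> vs.span ?S'" and k: "k \<noteq> 0" for k y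
      proof (rule lead_mon_eqI)
        show "lookup (bconst k * F g + y) w \<noteq> 0"
          using S'0[OF y, of w] k qg by (simp add: lookup_add lookup_bconst_mult q_def)
        fix v assume v: "mon_greater v w"
        then show "lookup (bconst k * F g + y) v = 0"
          using S'0[OF y, of v] outside[OF F(1) g above[OF v]] by (simp add: lookup_add lookup_bconst_mult)
      qed
      show ?thesis
      proof
        show "lead_set (vs.span ?S) \<subseteq> insert w L'"
        proof
          fix v assume "v \<in> lead_set (vs.span ?S)"
          then obtain f where f: "f \<in> vs.span ?S" "f \<noteq> 0" "lead_mon f = v" by (rule lead_setE)
          then obtain k where k: "f - bconst k * F g \<in> vs.span ?S'" using span_sub vs.span_insert by blast
          show "v \<in> insert w L'"
          proof (cases "k = 0")
            case True
            then have "f \<in> vs.span ?S'" using k by (simp add: bc.hom_zero)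
            then show ?thesis using lead_setI[OF _ f(2)] f(3) L' by blast
          next
            case False
            from leadF[OF k this] show ?thesis using f(3) by simp
          qed
        qed
        have "F g \<noteq> 0" using qg by (auto simp: q_def)
        moreover have "lead_mon (F g) = w" using leadF[OF vs.span_zero, of 1] by (simp add: bc.hom_one)
        ultimately have "w \<in> lead_set (vs.span ?S)" using lead_setI[OF FS] by metis
        moreover have "L' \<subseteq> lead_set (vs.span ?S)" using lead_set_mono[OF S'S] L' by blast
        ultimately show "insert w L' \<subseteq> lead_set (vs.span ?S)" by blast
      qed
    qed
    then show ?thesis using nonzero_gpoly_mult[OF inf q p'(1)] by blast
  qed
qed

lemma card_lead_set_span_le:
  assumes S: "finite S"
  shows "finite (lead_set (vs.span S)) \<and> card (lead_set (vs.span S)) \<le> card S"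
proof -
  define b where "b = (\<lambda>w. SOME f. f \<in> vs.span S \<and> f \<noteq> 0 \<and> lead_mon f = w)"
  have b: "b w \<in> vs.span S" "b w \<noteq> 0" "lead_mon (b w) = w" if w_in: "w \<in> lead_set (vs.span S)" for w
  proof -
    obtain f where "f \<in> vs.span S" "f \<noteq> 0" "lead_mon f = w" using w_in by (rule lead_setE)
    then have "\<exists>f. f \<in> vs.span S \<and> f \<noteq> 0 \<and> lead_mon f = w" by blast
    from someI_ex[OF this] show "b w \<in> vs.span S" "b w \<noteq> 0" "lead_mon (b w) = w"
      unfolding b_def by blast+
  qed
  let ?B = "b ` lead_set (vs.span S)"
  have "0 \<notin> ?B"
  proof
    assume "0 \<in> ?B"
    then obtain w where "w \<in> lead_set (vs.span S)" "0 = b w" by blast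
    then show False using b(2)[of w] by simp
  qed
  moreover have "inj_on lead_mon ?B"
    by (rule inj_on_inverseI[of _ b]) (use b(3) in force)
  ultimately have "vs.independent ?B" by (rule independent_if_inj_leads)
  moreover have "?B \<subseteq> vs.span S" using b(1) by blast
  ultimately have "finite ?B \<and> card ?B \<le> card S" using vs.independent_span_bound[OF S] by blast
  moreover have inj: "inj_on b (lead_set (vs.span S))" using b(3) by (rule inj_on_inverseI)
  ultimately show ?thesis using finite_image_iff[OF inj] card_image[OF inj] by simp
qed

lemma spanning_set_of_leads:
  fixes V :: "'k::field bipoly set"
  assumes V: "vs.subspace V" and W: "finite W" "\<And>f. f \<in> V \<Longrightarrow> keys f \<subseteq> W"
  shows "\<exists>S. finite S \<and> V = vs.span S \<and> card S = card (lead_set V)"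
proof -
  define b where "b = (\<lambda>w. SOME f. f \<in> V \<and> f \<noteq> 0 \<and> lead_mon f = w)"
  have b: "b w \<in> V" "b w \<noteq> 0" "lead_mon (b w) = w" if w_in: "w \<in> lead_set V" for w
  proof -
    obtain f where "f \<in> V" "f \<noteq> 0" "lead_mon f = w" using w_in by (rule lead_setE)
    then have "\<exists>f. f \<in> V \<and> f \<noteq> 0 \<and> lead_mon f = w" by blast
    from someI_ex[OF this] show "b w \<in> V" "b w \<noteq> 0" "lead_mon (b w) = w"
      unfolding b_def by blast+
  qed
  let ?S = "b ` lead_set V"
  have sub: "vs.span ?S \<subseteq> V" using b(1) by (intro vs.span_minimal V) blast
  have "lead_set V \<subseteq> W"
  proof
    fix w assume "w \<in> lead_set V"
    then obtain f where "f \<in> V" "f \<noteq> 0" "lead_mon f = w" by (rule lead_setE)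
    then show "w \<in> W" using W(2) lead_mon_in_keys by blast
  qed
  then have fin: "finite (lead_set V)" using W(1) finite_subset by blast
  have "V \<subseteq> vs.span ?S"
  proof (rule subspace_eq_if_same_leads[OF W(1) W(2)])
    show "f + bconst c * g \<in> vs.span ?S" if "f \<in> vs.span ?S" "g \<in> vs.span ?S" for f g c
      using that by (intro vs.span_add vs.span_scale)
    show "f - bconst c * g \<in> V" if "f \<in> V" "g \<in> vs.span ?S" for f g c
      using that sub V by (intro vs.subspace_diff vs.subspace_scale) auto
    show "lead_set V \<subseteq> lead_set (vs.span ?S)"
    proof
      fix w assume w: "w \<in> lead_set V"
      have "b w \<in> vs.span ?S" using w by (intro vs.span_base imageI)
      from lead_setI[OF this b(2)[OF w]] show "w \<in> lead_set (vs.span ?S)" unfolding b(3)[OF w] .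
    qed
  qed (auto intro: vs.span_zero)
  moreover have "inj_on b (lead_set V)" using b(3) by (rule inj_on_inverseI)
  ultimately show ?thesis using sub fin card_image by (intro exI[of _ ?S]) auto
qed

section \<open>The bigeneric initial ideal\<close>

lemma subspace_bihom_part:
  assumes J: "poly_ideal n m J" shows "vs.subspace (J \<inter> bihom n m c)"
proof (rule vs.subspaceI)
  show "0 \<in> J \<inter> bihom n m c" using poly_idealD(2)[OF J] by simp
  show "f + g \<in> J \<inter> bihom n m c" if "f \<in> J \<inter> bihom n m c" "g \<in> J \<inter> bihom n m c" for f g
    using that poly_idealD(3)[OF J, of f g] bihom_add[of f n m c g] by simp
  show "bconst a * f \<in> J \<inter> bihom n m c" if "f \<in> J \<inter> bihom n m c" for f a
    using that poly_idealD(4)[OF J _ poly_carrier_bconst, of f a] bihom_scale[of f n m c a] by simp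
qed

lemma lead_set_bihom_part:
  assumes J: "bigraded n m J"
  shows "lead_set (J \<inter> bihom n m c) = lead_set J \<inter> hmons n m c"
proof
  show "lead_set (J \<inter> bihom n m c) \<subseteq> lead_set J \<inter> hmons n m c"
  proof
    fix w assume "w \<in> lead_set (J \<inter> bihom n m c)"
    then obtain f where f: "f \<in> J \<inter> bihom n m c" "f \<noteq> 0" "lead_mon f = w" by (rule lead_setE)
    then have "keys f \<subseteq> hmons n m c" by (simp add: bihom_iff)
    then show "w \<in> lead_set J \<inter> hmons n m c"
      using lead_setI[of f J] f lead_mon_in_keys[OF f(2)] by blast
  qed
  show "lead_set J \<inter> hmons n m c \<subseteq> lead_set (J \<inter> bihom n m c)"
  proof
    fix w assume w: "w \<in> lead_set J \<inter> hmons n m c"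
    then have "bideg w = c" by (simp add: hmons_def)
    moreover obtain f where "f \<in> J" "f \<in> bihom n m (bideg w)" "f \<noteq> 0" "lead_mon f = w"
      using lead_set_homogeneous[OF J, of w] w by blast
    ultimately show "w \<in> lead_set (J \<inter> bihom n m c)" using lead_setI[of f "J \<inter> bihom n m c"] by simp
  qed
qed

lemma act_bihom_part:
  assumes J: "bigraded n m J"
  shows "act n m g ` (J \<inter> bihom n m c) = act n m g ` J \<inter> bihom n m c"
proof
  show "act n m g ` (J \<inter> bihom n m c) \<subseteq> act n m g ` J \<inter> bihom n m c" using act_bihom by blast
  show "act n m g ` J \<inter> bihom n m c \<subseteq> act n m g ` (J \<inter> bihom n m c)"
  proof
    fix f assume f: "f \<in> act n m g ` J \<inter> bihom n m c"
    then obtain j where j: "j \<in> J" "f = act n m g j" by blast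
    have "f = hcomp c f" using f hcomp_id[of f n m c] by simp
    then have "f = act n m g (hcomp c j)" by (simp add: j(2) hcomp_act)
    moreover have "hcomp c j \<in> J \<inter> bihom n m c"
      using bigradedD(2)[OF J j(1)] hcomp_bihom[OF poly_idealD(1)[OF bigradedD(1)[OF J] j(1)]] by blast
    ultimately show "f \<in> act n m g ` (J \<inter> bihom n m c)" by (rule image_eqI)
  qed
qed

lemma act_span: "act n m g ` vs.span S = vs.span (act n m g ` S)"
proof -
  interpret L: Vector_Spaces.linear "\<lambda>c f. bconst c * f" "\<lambda>c f. bconst c * f" "act n m g"
    by unfold_locales (simp_all add: act_add act_mult act_bconst)
  show ?thesis by (rule L.span_image[symmetric])
qed

text \<open>Counting leading monomials means taking dimensions, and the action is invertible.\<close>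

lemma card_lead_set_act:
  fixes J :: "'k::field bipoly set"
  assumes J: "bigraded n m J" and g: "g \<in> GL n \<times> GL m"
  shows "card (lead_set (act n m g ` J \<inter> bihom n m c)) = card (lead_set (J \<inter> bihom n m c))"
proof -
  have le: "card (lead_set (act n m g ` J \<inter> bihom n m c)) \<le> card (lead_set (J \<inter> bihom n m c))"
    if J: "bigraded n m J" for J :: "'k bipoly set" and g
  proof -
    obtain S where S: "finite S" "J \<inter> bihom n m c = vs.span S" "card S = card (lead_set (J \<inter> bihom n m c))"
      using spanning_set_of_leads[OF subspace_bihom_part[OF bigradedD(1)[OF J]] finite_hmons[of n m c], of c]
      by (auto simp: bihom_iff)
    have "act n m g ` J \<inter> bihom n m c = vs.span (act n m g ` S)"
      by (simp only: act_bihom_part[OF J, symmetric] S(2) act_span)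
    then have "card (lead_set (act n m g ` J \<inter> bihom n m c)) \<le> card (act n m g ` S)"
      using card_lead_set_span_le[of "act n m g ` S"] S(1) by simp
    also have "\<dots> \<le> card S" using S(1) by (rule card_image_le)
    finally show ?thesis using S(3) by simp
  qed
  obtain h where h: "\<And>f. f \<in> poly_carrier n m \<Longrightarrow> act n m h (act n m g f) = f"
    using act_inverse[OF g] by blast
  have "act n m h ` (act n m g ` J) = J"
    using h poly_idealD(1)[OF bigradedD(1)[OF J]] by (force simp: image_image)
  then show ?thesis using le[OF J, of g] le[OF bigraded_act[OF J g], of h] by simp
qed

lemma zariski_open_iff_ex:
  "zariski_open n m U \<longleftrightarrow> (\<exists>P\<subseteq>entry_polys n m. U = {g \<in> GL n \<times> GL m. \<exists>p\<in>P. entry_eval p g \<noteq> 0})"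
proof -
  have "GL n \<times> GL m - {g. \<forall>p\<in>P. entry_eval p g = 0} = {g \<in> GL n \<times> GL m. \<exists>p\<in>P. entry_eval p g \<noteq> 0}" for P :: "'a entry_poly set"
    by blast
  then show ?thesis unfolding zariski_open_def by simp
qed

lemma zariski_open_nonzero_gpoly:
  fixes U :: "('k::field mat \<times> 'k mat) set"
  assumes "zariski_open n m U" "U \<noteq> {}"
  shows "\<exists>\<phi>. nonzero_gpoly n m \<phi> \<and> (\<forall>g\<in>GL n \<times> GL m. \<phi> g \<noteq> 0 \<longrightarrow> g \<in> U)"
proof -
  obtain P where P: "P \<subseteq> entry_polys n m" "U = {g \<in> GL n \<times> GL m. \<exists>p\<in>P. entry_eval p g \<noteq> 0}"
    using assms(1) unfolding zariski_open_iff_ex by blast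
  then obtain g p where g: "g \<in> GL n \<times> GL m" "p \<in> P" "entry_eval p g \<noteq> 0" using assms(2) by blast
  have "gpoly n m (entry_eval p)" unfolding gpoly_def using P(1) g(2) by blast
  then have "nonzero_gpoly n m (entry_eval p)" unfolding nonzero_gpoly_def using g(3) GL_pairs_mat_pairs[OF g(1)] by blast
  then show ?thesis using P(2) g(2) by blast
qed

lemma nonzero_gpoly_zariski_open:
  fixes \<phi> :: "'k::field mat \<times> 'k mat \<Rightarrow> 'k"
  assumes inf: "infinite (UNIV :: 'k set)" and \<phi>: "nonzero_gpoly n m \<phi>"
  shows "zariski_open n m {g \<in> GL n \<times> GL m. \<phi> g \<noteq> 0} \<and> {g \<in> GL n \<times> GL m. \<phi> g \<noteq> 0} \<noteq> {}"
proof
  obtain p where "p \<in> entry_polys n m" "\<And>g. \<phi> g = entry_eval p g" using \<phi> by (auto simp: nonzero_gpoly_def gpoly_def)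
  then show "zariski_open n m {g \<in> GL n \<times> GL m. \<phi> g \<noteq> 0}"
    unfolding zariski_open_iff_ex by (intro exI[of _ "{p}"]) simp
  show "{g \<in> GL n \<times> GL m. \<phi> g \<noteq> 0} \<noteq> {}" using nonzero_gpoly_point_in_GL[OF inf \<phi>] by blast
qed

text \<open>In each bidegree the leading monomials are constant on a nonempty open set, but there are
  infinitely many bidegrees. Dickson's lemma leaves finitely many of them in which the generic
  leading monomials generate all of \<open>L\<close>. For a pair of matrices generic in these bidegrees, \<open>L\<close> is
  contained in the leading monomials, and as the dimensions agree in every bidegree, both are equal.\<close>

theorem generic_leads_exist:
  fixes J :: "'k::field bipoly set"
  assumes inf: "infinite (UNIV :: 'k set)" and J: "bigraded n m J"
  shows "\<exists>\<phi> L. nonzero_gpoly n m \<phi> \<and> (\<forall>g\<in>GL n \<times> GL m. \<phi> g \<noteq> 0 \<longrightarrow> lead_set (act n m g ` J) = L)"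
proof -
  note pJ = bigradedD(1)[OF J]
  have ex: "\<exists>\<phi> L. nonzero_gpoly n m \<phi> \<and> (\<forall>g\<in>GL n \<times> GL m. \<phi> g \<noteq> 0 \<longrightarrow> lead_set (act n m g ` J \<inter> bihom n m c) = L)" for c
  proof -
    obtain S where S: "finite S" "J \<inter> bihom n m c = vs.span S"
      using spanning_set_of_leads[OF subspace_bihom_part[OF pJ] finite_hmons[of n m c], of c]
      by (auto simp: bihom_iff)
    have SJ: "f \<in> bihom n m c" if "f \<in> S" for f using S(2) vs.span_base[OF that] by blast
    let ?Fs = "(\<lambda>f g. act n m g f) ` S"
    have "\<exists>\<phi> L. nonzero_gpoly n m \<phi> \<and> (\<forall>g\<in>mat_pairs n m. \<phi> g \<noteq> 0 \<longrightarrow> lead_set (vs.span ((\<lambda>F. F g) ` ?Fs)) = L)"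
    proof (rule generic_lead_set[OF inf finite_hmons[of n m c]])
      fix F assume "F \<in> ?Fs"
      then obtain f where f: "f \<in> S" "F = (\<lambda>g. act n m g f)" by blast
      have "keys (F g) \<subseteq> hmons n m c" for g using act_bihom[OF SJ[OF f(1)], of g] by (simp add: f(2) bihom_iff)
      moreover have "gpoly n m (\<lambda>g. lookup (F g) w)" for w
        using gpoly_family_act[OF bihom_carrier[OF SJ[OF f(1)]]] by (simp add: f(2) gpoly_family_def)
      ultimately show "(\<forall>g. keys (F g) \<subseteq> hmons n m c) \<and> (\<forall>w. gpoly n m (\<lambda>g. lookup (F g) w))" by blast
    qed (use S(1) in simp)
    then obtain \<phi> L where \<phi>0: "nonzero_gpoly n m \<phi>"
      "\<forall>g\<in>mat_pairs n m. \<phi> g \<noteq> 0 \<longrightarrow> lead_set (vs.span ((\<lambda>F. F g) ` ?Fs)) = L" by (elim exE conjE)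
    note \<phi> = \<phi>0(1) \<phi>0(2)[rule_format]
    have "lead_set (act n m g ` J \<inter> bihom n m c) = L" if g: "g \<in> GL n \<times> GL m" "\<phi> g \<noteq> 0" for g
    proof -
      have "act n m g ` J \<inter> bihom n m c = vs.span (act n m g ` S)"
        by (simp only: act_bihom_part[OF J, symmetric] S(2) act_span)
      then show ?thesis using \<phi>(2)[OF GL_pairs_mat_pairs[OF g(1)] g(2)] by (simp add: image_image)
    qed
    then show ?thesis using \<phi>(1) by (intro exI[of _ \<phi>] exI[of _ L]) simp
  qed
  have "\<forall>c. \<exists>x. nonzero_gpoly n m (fst x) \<and>
      (\<forall>g\<in>GL n \<times> GL m. fst x g \<noteq> 0 \<longrightarrow> lead_set (act n m g ` J \<inter> bihom n m c) = snd x)"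
  proof
    fix c
    obtain \<phi> L where *: "nonzero_gpoly n m \<phi>"
      "\<forall>g\<in>GL n \<times> GL m. \<phi> g \<noteq> 0 \<longrightarrow> lead_set (act n m g ` J \<inter> bihom n m c) = L"
      using ex[of c] by (elim exE conjE)
    show "\<exists>x. nonzero_gpoly n m (fst x) \<and>
        (\<forall>g\<in>GL n \<times> GL m. fst x g \<noteq> 0 \<longrightarrow> lead_set (act n m g ` J \<inter> bihom n m c) = snd x)"
      by (rule exI[of _ "(\<phi>, L)"], unfold fst_conv snd_conv) (intro conjI *)
  qed
  from choice[OF this] obtain x where x0: "\<forall>c. nonzero_gpoly n m (fst (x c)) \<and>
      (\<forall>g\<in>GL n \<times> GL m. fst (x c) g \<noteq> 0 \<longrightarrow> lead_set (act n m g ` J \<inter> bihom n m c) = snd (x c))"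
    by (rule exE)
  note x = x0[THEN spec, THEN conjunct1] x0[THEN spec, THEN conjunct2, rule_format]
  define \<phi> where "\<phi> = (\<lambda>c. fst (x c))"
  define Lc where "Lc = (\<lambda>c. snd (x c))"
  have \<phi>: "nonzero_gpoly n m (\<phi> c)" for c using x(1) by (simp add: \<phi>_def)
  have Lc: "lead_set (act n m g ` J \<inter> bihom n m c) = Lc c" if "g \<in> GL n \<times> GL m" "\<phi> c g \<noteq> 0" for c g
    using x(2) that by (simp add: \<phi>_def Lc_def)
  have part: "lead_set (act n m g ` J \<inter> bihom n m c) = lead_set (act n m g ` J) \<inter> hmons n m c"
    if "g \<in> GL n \<times> GL m" for g c by (rule lead_set_bihom_part[OF bigraded_act[OF J that]])
  have Lc_h: "Lc c \<subseteq> hmons n m c" for c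
  proof -
    obtain g where "g \<in> GL n \<times> GL m" "\<phi> c g \<noteq> 0" using nonzero_gpoly_point_in_GL[OF inf \<phi>] by blast
    then show ?thesis using Lc part by blast
  qed
  define L where "L = (\<Union>c. Lc c)"
  have L_part: "L \<inter> hmons n m c = Lc c" for c
    unfolding L_def using Lc_h unfolding hmons_def by blast
  have Lm: "L \<subseteq> mons n m" using Lc_h unfolding L_def hmons_def by blast
  obtain Q0 where Q0: "Q0 \<subseteq> L" "finite Q0" "\<And>w. w \<in> L \<Longrightarrow> \<exists>q\<in>Q0. \<exists>u\<in>mons n m. w = u + q"
    using dickson[OF Lm] by blast
  let ?p = "\<lambda>g. \<Prod>q\<in>Q0. \<phi> (bideg q) g"
  have "nonzero_gpoly n m ?p" by (rule nonzero_gpoly_prod[OF inf Q0(2) \<phi>])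
  moreover have "lead_set (act n m g ` J) = L" if g: "g \<in> GL n \<times> GL m" and pg: "?p g \<noteq> 0" for g
  proof -
    let ?M = "lead_set (act n m g ` J)"
    have up: "mon_upset n m ?M" by (rule mon_upset_lead_set[OF bigradedD(1)[OF bigraded_act[OF J g]]])
    have "Q0 \<subseteq> ?M"
    proof
      fix q assume q: "q \<in> Q0"
      then have "\<phi> (bideg q) g \<noteq> 0" using pg Q0(2) by simp
      then have "Lc (bideg q) = ?M \<inter> hmons n m (bideg q)" using Lc[OF g] part[OF g] by simp
      moreover have "q \<in> Lc (bideg q)"
        unfolding L_part[symmetric] using q Q0(1) Lm by (auto simp: hmons_def)
      ultimately show "q \<in> ?M" by blast
    qed
    then have LM: "L \<subseteq> ?M" using Q0(3) up unfolding mon_upset_def by blast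
    have M_part: "?M \<inter> hmons n m c = Lc c" for c
    proof -
      obtain g' where g': "g' \<in> GL n \<times> GL m" "\<phi> c g' \<noteq> 0" using nonzero_gpoly_point_in_GL[OF inf \<phi>] by blast
      have "card (?M \<inter> hmons n m c) = card (lead_set (J \<inter> bihom n m c))"
        using card_lead_set_act[OF J g] part[OF g] by simp
      also have "\<dots> = card (Lc c)" using card_lead_set_act[OF J g'(1), of c] Lc[OF g'] by simp
      finally have "card (Lc c) = card (?M \<inter> hmons n m c)" by simp
      moreover have "Lc c \<subseteq> ?M \<inter> hmons n m c" using LM L_part by blast
      moreover have "finite (?M \<inter> hmons n m c)" using finite_hmons by blast
      ultimately show ?thesis using card_subset_eq by metis
    qed
    have Mm: "?M \<subseteq> mons n m" using up by (simp add: mon_upset_def)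
    have "?M \<subseteq> L"
    proof
      fix w assume w: "w \<in> ?M"
      then have "w \<in> ?M \<inter> hmons n m (bideg w)" using subsetD[OF Mm w] by (simp add: hmons_def)
      then have "w \<in> Lc (bideg w)" unfolding M_part .
      then show "w \<in> L" unfolding L_def by blast
    qed
    then show ?thesis using LM by (rule subset_antisym)
  qed
  ultimately show ?thesis by (intro exI[of _ ?p] exI[of _ L]) blast
qed

text \<open>Over an infinite field two nonempty open sets meet, so the definite description is met by one
  ideal only.\<close>

lemma bigin_eq:
  fixes J :: "'k::field bipoly set"
  assumes inf: "infinite (UNIV :: 'k set)" and J: "bigraded n m J" and \<phi>: "nonzero_gpoly n m \<phi>"
    and L: "\<And>g. g \<in> GL n \<times> GL m \<Longrightarrow> \<phi> g \<noteq> 0 \<Longrightarrow> lead_set (act n m g ` J) = L"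
  shows "bigin n m J = mon_ideal L"
  unfolding bigin_def
proof (rule the_equality)
  have ini: "initial_ideal n m (act n m g ` J) = mon_ideal L" if "g \<in> GL n \<times> GL m" "\<phi> g \<noteq> 0" for g
    using initial_ideal_eq[OF bigradedD(1)[OF bigraded_act[OF J that(1)]]] L[OF that] by simp
  let ?U = "{g \<in> GL n \<times> GL m. \<phi> g \<noteq> 0}"
  show "\<exists>U. zariski_open n m U \<and> U \<noteq> {} \<and> (\<forall>g\<in>U. initial_ideal n m (act n m g ` J) = mon_ideal L)"
    using nonzero_gpoly_zariski_open[OF inf \<phi>] ini by (intro exI[of _ ?U]) simp
  fix I assume "\<exists>U. zariski_open n m U \<and> U \<noteq> {} \<and> (\<forall>g\<in>U. initial_ideal n m (act n m g ` J) = I)"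
  then obtain U where U: "zariski_open n m U" "U \<noteq> {}" "\<And>g. g \<in> U \<Longrightarrow> initial_ideal n m (act n m g ` J) = I" by blast
  obtain \<psi> where \<psi>: "nonzero_gpoly n m \<psi>" "\<And>g. g \<in> GL n \<times> GL m \<Longrightarrow> \<psi> g \<noteq> 0 \<Longrightarrow> g \<in> U"
    using zariski_open_nonzero_gpoly[OF U(1,2)] by blast
  obtain g where "g \<in> GL n \<times> GL m" "\<phi> g * \<psi> g \<noteq> 0" using nonzero_gpoly_point_in_GL[OF inf nonzero_gpoly_mult[OF inf \<phi> \<psi>(1)]] by blast
  then have g: "g \<in> GL n \<times> GL m" "\<phi> g \<noteq> 0" "\<psi> g \<noteq> 0" by auto
  show "I = mon_ideal L" using ini[OF g(1,2)] U(3)[OF \<psi>(2)[OF g(1,3)]] by simp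
qed

section \<open>Strong stability in characteristic zero\<close>

text \<open>The substitution of \<open>x\<^sub>a + t x\<^sub>i\<close> for \<open>x\<^sub>a\<close>.\<close>

definition shear :: "nat \<Rightarrow> nat \<Rightarrow> nat \<Rightarrow> nat \<Rightarrow> 'k::field \<Rightarrow> 'k mat \<times> 'k mat" where
  "shear n m i a t =
    (mat n n (\<lambda>(k, l). (if k = l then 1 else 0) + (if k = i \<and> l = a then t else 0)), 1\<^sub>m m)"

lemma shear_mat_pairs: "shear n m i a t \<in> mat_pairs n m"
  by (simp add: shear_def)

lemma shear_0: "shear n m i a 0 = (1\<^sub>m n, 1\<^sub>m m)"
proof -
  have "mat n n (\<lambda>(k, l). (if k = l then 1 else 0) + (if k = i \<and> l = a then 0 else 0)) = (1\<^sub>m n :: 'a mat)"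
    by (rule eq_matI) simp_all
  then show ?thesis by (simp add: shear_def)
qed

lemma x_image_shear:
  assumes "i < n" "j < n"
  shows "x_image n (fst (shear n m i a t)) j = x_var j + (if j = a then bconst t * x_var i else 0)"
proof -
  have "x_image n (fst (shear n m i a t)) j
      = (\<Sum>k<n. (if k = j then x_var k else 0) + (if k = i then (if j = a then bconst t * x_var k else 0) else 0))"
    unfolding x_image_def using assms
    by (intro sum.cong) (auto simp: shear_def bc.hom_add bc.hom_one bc.hom_zero distrib_right)
  then show ?thesis using assms by (simp add: sum.distrib)
qed

abbreviation x_power :: "nat \<Rightarrow> nat \<Rightarrow> bimon" where
  "x_power i k \<equiv> (Poly_Mapping.single i k, 0)"

lemma x_var_power: "x_var i ^ k = (bimonom (x_power i k) :: 'k::field bipoly)"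
  using mon_prod_x_var[of "Poly_Mapping.single i k"] by (simp add: mon_prod_single)

lemma bimonom_mult: "bimonom u * bimonom v = bimonom (u + v)"
  by (simp add: bimonom_def mult_single)

text \<open>The image of the monomial \<open>v\<close> under the shear is obtained by trading \<open>j\<close> factors \<open>x\<^sub>a\<close> for \<open>x\<^sub>i\<close>, for
  each \<open>j\<close>; this is the coefficient of \<open>t\<^sup>j b\<close>. The equation between monomials avoids subtraction.\<close>

definition shear_coeff :: "nat \<Rightarrow> nat \<Rightarrow> nat \<Rightarrow> bimon \<Rightarrow> bimon \<Rightarrow> 'k::field" where
  "shear_coeff i a j v b =
    (if b + x_power a j = v + x_power i j then of_nat (lookup (fst v) a choose j) else 0)"

lemma lookup_mon_image_shear:
  fixes t :: "'k::field"
  assumes v: "v \<in> mons n m" and ia: "i < n" "a < n" "i \<noteq> a" and M: "lookup (fst v) a \<le> M"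
  shows "lookup (mon_image n m (shear n m i a t) v) b = (\<Sum>j\<le>M. t ^ j * shear_coeff i a j v b)"
proof -
  define k where "k = lookup (fst v) a"
  define u where "u = fst v - Poly_Mapping.single a k"
  have u: "fst v = Poly_Mapping.single a k + u"
    by (rule poly_mapping_eqI) (simp add: u_def k_def lookup_add minus_poly_mapping.rep_eq lookup_single when_def)
  have ua: "a \<notin> keys u" by (simp add: in_keys_iff u_def k_def minus_poly_mapping.rep_eq)
  have kv: "keys (fst v) \<subseteq> {..<n}" "keys (snd v) \<subseteq> {..<m}" using v by (simp_all add: mons_def)
  have ku: "keys u \<subseteq> {..<n}" using kv(1) by (simp add: u keys_add_nat)
  have v_eq: "v = x_power a k + (u, snd v)" by (rule prod_eqI) (simp_all add: u)
  have "mon_prod (x_image n (fst (shear n m i a t))) u = (mon_prod x_var u :: 'k bipoly)"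
    unfolding mon_prod_def
  proof (rule prod.cong[OF refl])
    fix j assume j: "j \<in> keys u"
    then have "j < n" "j \<noteq> a" using ku ua by auto
    then show "x_image n (fst (shear n m i a t)) j ^ lookup u j = x_var j ^ lookup u j"
      by (simp add: x_image_shear[OF ia(1)])
  qed
  then have X: "mon_prod (x_image n (fst (shear n m i a t))) (fst v)
      = (bconst t * x_var i + x_var a) ^ k * bimonom (u, 0)"
    unfolding u mon_prod_add by (simp add: mon_prod_single x_image_shear[OF ia(1,2)] mon_prod_x_var add.commute)
  have "mon_prod (y_image m (snd (shear n m i a t))) (snd v) = (mon_prod y_var (snd v) :: 'k bipoly)"
    unfolding mon_prod_def
  proof (rule prod.cong[OF refl])
    fix j assume "j \<in> keys (snd v)"
    then have "j < m" using kv(2) by blast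
    then show "y_image m (snd (shear n m i a t)) j ^ lookup (snd v) j = y_var j ^ lookup (snd v) j"
      by (simp add: shear_def y_image_one)
  qed
  then have Y: "mon_prod (y_image m (snd (shear n m i a t))) (snd v) = (bimonom (0, snd v) :: 'k bipoly)"
    by (simp add: mon_prod_y_var)
  have uv: "bimonom (u, 0) * bimonom (0, snd v) = (bimonom (u, snd v) :: 'k bipoly)"
    by (simp add: bimonom_mult)
  have bpow: "bconst t ^ j = bconst (t ^ j)" for j
    by (induction j) (simp_all add: bc.hom_one bc.hom_mult)
  have bnat: "(of_nat c :: 'k bipoly) = bconst (of_nat c)" for c by (simp add: bconst_def)
  have "mon_image n m (shear n m i a t) v = (bconst t * x_var i + x_var a) ^ k * bimonom (u, snd v)"
    unfolding mon_image_def X Y by (simp only: mult.assoc uv)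
  also have "\<dots> = (\<Sum>j\<le>k. of_nat (k choose j) * (bconst t * x_var i) ^ j * x_var a ^ (k - j)) * bimonom (u, snd v)"
    by (simp only: binomial_ring)
  also have "\<dots> = (\<Sum>j\<le>k. Poly_Mapping.single (x_power i j + x_power a (k - j) + (u, snd v)) (t ^ j * of_nat (k choose j)))"
    unfolding sum_distrib_right
  proof (rule sum.cong[OF refl])
    fix j
    have "of_nat (k choose j) * (bconst t * x_var i) ^ j * x_var a ^ (k - j) * bimonom (u, snd v)
        = bconst (of_nat (k choose j)) * (bconst (t ^ j) * bimonom (x_power i j)) * bimonom (x_power a (k - j)) * bimonom (u, snd v)"
      by (simp only: power_mult_distrib bpow bnat x_var_power)
    also have "\<dots> = Poly_Mapping.single (x_power i j + x_power a (k - j) + (u, snd v)) (t ^ j * of_nat (k choose j))"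
      unfolding bconst_def bimonom_def mult_single by (simp add: mult.commute)
    finally show "of_nat (k choose j) * (bconst t * x_var i) ^ j * x_var a ^ (k - j) * bimonom (u, snd v)
        = Poly_Mapping.single (x_power i j + x_power a (k - j) + (u, snd v)) (t ^ j * of_nat (k choose j))" .
  qed
  finally have "lookup (mon_image n m (shear n m i a t) v) b
      = (\<Sum>j\<le>k. (if x_power i j + x_power a (k - j) + (u, snd v) = b then t ^ j * of_nat (k choose j) else 0))"
    by (simp add: lookup_sum lookup_single when_def)
  also have "\<dots> = (\<Sum>j\<le>k. t ^ j * shear_coeff i a j v b)"
  proof (rule sum.cong[OF refl])
    fix j assume "j \<in> {..k}"
    then have j: "x_power a (k - j) + x_power a j = x_power a k" by (simp add: single_add[symmetric])
    have "x_power i j + x_power a (k - j) + (u, snd v) = b \<longleftrightarrow>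
        x_power i j + x_power a (k - j) + (u, snd v) + x_power a j = b + x_power a j" by (rule add_right_cancel[symmetric])
    also have "x_power i j + x_power a (k - j) + (u, snd v) + x_power a j
        = x_power i j + (x_power a (k - j) + x_power a j) + (u, snd v)" by (simp only: add_ac)
    also have "\<dots> = v + x_power i j" unfolding j by (subst (2) v_eq) (simp only: add_ac)
    finally have "x_power i j + x_power a (k - j) + (u, snd v) = b \<longleftrightarrow> b + x_power a j = v + x_power i j" by metis
    then show "(if x_power i j + x_power a (k - j) + (u, snd v) = b then t ^ j * of_nat (k choose j) else 0)
        = t ^ j * shear_coeff i a j v b" by (simp add: shear_coeff_def k_def)
  qed
  also have "\<dots> = (\<Sum>j\<le>M. t ^ j * shear_coeff i a j v b)"
    using M by (intro sum.mono_neutral_left) (auto simp: k_def shear_coeff_def binomial_eq_0)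
  finally show ?thesis .
qed

text \<open>The degree bound is a successor so that the sum always contains the terms of degree \<open>0\<close> and \<open>1\<close>
  in \<open>t\<close>.\<close>

lemma lookup_act_shear:
  fixes f :: "'k::field bipoly"
  assumes f: "f \<in> poly_carrier n m" and ia: "i < n" "a < n" "i \<noteq> a"
  shows "\<exists>M. \<forall>t b. lookup (act n m (shear n m i a t) f) b
    = (\<Sum>j\<le>Suc M. t ^ j * (\<Sum>v\<in>keys f. lookup f v * shear_coeff i a j v b))"
proof -
  obtain M where M: "\<forall>v\<in>keys f. lookup (fst v) a \<le> M"
    using finite_nat_set_iff_bounded_le[of "(\<lambda>v. lookup (fst v) a) ` keys f"] by auto
  have "lookup (act n m (shear n m i a t) f) b
      = (\<Sum>j\<le>Suc M. t ^ j * (\<Sum>v\<in>keys f. lookup f v * shear_coeff i a j v b))" for t b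
  proof -
    have "lookup (act n m (shear n m i a t) f) b
        = (\<Sum>v\<in>keys f. lookup f v * lookup (mon_image n m (shear n m i a t) v) b)"
      by (simp add: act_eq_lin_ext lin_ext_def lookup_sum lookup_bconst_mult)
    also have "\<dots> = (\<Sum>v\<in>keys f. lookup f v * (\<Sum>j\<le>Suc M. t ^ j * shear_coeff i a j v b))"
    proof (rule sum.cong[OF refl])
      fix v assume v: "v \<in> keys f"
      have "v \<in> mons n m" using f v unfolding poly_carrier_iff by blast
      moreover have "lookup (fst v) a \<le> Suc M" using M v by (simp add: le_SucI)
      ultimately show "lookup f v * lookup (mon_image n m (shear n m i a t) v) b
          = lookup f v * (\<Sum>j\<le>Suc M. t ^ j * shear_coeff i a j v b)"
        by (simp only: lookup_mon_image_shear[OF _ ia])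
    qed
    also have "\<dots> = (\<Sum>j\<le>Suc M. \<Sum>v\<in>keys f. t ^ j * (lookup f v * shear_coeff i a j v b))"
      unfolding sum_distrib_left by (subst sum.swap) (simp only: mult.left_commute)
    finally show ?thesis by (simp only: sum_distrib_left)
  qed
  then show ?thesis by blast
qed

lemma polyfun_det:
  assumes "\<And>t. A t \<in> carrier_mat r r" "\<And>k l. k < r \<Longrightarrow> l < r \<Longrightarrow> polyfun (\<lambda>t. A t $$ (k, l))"
  shows "polyfun (\<lambda>t. det (A t) :: 'k::field)"
proof -
  have perm: "p k < r" if "p permutes {0..<r}" "k < r" for p k
    using permutes_in_image[OF that(1), of k] that(2) by simp
  have "(\<lambda>t. det (A t)) = (\<lambda>t. \<Sum>p\<in>{p. p permutes {0..<r}}. signof p * (\<Prod>k=0..<r. A t $$ (k, p k)))"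
    by (rule ext) (rule det_def'[OF assms(1)])
  then show ?thesis
    by (simp only:) (intro polyfun_sum polyfun_mult polyfun_prod polyfun_const assms(2), auto simp: perm)
qed

text \<open>Listed by decreasing monomials, the matrix \<open>G 0\<close> is triangular with nonzero diagonal. Its
  determinant is the value at \<open>0\<close> of a polynomial function, which then has finitely many zeros.\<close>

lemma generic_interpolation:
  fixes G :: "'k::field \<Rightarrow> bimon \<Rightarrow> bimon \<Rightarrow> 'k"
  assumes B: "finite B" and w: "w \<in> B"
    and poly: "\<And>b b'. b \<in> B \<Longrightarrow> b' \<in> B \<Longrightarrow> polyfun (\<lambda>t. G t b b')"
    and diag: "\<And>b. b \<in> B \<Longrightarrow> G 0 b b \<noteq> 0"
    and upper: "\<And>b b'. b \<in> B \<Longrightarrow> b' \<in> B \<Longrightarrow> mon_greater b b' \<Longrightarrow> G 0 b b' = 0"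
  shows "\<exists>T. finite T \<and> (\<forall>t. t \<notin> T \<longrightarrow> (\<exists>c. \<forall>b\<in>B. (\<Sum>b'\<in>B. c b' * G t b b') = (if b = w then 1 else 0)))"
proof -
  let ?r = "card B"
  obtain bs where bs: "bij_betw bs {0..<?r} B" using ex_bij_betw_nat_finite[OF B] by blast
  define A where "A = (\<lambda>t. mat ?r ?r (\<lambda>(k, l). G t (bs k) (bs l)))"
  have A: "A t \<in> carrier_mat ?r ?r" for t by (simp add: A_def)
  have bsB: "bs k \<in> B" if "k < ?r" for k using bs that by (auto simp: bij_betw_def)
  have index_of: "\<exists>k<?r. bs k = b" if b_in: "b \<in> B" for b
  proof -
    have "b \<in> bs ` {0..<?r}" using bs b_in unfolding bij_betw_def by blast
    then show ?thesis by (metis imageE atLeastLessThan_iff)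
  qed
  have bs_inj: "bs k = bs l \<longleftrightarrow> k = l" if "k < ?r" "l < ?r" for k l
    using bs that by (auto simp: bij_betw_def inj_on_def)
  have Av: "(A t *\<^sub>v vec ?r v) $ k = (\<Sum>l<?r. G t (bs k) (bs l) * v l)" if k: "k < ?r" for t v k
  proof -
    have "(A t *\<^sub>v vec ?r v) $ k = (\<Sum>l<?r. A t $$ (k, l) * v l)" unfolding mat_mult_vec_fun[OF A] using k by simp
    also have "\<dots> = (\<Sum>l<?r. G t (bs k) (bs l) * v l)" using k by (intro sum.cong) (simp_all add: A_def)
    finally show ?thesis .
  qed
  have "det (A 0) \<noteq> 0"
  proof
    assume "det (A 0) = 0"
    then obtain v where v: "v \<in> carrier_vec ?r" "v \<noteq> 0\<^sub>v ?r" "A 0 *\<^sub>v v = 0\<^sub>v ?r"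
      using det_0_iff_vec_prod_zero_field[OF A] by blast
    have v_eq: "v = vec ?r (\<lambda>l. v $ l)" using v(1) by (intro eq_vecI) auto
    \<comment> \<open>The largest monomial with a nonzero entry in a vector of the kernel gives an equation with a
      single nonzero term.\<close>
    define N where "N = bs ` {l. l < ?r \<and> v $ l \<noteq> 0}"
    have "finite N" by (simp add: N_def)
    moreover have "N \<noteq> {}"
    proof
      assume "N = {}"
      then have "v = 0\<^sub>v ?r" using v(1) by (intro eq_vecI) (auto simp: N_def)
      then show False using v(2) by simp
    qed
    ultimately obtain b where b: "b \<in> N" "\<forall>b'\<in>N. b' \<noteq> b \<longrightarrow> mon_greater b b'"
      using finite_has_greatest_mon by meson
    then obtain k where k: "k < ?r" "v $ k \<noteq> 0" "b = bs k" by (auto simp: N_def)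
    have "G 0 (bs k) (bs l) * v $ l = (if l = k then G 0 b b * v $ k else 0)" if l: "l < ?r" for l
    proof (cases "l = k \<or> v $ l = 0")
      case True
      then show ?thesis using k by auto
    next
      case False
      then have "bs l \<in> N" "bs l \<noteq> b" using l k bs_inj by (auto simp: N_def)
      then have "mon_greater (bs k) (bs l)" using b(2) k(3) by blast
      then show ?thesis using upper[OF bsB[OF k(1)] bsB[OF l]] False by simp
    qed
    then have "(\<Sum>l<?r. G 0 (bs k) (bs l) * v $ l) = (\<Sum>l<?r. if l = k then G 0 b b * v $ k else 0)"
      by (intro sum.cong) simp_all
    also have "\<dots> = G 0 b b * v $ k" using k(1) by simp
    finally have "(A 0 *\<^sub>v v) $ k = G 0 b b * v $ k" using Av[OF k(1), of 0 "\<lambda>l. v $ l"] v_eq by simp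
    then have "G 0 b b * v $ k = 0" using v(3) k(1) by simp
    then show False using k diag[OF bsB[OF k(1)]] by simp
  qed
  moreover have "polyfun (\<lambda>t. det (A t))"
  proof (rule polyfun_det[OF A])
    fix k l assume kl: "k < ?r" "l < ?r"
    have "polyfun (\<lambda>t. G t (bs k) (bs l))" by (intro poly bsB kl)
    then show "polyfun (\<lambda>t. A t $$ (k, l))" using kl by (simp add: A_def)
  qed
  ultimately have fin: "finite {t. det (A t) = 0}" using polyfun_finite_zeros by metis
  have "\<exists>c. \<forall>b\<in>B. (\<Sum>b'\<in>B. c b' * G t b b') = (if b = w then 1 else 0)" if t: "t \<notin> {t. det (A t) = 0}" for t
  proof -
    have "A t \<in> GL ?r" using t GL_iff_det[OF A] by simp
    then obtain C where C: "C \<in> GL ?r" "A t * C = 1\<^sub>m ?r" using GL_inverse by blast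
    have Cc: "C \<in> carrier_mat ?r ?r" using C(1) by (simp add: GL_def)
    obtain p where p: "p < ?r" "bs p = w" using index_of[OF w] by blast
    define v where "v = C *\<^sub>v unit_vec ?r p"
    have vc: "v \<in> carrier_vec ?r" using Cc by (simp add: v_def)
    have "A t *\<^sub>v v = (A t * C) *\<^sub>v unit_vec ?r p" unfolding v_def by (rule assoc_mult_mat_vec[OF A Cc, symmetric]) simp
    then have Av_unit: "A t *\<^sub>v v = unit_vec ?r p" unfolding C(2) by simp
    have v_eq: "v = vec ?r (\<lambda>l. v $ l)" using vc by (intro eq_vecI) auto
    define c where "c = (\<lambda>b'. v $ inv_into {0..<?r} bs b')"
    have c: "c (bs l) = v $ l" if "l < ?r" for l
      using bs that by (simp add: c_def bij_betw_def inv_into_f_f)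
    have "(\<Sum>b'\<in>B. c b' * G t b b') = (if b = w then 1 else 0)" if b: "b \<in> B" for b
    proof -
      obtain k where k: "k < ?r" "bs k = b" using index_of[OF b] by blast
      have "(\<Sum>b'\<in>B. c b' * G t b b') = (\<Sum>l\<in>{0..<?r}. c (bs l) * G t b (bs l))"
        by (rule sum.reindex_bij_betw[OF bs, symmetric])
      also have "\<dots> = (\<Sum>l<?r. G t (bs k) (bs l) * v $ l)"
        using k by (intro sum.cong) (auto simp: c)
      also have "\<dots> = (A t *\<^sub>v v) $ k" using Av[OF k(1), of t "\<lambda>l. v $ l"] v_eq by simp
      also have "\<dots> = (if b = w then 1 else 0)" unfolding Av_unit using k p bs_inj by auto
      finally show ?thesis .
    qed
    then show ?thesis by blast
  qed
  then show ?thesis using fin by blast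
qed

lemma shear_coeff_0: "shear_coeff i a 0 v b = (if v = b then 1 else 0)"
  by (auto simp: shear_coeff_def zero_prod_def[symmetric])

lemma shear_coeff_1:
  "shear_coeff i a (Suc 0) v b =
    (if x_mon a + b = x_mon i + v then of_nat (lookup (fst v) a) else 0)"
  by (simp add: shear_coeff_def x_mon_def add.commute)

text \<open>For \<open>f\<close> in \<open>J\<close> with leading monomial \<open>x\<^sub>a w\<close>, the sheared polynomial is \<open>f + t f\<^sub>1 + \<dots>\<close> with
  \<open>f\<^sub>1 = x\<^sub>i (\<partial>f/\<partial>x\<^sub>a)\<close>. In characteristic \<open>0\<close> the leading monomial of \<open>f\<^sub>1\<close> is \<open>x\<^sub>i w\<close>, which is larger than
  every monomial of \<open>f\<close>. From \<open>x\<^sub>i w\<close> upwards, the sheared \<open>f\<close> divided by \<open>t\<close> therefore has the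
  coefficients of \<open>f\<^sub>1\<close> at \<open>t = 0\<close>. Together with elements of \<open>J\<close> for the leading monomials above
  \<open>x\<^sub>i w\<close> it satisfies the hypotheses of \<open>generic_interpolation\<close>, which yields a combination whose
  leading monomial is either \<open>x\<^sub>i w\<close> or a leading monomial outside those of \<open>J\<close>, and the latter is excluded
  as the shear does not change the leading monomials.\<close>

lemma lead_set_shear_stable:
  fixes J :: "'k::field bipoly set"
  assumes inf: "infinite (UNIV :: 'k set)" and char: "CHAR('k) = 0"
    and J: "bigraded n m J" and T0: "finite T0"
    and same: "\<And>t. t \<notin> T0 \<Longrightarrow> lead_set (act n m (shear n m i a t) ` J) = lead_set J"
    and ia: "i < a" "a < n" and xw: "x_mon a + w \<in> lead_set J"
  shows "x_mon i + w \<in> lead_set J"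
proof -
  note pJ = bigradedD(1)[OF J]
  have ia': "i < n" "a < n" "i \<noteq> a" using ia by auto
  define w1 where "w1 = x_mon i + w"
  define c where "c = bideg w1"
  have L: "lead_set J \<subseteq> mons n m" using mon_upset_lead_set[OF pJ] by (simp add: mon_upset_def)
  have wm: "w \<in> mons n m" using subsetD[OF L xw] by (simp add: mons_add)
  have bidegw: "bideg (x_mon a + w) = c" by (simp add: c_def w1_def bideg_add x_mon_props)
  have xia: "mon_greater (x_mon i) (x_mon a)"
  proof (rule mon_greater_mons)
    show "x_mon i \<in> mons a m" using x_mon_props(1)[of i m] mons_mono[of "Suc i" a m m] ia by auto
    show "x_mon a \<in> mons (Suc a) m" "x_mon a \<notin> mons a m" "bideg (x_mon i) = bideg (x_mon a)"
      by (simp_all only: x_mon_props not_False_eq_True)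
  qed
  have w1_greater: "mon_greater w1 (x_mon a + w)"
    using xia mon_greater_add[of w "x_mon i" "x_mon a"] by (simp add: w1_def add.commute)
  have swap: "x_mon a + w1 = x_mon i + (x_mon a + w)" by (simp only: w1_def add_ac)
  define B where "B = insert w1 {b \<in> lead_set J. bideg b = c \<and> mon_greater b w1}"
  have "{b \<in> lead_set J. bideg b = c \<and> mon_greater b w1} \<subseteq> hmons n m c"
    using L by (auto simp only: hmons_def)
  then have B: "finite B" unfolding B_def using finite_subset[OF _ finite_hmons] by blast
  obtain f0 where f0: "f0 \<in> J" "f0 \<in> bihom n m (bideg (x_mon a + w))" "f0 \<noteq> 0" "lead_mon f0 = x_mon a + w"
    using lead_set_homogeneous[OF J xw] by metis
  define f where "f = (\<lambda>b. if b = w1 then f0 else SOME f. f \<in> J \<and> f \<in> bihom n m c \<and> f \<noteq> 0 \<and> lead_mon f = b)"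
  have f_w1: "f w1 = f0" by (simp add: f_def)
  have f_other: "f b \<in> J \<and> f b \<in> bihom n m c \<and> f b \<noteq> 0 \<and> lead_mon (f b) = b" if b_in: "b \<in> B" "b \<noteq> w1" for b
  proof -
    have b: "b \<in> lead_set J" "bideg b = c" using b_in unfolding B_def by blast+
    have "\<exists>f. f \<in> J \<and> f \<in> bihom n m c \<and> f \<noteq> 0 \<and> lead_mon f = b"
      using lead_set_homogeneous[OF J b(1)] unfolding b(2) by metis
    from someI_ex[OF this] show ?thesis using b_in(2) by (simp add: f_def)
  qed
  have fJ: "f b \<in> J \<and> f b \<in> bihom n m c" if b_in: "b \<in> B" for b
    using f_other[OF b_in] f0(1,2) f_w1 unfolding bidegw by (cases "b = w1") simp_all
  define e where "e = (\<lambda>h j b. \<Sum>v\<in>keys h. lookup h v * shear_coeff i a j v b :: 'k)"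
  have "\<exists>M. \<forall>t b'. lookup (act n m (shear n m i a t) (f b)) b' = (\<Sum>j\<le>Suc M. t ^ j * e (f b) j b')" if b_in: "b \<in> B" for b
    unfolding e_def by (rule lookup_act_shear[OF poly_idealD(1)[OF pJ] ia']) (use fJ[OF b_in] in blast)
  then obtain M where M: "\<And>b t b'. b \<in> B \<Longrightarrow>
      lookup (act n m (shear n m i a t) (f b)) b' = (\<Sum>j\<le>Suc (M b). t ^ j * e (f b) j b')" by metis
  have w1B: "w1 \<in> B" by (simp add: B_def)
  have B_ge: "b = w1 \<or> mon_greater b w1" if "b \<in> B" for b using that unfolding B_def by blast
  have e_0: "e h 0 b = lookup h b" for h b
  proof -
    have "e h 0 b = (\<Sum>v\<in>keys h. if v = b then lookup h b else 0)"
      unfolding e_def by (rule sum.cong) (simp_all add: shear_coeff_0)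
    also have "\<dots> = lookup h b" by (simp add: in_keys_iff)
    finally show ?thesis .
  qed
  have e0_f0: "e f0 0 b = 0" if b_in: "b \<in> B" for b
  proof -
    have "mon_greater b (x_mon a + w)" using B_ge[OF b_in] w1_greater mon_greater_trans[of b w1 "x_mon a + w"] by metis
    then show ?thesis unfolding e_0 using lookup_above_lead_mon[of b f0] f0(4) by metis
  qed
  have e1_greater: "e f0 (Suc 0) b = 0" if gr: "mon_greater b w1" for b
    unfolding e_def
  proof (rule sum.neutral, rule ballI)
    fix v assume v: "v \<in> keys f0"
    have "x_mon a + b \<noteq> x_mon i + v"
    proof
      assume eq: "x_mon a + b = x_mon i + v"
      show False
      proof (cases "v = x_mon a + w")
        case True
        then have "x_mon a + b = x_mon a + w1" using eq swap by metis
        then show False using gr mon_greater_irrefl by (metis add_left_cancel)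
      next
        case False
        then have "mon_greater (x_mon a + w) v" using lead_mon_greater[OF f0(3) v] f0(4) by metis
        then have "mon_greater (x_mon a + w1) (x_mon a + b)" unfolding eq swap by (simp only: mon_greater_add)
        then have "mon_greater w1 b" by (simp only: mon_greater_add)
        then show False using gr mon_greater_asym by metis
      qed
    qed
    then show "lookup f0 v * shear_coeff i a (Suc 0) v b = 0" by (simp add: shear_coeff_1)
  qed
  have e1_w1: "e f0 (Suc 0) w1 \<noteq> 0"
  proof -
    have iff: "x_mon a + w1 = x_mon i + v \<longleftrightarrow> v = x_mon a + w" for v
      unfolding swap by (metis add_left_cancel)
    have "e f0 (Suc 0) w1 = (\<Sum>v\<in>keys f0. if v = x_mon a + w then lookup f0 (x_mon a + w) * of_nat (lookup (fst (x_mon a + w)) a) else 0)"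
      unfolding e_def by (rule sum.cong) (simp_all add: shear_coeff_1 iff)
    also have "\<dots> = lookup f0 (x_mon a + w) * of_nat (lookup (fst (x_mon a + w)) a)"
      using lead_mon_in_keys[OF f0(3)] f0(4) by simp
    finally have eq: "e f0 (Suc 0) w1 = lookup f0 (x_mon a + w) * of_nat (lookup (fst (x_mon a + w)) a)" .
    have "lookup (fst (x_mon a + w)) a \<noteq> 0" by (simp add: x_mon_def lookup_add)
    then have "(of_nat (lookup (fst (x_mon a + w)) a) :: 'k) \<noteq> 0"
      using of_nat_eq_0_iff_char_dvd[where 'a='k] char by (metis dvd_0_left_iff)
    moreover have "lookup f0 (x_mon a + w) \<noteq> 0" using lookup_lead_mon[OF f0(3)] f0(4) by metis
    ultimately show ?thesis unfolding eq by simp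
  qed
  \<comment> \<open>The column of \<open>w1\<close> is the sheared \<open>f0\<close> divided by \<open>t\<close>; the term of degree \<open>0\<close> in \<open>t\<close> vanishes at
    the monomials in \<open>B\<close>.\<close>
  define G where "G = (\<lambda>t b b'. if b' = w1 then (\<Sum>j\<le>M w1. t ^ j * e f0 (Suc j) b)
      else lookup (act n m (shear n m i a t) (f b')) b)"
  have G_w1: "lookup (act n m (shear n m i a t) (f w1)) b = t * G t b w1" if b_in: "b \<in> B" for t b
  proof -
    have "lookup (act n m (shear n m i a t) (f w1)) b = (\<Sum>j\<le>M w1. t ^ Suc j * e f0 (Suc j) b)"
      using M[OF w1B, of t b] e0_f0[OF b_in] by (simp only: sum.atMost_Suc_shift f_w1 mult_zero_right add_0_left)
    then show ?thesis by (simp add: G_def sum_distrib_left mult.assoc)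
  qed
  have G_0_w1: "G 0 b w1 = e f0 (Suc 0) b" for b
  proof -
    have "G 0 b w1 = (\<Sum>j\<le>M w1. if j = 0 then e f0 (Suc 0) b else 0)"
      unfolding G_def if_P[OF refl] by (rule sum.cong) (simp_all add: power_0_left)
    then show ?thesis by simp
  qed
  have G_0: "G 0 b b' = lookup (f b') b" if b'_in: "b' \<in> B" "b' \<noteq> w1" for b b'
  proof -
    have "f b' \<in> poly_carrier n m" using fJ[OF b'_in(1)] poly_idealD(1)[OF pJ] by blast
    then show ?thesis using b'_in(2) by (simp add: G_def shear_0 act_identity)
  qed
  have "\<exists>T. finite T \<and> (\<forall>t. t \<notin> T \<longrightarrow> (\<exists>c. \<forall>b\<in>B. (\<Sum>b'\<in>B. c b' * G t b b') = (if b = w1 then 1 else 0)))"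
  proof (rule generic_interpolation[OF B w1B])
    show "polyfun (\<lambda>t. G t b b')" if b'_in: "b' \<in> B" for b b'
    proof (cases "b' = w1")
      case True
      have "polyfun (\<lambda>t. \<Sum>j\<le>M w1. t ^ j * e f0 (Suc j) b)"
        by (intro polyfun_sum polyfun_mult polyfun_power polyfun_id polyfun_const)
      then show ?thesis using True by (simp add: G_def)
    next
      case False
      have "polyfun (\<lambda>t. \<Sum>j\<le>Suc (M b'). t ^ j * e (f b') j b)"
        by (intro polyfun_sum polyfun_mult polyfun_power polyfun_id polyfun_const)
      then show ?thesis using False by (simp only: G_def M[OF b'_in] if_False)
    qed
    show "G 0 b b \<noteq> 0" if b_in: "b \<in> B" for b
    proof (cases "b = w1")
      case True
      then show ?thesis using G_0_w1 e1_w1 by metis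
    next
      case False
      then show ?thesis using G_0[OF b_in False] f_other[OF b_in False] lookup_lead_mon[of "f b"] by metis
    qed
    show "G 0 b b' = 0" if b'_in: "b' \<in> B" and gr: "mon_greater b b'" for b b'
    proof (cases "b' = w1")
      case True
      then show ?thesis using G_0_w1 e1_greater gr by metis
    next
      case False
      then show ?thesis
        using G_0[OF b'_in False] f_other[OF b'_in False] lookup_above_lead_mon[of b "f b'"] gr by metis
    qed
  qed
  then obtain T where T: "finite T"
    "\<forall>t. t \<notin> T \<longrightarrow> (\<exists>c. \<forall>b\<in>B. (\<Sum>b'\<in>B. c b' * G t b b') = (if b = w1 then 1 else 0))" by metis
  obtain t where t: "t \<notin> insert 0 (T \<union> T0)"
    using ex_new_if_finite[OF inf] T(1) T0 by (metis finite_Un finite_insert)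
  obtain d where d: "\<forall>b\<in>B. (\<Sum>b'\<in>B. d b' * G t b b') = (if b = w1 then 1 else 0)"
    using T(2) t by (metis UnCI insertCI)
  define F where "F = (\<Sum>b'\<in>B. bconst (if b' = w1 then d b' / t else d b') * f b')"
  have "F \<in> J \<inter> bihom n m c"
    unfolding F_def using fJ
    by (intro vs.subspace_sum[OF subspace_bihom_part[OF pJ]] vs.subspace_scale[OF subspace_bihom_part[OF pJ]]) blast
  then have F: "F \<in> J" "F \<in> bihom n m c" by blast+
  define u where "u = act n m (shear n m i a t) F"
  have u: "u \<in> act n m (shear n m i a t) ` J" "u \<in> bihom n m c"
    unfolding u_def using F act_bihom by blast+
  have lu: "lookup u b = (if b = w1 then 1 else 0)" if b_in: "b \<in> B" for b
  proof -
    have "lookup u b = (\<Sum>b'\<in>B. (if b' = w1 then d b' / t else d b') * lookup (act n m (shear n m i a t) (f b')) b)"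
      by (simp add: u_def F_def act_sum act_mult act_bconst lookup_sum lookup_bconst_mult)
    also have "\<dots> = (\<Sum>b'\<in>B. d b' * G t b b')"
    proof (rule sum.cong[OF refl])
      fix b'
      have "t \<noteq> 0" using t by blast
      then show "(if b' = w1 then d b' / t else d b') * lookup (act n m (shear n m i a t) (f b')) b = d b' * G t b b'"
        using G_w1[OF b_in] by (cases "b' = w1") (simp_all add: G_def)
    qed
    finally show ?thesis using d b_in by simp
  qed
  have lu1: "lookup u w1 \<noteq> 0" using lu[OF w1B] by simp
  then have u0: "u \<noteq> 0" by (metis lookup_zero)
  have lead_u: "lead_mon u \<in> lead_set J" using same[of t] t lead_setI[OF u(1) u0] by blast
  have "lead_mon u = w1"
  proof (rule ccontr)
    assume ne: "lead_mon u \<noteq> w1"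
    have "mon_greater (lead_mon u) w1" using lead_mon_greater[OF u0, of w1] lu1 ne by (metis in_keys_iff)
    moreover have "bideg (lead_mon u) = c"
      using u(2) lead_mon_in_keys[OF u0] unfolding bihom_iff hmons_def by blast
    ultimately have "lead_mon u \<in> B" using lead_u unfolding B_def by blast
    then show False using lu[of "lead_mon u"] ne lookup_lead_mon[OF u0] by metis
  qed
  then show ?thesis using lead_u unfolding w1_def by metis
qed

lemma gmult_mat_pairs: "g \<in> mat_pairs n m \<Longrightarrow> h \<in> mat_pairs n m \<Longrightarrow> gmult g h \<in> mat_pairs n m"
  by (auto simp: gmult_def)

lemma polyfun_shear_gmult:
  fixes g :: "'k::field mat \<times> 'k mat"
  assumes g: "g \<in> mat_pairs n m" and z: "z \<in> entry_vars n m"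
  shows "polyfun (\<lambda>t. entry (gmult (shear n m i a t) g) z)"
proof (cases z)
  case (Inl kl)
  obtain k l where kl: "kl = (k, l)" "k < n" "l < n" using z Inl by (auto simp: entry_vars_def)
  have A: "fst g \<in> carrier_mat n n" using g by auto
  have "entry (gmult (shear n m i a t) g) z
      = (\<Sum>p<n. ((if k = p then 1 else 0) + (if k = i \<and> p = a then t else 0)) * fst g $$ (p, l))" for t
    using A kl Inl by (simp add: entry_def gmult_def shear_def scalar_prod_def lessThan_atLeast0)
  moreover have "polyfun (\<lambda>t. \<Sum>p<n. ((if k = p then 1 else 0) + (if k = i \<and> p = a then t else 0)) * fst g $$ (p, l))"
  proof (intro polyfun_sum polyfun_mult polyfun_add polyfun_const)
    show "polyfun (\<lambda>t. if k = i \<and> p = a then t else 0)" for p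
      by (cases "k = i"; cases "p = a") simp_all
  qed
  ultimately show ?thesis by simp
next
  case (Inr kl)
  then show ?thesis by (simp add: entry_def gmult_def shear_def)
qed

text \<open>A shear of a generic pair of matrices is generic again for almost all parameters, so it does not
  change the leading monomials.\<close>

lemma generic_leads_strongly_stable:
  fixes J :: "'k::field bipoly set"
  assumes inf: "infinite (UNIV :: 'k set)" and char: "CHAR('k) = 0"
    and J: "bigraded n m J" and \<phi>: "nonzero_gpoly n m \<phi>"
    and L: "\<And>g. g \<in> GL n \<times> GL m \<Longrightarrow> \<phi> g \<noteq> 0 \<Longrightarrow> lead_set (act n m g ` J) = L"
    and ia: "i < a" "a < n" and xw: "x_mon a + w \<in> L"
  shows "x_mon i + w \<in> L"
proof -
  obtain g where g: "g \<in> GL n \<times> GL m" "\<phi> g \<noteq> 0" using nonzero_gpoly_point_in_GL[OF inf \<phi>] by blast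
  have gp: "g \<in> mat_pairs n m" by (rule GL_pairs_mat_pairs[OF g(1)])
  let ?s = "\<lambda>t. gmult (shear n m i a t) g"
  let ?\<psi> = "\<lambda>g. \<phi> g * det_pair n m g"
  have "gpoly n m ?\<psi>" using \<phi> nonzero_gpoly_det_pair[of n m] unfolding nonzero_gpoly_def by (blast intro: gpoly_mult)
  then have "polyfun (\<lambda>t. ?\<psi> (?s t))" by (rule gpoly_along_curve) (rule polyfun_shear_gmult[OF gp])
  moreover have "?s 0 = g" using gp by (auto simp: shear_0 gmult_def)
  then have "?\<psi> (?s 0) \<noteq> 0" using g GL_pairs_iff_det_pair[OF gp] by simp
  ultimately have fin: "finite {t. ?\<psi> (?s t) = 0}" by (rule polyfun_finite_zeros)
  let ?J = "act n m g ` J"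
  have same: "lead_set (act n m (shear n m i a t) ` ?J) = lead_set ?J" if t: "t \<notin> {t. ?\<psi> (?s t) = 0}" for t
  proof -
    have nz: "\<phi> (?s t) \<noteq> 0" "det_pair n m (?s t) \<noteq> 0" using t by auto
    have "?s t \<in> GL n \<times> GL m"
      using GL_pairs_iff_det_pair[OF gmult_mat_pairs[OF shear_mat_pairs gp]] nz(2) by blast
    then have "lead_set (act n m (?s t) ` J) = L" by (rule L[OF _ nz(1)])
    moreover have "act n m (?s t) ` J = act n m (shear n m i a t) ` ?J"
      unfolding image_image
      by (rule image_cong[OF refl]) (rule act_act[OF shear_mat_pairs gp poly_idealD(1)[OF bigradedD(1)[OF J]], symmetric])
    ultimately show ?thesis unfolding L[OF g] by (simp only:)
  qed
  have "x_mon a + w \<in> lead_set ?J" using xw L[OF g] by simp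
  from lead_set_shear_stable[OF inf char bigraded_act[OF J g(1)] fin same ia this]
  show ?thesis unfolding L[OF g] .
qed

text \<open>The monomials outside \<open>L\<close> that \<open>x\<^sub>a\<close> carries into \<open>L\<close> are multiples of finitely many of them, say
  \<open>u q\<close>. A factor \<open>x\<^sub>i\<close> of \<open>u\<close> would give \<open>x\<^sub>i q \<in> L\<close> by stability, and then \<open>u q \<in> L\<close>; so \<open>u\<close> has
  \<open>x\<close>-degree \<open>0\<close>.\<close>

lemma strongly_stable_x_filter_regular:
  assumes L: "mon_upset n m L"
    and stable: "\<And>i a w. i < a \<Longrightarrow> a < n \<Longrightarrow> x_mon a + w \<in> L \<Longrightarrow> x_mon i + w \<in> L"
  shows "x_filter_regular n m L"
  unfolding x_filter_regular_def
proof (intro allI impI)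
  fix a assume a: "a < n"
  let ?Q = "{w \<in> mons (Suc a) m. w \<notin> L \<and> x_mon a + w \<in> L}"
  obtain Q0 where Q0: "Q0 \<subseteq> ?Q" "finite Q0"
    "\<And>w. w \<in> ?Q \<Longrightarrow> \<exists>q\<in>Q0. \<exists>u\<in>mons (Suc a) m. w = u + q"
    using dickson[of ?Q "Suc a" m] by blast
  have "\<exists>B. \<forall>q\<in>Q0. fst (bideg q) \<le> B"
    using Q0(2) by (metis finite_imageI Max_ge imageI)
  then obtain B where B: "\<And>q. q \<in> Q0 \<Longrightarrow> fst (bideg q) \<le> B" by blast
  have "w \<in> L" if w: "w \<in> mons (Suc a) m" "fst (bideg w) > B" "x_mon a + w \<in> L" for w
  proof (rule ccontr)
    assume "w \<notin> L"
    then obtain q u where q: "q \<in> Q0" "u \<in> mons (Suc a) m" "w = u + q" using Q0(3)[of w] w by blast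
    have "fst (bideg u) \<noteq> 0" using B[OF q(1)] w(2) q(3) by (auto simp: bideg_add)
    then have "fst u \<noteq> 0" by (auto simp: bideg_def)
    then obtain i where i: "i \<in> keys (fst u)" by (metis ex_in_conv keys_eq_empty)
    have ia: "i \<le> a" using i q(2) by (auto simp: mons_def)
    define u' where "u' = (fst u - Poly_Mapping.single i 1, snd u)"
    have "lookup (fst u) i > 0" using i by (simp add: in_keys_iff)
    then have u: "u = x_mon i + u'" using single_split by (simp add: prod_eq_iff x_mon_def u'_def)
    have "u \<in> mons n m" using q(2) mons_mono[of "Suc a" n m m] a by auto
    then have u'm: "u' \<in> mons n m" unfolding u by (simp only: mons_add)
    have qQ: "q \<notin> L" "x_mon a + q \<in> L" using q(1) Q0(1) by blast+
    have "x_mon i + q \<in> L"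
      using stable[OF _ a qQ(2)] qQ(2) ia by (cases "i = a") simp_all
    then have "u' + (x_mon i + q) \<in> L" using L u'm unfolding mon_upset_def by blast
    then show False using \<open>w \<notin> L\<close> unfolding q(3) u by (metis add.assoc add.commute)
  qed
  then show "\<exists>B. \<forall>w\<in>mons (Suc a) m. fst (bideg w) > B \<longrightarrow> x_mon a + w \<in> L \<longrightarrow> w \<in> L" by blast
qed


section \<open>The regularity of the bigeneric initial ideal\<close>

theorem proposition4p2:
  fixes n m :: nat and J :: "'k::field bipoly set"
  assumes "infinite (UNIV :: 'k set)"
    and "CHAR('k) = 0"
    and "bigraded_ideal n m J"
  shows "reg_x_quot n m J = reg_x_quot n m (bigin n m J)"
proof -
  note inf = assms(1)
  have J: "bigraded n m J" using assms(3) unfolding bigraded_ideal_iff .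
  obtain \<phi> L where \<phi>: "nonzero_gpoly n m \<phi>"
    and L: "\<And>g. g \<in> GL n \<times> GL m \<Longrightarrow> \<phi> g \<noteq> 0 \<Longrightarrow> lead_set (act n m g ` J) = L"
    using generic_leads_exist[OF inf J] by metis
  obtain g where g: "g \<in> GL n \<times> GL m" "\<phi> g \<noteq> 0" using nonzero_gpoly_point_in_GL[OF inf \<phi>] by blast
  note Jg = bigraded_act[OF J g(1)]
  have up: "mon_upset n m L" using mon_upset_lead_set[OF bigradedD(1)[OF Jg]] unfolding L[OF g] .
  have reg: "x_filter_regular n m L"
  proof (rule strongly_stable_x_filter_regular[OF up])
    show "x_mon i + w \<in> L" if "i < a" "a < n" "x_mon a + w \<in> L" for i a w
      by (rule generic_leads_strongly_stable[OF inf assms(2) J \<phi> _ that]) (rule L)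
  qed
  obtain rk sh D A where res: "is_res n m J rk sh D A"
    and J_eq: "reg_x_quot n m J = Sup {ereal (real_of_int a) | a i b. tor_nonzero rk sh D i (a + int i, b)}"
    using reg_x_quot_from_resolution[OF J] by (elim exE conjE)
  have J_bound: "(\<forall>a i b. tor_nonzero rk sh D i (a + int i, b) \<longrightarrow> a \<le> r) \<longleftrightarrow> x_reg_le n m L r" for r
  proof -
    have "x_filter_regular n m (lead_set (act n m g ` J))" using reg unfolding L[OF g] .
    from tor_bound_by_leads[OF Jg is_res_act[OF J g(1) res] this, of r]
    show ?thesis unfolding tor_nonzero_act[OF J g(1) res] L[OF g] .
  qed
  let ?I = "mon_ideal L :: 'k bipoly set"
  note I = bigraded_mon_ideal[OF up, where 'a = 'k]
  obtain rk' sh' D' A' where res': "is_res n m ?I rk' sh' D' A'"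
    and I_eq: "reg_x_quot n m ?I = Sup {ereal (real_of_int a) | a i b. tor_nonzero rk' sh' D' i (a + int i, b)}"
    using reg_x_quot_from_resolution[OF I] by (elim exE conjE)
  have I_bound: "(\<forall>a i b. tor_nonzero rk' sh' D' i (a + int i, b) \<longrightarrow> a \<le> r) \<longleftrightarrow> x_reg_le n m L r" for r
  proof -
    have "x_filter_regular n m (lead_set ?I)" using reg unfolding lead_set_mon_ideal .
    from tor_bound_by_leads[OF I res' this, of r] show ?thesis unfolding lead_set_mon_ideal .
  qed
  have "Sup {ereal (real_of_int a) | a. \<exists>i b. tor_nonzero rk sh D i (a + int i, b)}
      = Sup {ereal (real_of_int a) | a. \<exists>i b. tor_nonzero rk' sh' D' i (a + int i, b)}"
  proof (rule Sup_ereal_int_eq)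
    show "(\<forall>a. (\<exists>i b. tor_nonzero rk sh D i (a + int i, b)) \<longrightarrow> a \<le> r) \<longleftrightarrow>
        (\<forall>a. (\<exists>i b. tor_nonzero rk' sh' D' i (a + int i, b)) \<longrightarrow> a \<le> r)" for r
      using J_bound[of r] I_bound[of r] by blast
  qed
  moreover have "{ereal (real_of_int a) | a i b. P a i b} = {ereal (real_of_int a) | a. \<exists>i b. P a i b}"
    for P :: "int \<Rightarrow> nat \<Rightarrow> int \<Rightarrow> bool" by blast
  ultimately have "reg_x_quot n m J = reg_x_quot n m ?I" unfolding J_eq I_eq by metis
  moreover have "bigin n m J = ?I" by (rule bigin_eq[OF inf J \<phi>]) (rule L)
  ultimately show ?thesis by (simp only:)
qed

end
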